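(* Let $k$ be a field and let $H=(H,\Delta,\varepsilon,\Phi,\alpha,\beta,S)$ be a finite-dimensional quasi-Hopf algebra over $k$. Let $\{e_i\}_{i\in I}$ be a basis of $H$ and $\{e^i\}_{i\in I}$ its dual basis of $H^*$. Let $\mathcal{H}_1(H)$ be the first Heisenberg double of $H$, and let $\tilde V=\tilde V^1\otimes\tilde V^2\in H\otimes H$ be the element $\tilde V=S(\tilde p^2)f^1\otimes S(\tilde p^1)f^2$ (all defined in the context). Put $$\bar W=\sum_{i\in I}(e_i\#\varepsilon)\otimes(1_H\# e^i),\qquad \hat W=\sum_{i\in I}(S(\tilde V^2e_i)\#\varepsilon)\otimes(\tilde V^1\# e^i)\quad\text{in }\mathcal{H}_1(H)^{\otimes 2},$$ and $$(\overline{\boldsymbol{\Phi}}^{-1})^{321}=(x^3\#\varepsilon)\otimes(x^2\#\varepsilon)\otimes(x^1\#\varepsilon),\qquad \overline{\boldsymbol{\Phi}}_S=(S(X^1)\#\varepsilon)\otimes(S(X^2)\#\varepsilon)\otimes(S(X^3)\#\varepsilon)\quad\text{in }\mathcal{H}_1(H)^{\otimes 3},$$ where $\Phi=X^1\otimes X^2\otimes X^3$ and $\Phi^{-1}=x^1\otimes x^2\otimes x^3$. Then, in $\mathcal{H}_1(H)^{\otimes 3}$, $$\bar W_{23}\bar W_{13}\bar W_{12}=(\overline{\boldsymbol{\Phi}}^{-1})^{321}\bar W_{12}\bar W_{23},\qquad \hat W_{12}\hat W_{13}\hat W_{23}=\hat W_{23}\hat W_{12}\overline{\boldsymbol{\P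hi}}_S.$$
   Context: All algebras, spaces and maps are $k$-linear, $\otimes=\otimes_k$. Quasi-bialgebra: a unital associative algebra $H$ with an invertible $\Phi\in H^{\otimes3}$ and algebra maps $\Delta:H\to H\otimes H$, $\varepsilon:H\to k$ such that for all $h\in H$: $(\mathrm{Id}\otimes\Delta)(\Delta(h))=\Phi(\Delta\otimes\mathrm{Id})(\Delta(h))\Phi^{-1}$; $(\mathrm{Id}\otimes\varepsilon)(\Delta(h))=h=(\varepsilon\otimes\mathrm{Id})(\Delta(h))$; $(1\otimes\Phi)(\mathrm{Id}\otimes\Delta\otimes\mathrm{Id})(\Phi)(\Phi\otimes1)=(\mathrm{Id}\otimes\mathrm{Id}\otimes\Delta)(\Phi)(\Delta\otimes\mathrm{Id}\otimes\mathrm{Id})(\Phi)$; $(\mathrm{Id}\otimes\varepsilon\otimes\mathrm{Id})(\Phi)=1\otimes1$. Quasi-Hopf algebra: a quasi-bialgebra with an anti-algebra map $S:H\to H$ and $\alpha,\beta\in H$ such that $S(h_1)\alpha h_2=\varepsilon(h)\alpha$, $h_1\beta S(h_2)=\varepsilon(h)\beta$ for all $h$, and $X^1\beta S(X^2)\alpha X^3=1_H$, $S(x^1)\alpha x^2\beta S(x^3)=1_H$. Notation (summation suppressed): $\Delta(h)=h_1\otimes h_2$, $\Phi=X^1\otimes X^2\otimes X^3$, $\Phi^{-1}=x^1\otimes x^2\otimes x^3$; $\Delta^{\mathrm{cop}}(h)=h_2\otimes h_1$; $X^1_1\otimes X^1_2=\Delta(X^1)$, etc. When $H$ is finite-dimensional,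 $S$ is bijective (known fact). Drinfel'd twist: with $\gamma=S(X^2x^1_2)\alpha X^3x^2\otimes S(X^1x^1_1)\alpha x^3$, the invertible element $f=f^1\otimes f^2\in H\otimes H$ is $f=(S\otimes S)(\Delta^{\mathrm{cop}}(x^1))\,\gamma\,\Delta(x^2\beta S(x^3))$. Put $p_L=\tilde p^1\otimes\tilde p^2=X^2S^{-1}(X^1\beta)\otimes X^3$ and $\tilde V=\tilde V^1\otimes\tilde V^2=S(\tilde p^2)f^1\otimes S(\tilde p^1)f^2$. Right action of $H$ on $H^*$: $(\xi\leftharpoonup h)(a)=\xi(ha)$. Convolution: $(\xi*\nu)(a)=\xi(a_1)\nu(a_2)$. First Heisenberg double $\mathcal{H}_1(H)$ of $H$: the vector space $H\otimes H^*$, with $a\otimes\xi$ written $a\#\xi$, and the (in general nonassociative) multiplication $$(a\#\xi)(b\#\nu)=ab_1x^1\,\#\,(\xi\leftharpoonup b_2x^2)*(\nu\leftharpoonup x^3),$$ with unit $1_H\#\varepsilon$ (it also carries the left $H$-action $h\triangleright(a\#\xi)=a\#(h\rightharpoonup\xi)$, $(h\rightharpoonup\xi)(a)=\xi(ah)$, making it an algebra in the monoidal category of left $H$-modules). Tensor powers of $\mathcal{H}_1(H)$ are multiplied componentwise. For $A=\sum a\otimes a'\in\mathcal{H}_1(H)^{\otimes2}$, $A_{ij}\in\mathcal{H}_1(H)^{\otimes3}$ ($i<j$) has $a$ in slot $i$, $a'$ in slot $j$ and the unit $1_H\#\varepsilon$ in the remaining slot. In all triple products in the claim the two bracketings $(AB)C$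 and $A(BC)$ coincide (the product of three elements $a\#\xi,b\#\nu,c\#\zeta$ of $\mathcal{H}_1(H)$ is independent of bracketing if one of $\xi,\nu,\zeta$ is $\varepsilon$), so brackets are omitted. *)

theory Defs
  imports Complex_Main "HOL-Library.Poly_Mapping" "HOL-Library.Function_Algebras"
begin

section \<open>Tensor products\<close>

text \<open>
  A tensor is written down as a finite list of pure tensors, read as their sum, so that
  Sweedler notation becomes list comprehension: \<open>[(a, b1, b2). (a, b) \<leftarrow> \<Delta> h, (b1, b2) \<leftarrow> \<Delta> b]\<close>
  is \<open>h\<^sub>1 \<otimes> \<Delta>(h\<^sub>2)\<close>. Scalars are absorbed into the entries. The element of the tensor product
  that a list denotes is its coset in the usual quotient of the free vector space on the
  pure tensors by the multilinearity relations. Equations between tensors are always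
  equations between these cosets, never between lists.
\<close>

definition free_scale :: "'k::field \<Rightarrow> ('p \<Rightarrow>\<^sub>0 'k) \<Rightarrow> ('p \<Rightarrow>\<^sub>0 'k)" where
  "free_scale c = Poly_Mapping.map ((*) c)"

definition formal_sum :: "'p list \<Rightarrow> ('p \<Rightarrow>\<^sub>0 'k::field)" where
  "formal_sum ps = (\<Sum>p\<leftarrow>ps. Poly_Mapping.single p 1)"

text \<open>
  A \<open>slot\<close> is a map \<open>x \<mapsto> (\<dots>, x, \<dots>)\<close> that puts a vector into one factor of a pure tensor whose
  other entries are fixed. The following are the generators of the subspace that has to be
  divided out for every slot in \<open>A\<close> to become linear on the subspace \<open>U\<close>.
\<close>

definition linearity_rels ::
  "('k::field \<Rightarrow> 'v::ab_group_add \<Rightarrow> 'v) \<Rightarrow> 'v set \<Rightarrow> ('v \<Rightarrow> 'p) set \<Rightarrow> ('p \<Rightarrow>\<^sub>0 'k) set" where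
  "linearity_rels scale U A =
     {Poly_Mapping.single (i (x + y)) 1 - Poly_Mapping.single (i x) 1 - Poly_Mapping.single (i y) 1
       | i x y. i \<in> A \<and> x \<in> U \<and> y \<in> U} \<union>
     {Poly_Mapping.single (i (scale c x)) 1 - free_scale c (Poly_Mapping.single (i x) 1)
       | i c x. i \<in> A \<and> x \<in> U}"

definition tensor_class :: "('p \<Rightarrow>\<^sub>0 'k::field) set \<Rightarrow> 'p list \<Rightarrow> ('p \<Rightarrow>\<^sub>0 'k) set" where
  "tensor_class R ps = {q. q - formal_sum ps \<in> module.span free_scale R}"

text \<open>
  Slots of a pair: \<open>A\<close>, \<open>B\<close> are the slots and \<open>P\<close>, \<open>Q\<close> the admissible entries of the first and
  the second component. Longer tuples are right-nested pairs.
\<close>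

definition pair_slots :: "('v \<Rightarrow> 'p) set \<Rightarrow> 'p set \<Rightarrow> ('v \<Rightarrow> 'q) set \<Rightarrow> 'q set \<Rightarrow> ('v \<Rightarrow> 'p \<times> 'q) set" where
  "pair_slots A P B Q =
     {\<lambda>x. (i x, q) | i q. i \<in> A \<and> q \<in> Q} \<union> {\<lambda>x. (p, j x) | p j. p \<in> P \<and> j \<in> B}"

definition slots2 :: "('v \<Rightarrow> 'v \<times> 'v) set" where
  "slots2 = pair_slots {\<lambda>x. x} UNIV {\<lambda>x. x} UNIV"

definition slots3 :: "('v \<Rightarrow> 'v \<times> 'v \<times> 'v) set" where
  "slots3 = pair_slots {\<lambda>x. x} UNIV slots2 UNIV"

definition slots4 :: "('v \<Rightarrow> 'v \<times> 'v \<times> 'v \<times> 'v) set" where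
  "slots4 = pair_slots {\<lambda>x. x} UNIV slots3 UNIV"

definition tensor2 ::
  "('k::field \<Rightarrow> 'v::ab_group_add \<Rightarrow> 'v) \<Rightarrow> ('v \<times> 'v) list \<Rightarrow> ('v \<times> 'v \<Rightarrow>\<^sub>0 'k) set" where
  "tensor2 scale = tensor_class (linearity_rels scale UNIV slots2)"

definition tensor3 ::
  "('k::field \<Rightarrow> 'v::ab_group_add \<Rightarrow> 'v) \<Rightarrow> ('v \<times> 'v \<times> 'v) list \<Rightarrow> ('v \<times> 'v \<times> 'v \<Rightarrow>\<^sub>0 'k) set" where
  "tensor3 scale = tensor_class (linearity_rels scale UNIV slots3)"

definition tensor4 ::
  "('k::field \<Rightarrow> 'v::ab_group_add \<Rightarrow> 'v) \<Rightarrow> ('v \<times> 'v \<times> 'v \<times> 'v) list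
    \<Rightarrow> ('v \<times> 'v \<times> 'v \<times> 'v \<Rightarrow>\<^sub>0 'k) set" where
  "tensor4 scale = tensor_class (linearity_rels scale UNIV slots4)"

fun mult2 :: "('h::ring_1 \<times> 'h) list \<Rightarrow> ('h \<times> 'h) list \<Rightarrow> ('h \<times> 'h) list" where
  "mult2 s t = [(a * a', b * b'). (a, b) \<leftarrow> s, (a', b') \<leftarrow> t]"

fun mult3 :: "('h::ring_1 \<times> 'h \<times> 'h) list \<Rightarrow> ('h \<times> 'h \<times> 'h) list \<Rightarrow> ('h \<times> 'h \<times> 'h) list" where
  "mult3 s t = [(a * a', b * b', c * c'). (a, b, c) \<leftarrow> s, (a', b', c') \<leftarrow> t]"

fun mult4 :: "('h::ring_1 \<times> 'h \<times> 'h \<times> 'h) list \<Rightarrow> ('h \<times> 'h \<times> 'h \<times> 'h) list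
    \<Rightarrow> ('h \<times> 'h \<times> 'h \<times> 'h) list" where
  "mult4 s t = [(a * a', b * b', c * c', d * d'). (a, b, c, d) \<leftarrow> s, (a', b', c', d') \<leftarrow> t]"


section \<open>Dual space and bases\<close>

definition dual :: "('k::field \<Rightarrow> 'v::ab_group_add \<Rightarrow> 'v) \<Rightarrow> ('v \<Rightarrow> 'k) set" where
  "dual scale = {\<xi>. Vector_Spaces.linear scale (*) \<xi>}"

definition dual_scale :: "'k::field \<Rightarrow> ('v \<Rightarrow> 'k) \<Rightarrow> ('v \<Rightarrow> 'k)" where
  "dual_scale c \<xi> = (\<lambda>a. c * \<xi> a)"

definition basis_family ::
  "('k::field \<Rightarrow> 'v::ab_group_add \<Rightarrow> 'v) \<Rightarrow> 'i set \<Rightarrow> ('i \<Rightarrow> 'v) \<Rightarrow> bool" where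
  "basis_family scale I e \<longleftrightarrow>
     inj_on e I \<and> \<not> module.dependent scale (e ` I) \<and> module.span scale (e ` I) = UNIV"

definition dual_basis_family ::
  "('k::field \<Rightarrow> 'v::ab_group_add \<Rightarrow> 'v) \<Rightarrow> 'i set \<Rightarrow> ('i \<Rightarrow> 'v) \<Rightarrow> ('i \<Rightarrow> 'v \<Rightarrow> 'k) \<Rightarrow> bool" where
  "dual_basis_family scale I e e' \<longleftrightarrow>
     (\<forall>i\<in>I. e' i \<in> dual scale \<and> (\<forall>j\<in>I. e' i (e j) = (if i = j then 1 else 0)))"

text \<open>
  An arbitrary enumeration of a finite index set, used to write a sum over \<open>I\<close> as a list.
  The class of the resulting tensor does not depend on the choice.
\<close>

definition enum_list :: "'i set \<Rightarrow> 'i list" where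
  "enum_list I = (SOME is. set is = I \<and> distinct is)"


section \<open>Quasi-bialgebras and quasi-Hopf algebras\<close>

locale unital_algebra = vector_space scale
  for scale :: "'k::field \<Rightarrow> 'h::ring_1 \<Rightarrow> 'h" (infixr \<open>*s\<close> 75) +
  assumes scale_mult_left: "(c *s a) * b = c *s (a * b)"
    and scale_mult_right: "a * (c *s b) = c *s (a * b)"

text \<open>
  \<open>\<Delta> h\<close>, \<open>\<Phi>\<close> and \<open>\<Phi>'\<close> are representatives of the coproduct of \<open>h\<close>, of the associator and of its
  inverse. The class \<open>ring_1\<close> only excludes the zero algebra, which has no counit.
\<close>

locale quasi_bialgebra = unital_algebra scale
  for scale :: "'k::field \<Rightarrow> 'h::ring_1 \<Rightarrow> 'h" (infixr \<open>*s\<close> 75) +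
  fixes \<Delta> :: "'h \<Rightarrow> ('h \<times> 'h) list"
    and \<epsilon> :: "'h \<Rightarrow> 'k"
    and \<Phi> \<Phi>' :: "('h \<times> 'h \<times> 'h) list"
  assumes assoc_right_inverse: "tensor3 scale (mult3 \<Phi> \<Phi>') = tensor3 scale [(1, 1, 1)]"
    and assoc_left_inverse: "tensor3 scale (mult3 \<Phi>' \<Phi>) = tensor3 scale [(1, 1, 1)]"
    and comult_add: "tensor2 scale (\<Delta> (a + b)) = tensor2 scale (\<Delta> a @ \<Delta> b)"
    and comult_scale: "tensor2 scale (\<Delta> (c *s a)) = tensor2 scale [(c *s a1, a2). (a1, a2) \<leftarrow> \<Delta> a]"
    and comult_mult: "tensor2 scale (\<Delta> (a * b)) = tensor2 scale (mult2 (\<Delta> a) (\<Delta> b))"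
    and comult_one: "tensor2 scale (\<Delta> 1) = tensor2 scale [(1, 1)]"
    and counit_linear: "Vector_Spaces.linear scale (*) \<epsilon>"
    and counit_mult: "\<epsilon> (a * b) = \<epsilon> a * \<epsilon> b"
    and counit_one: "\<epsilon> 1 = 1"
    and quasi_coassoc:
      "tensor3 scale [(h1, h21, h22). (h1, h2) \<leftarrow> \<Delta> h, (h21, h22) \<leftarrow> \<Delta> h2] =
       tensor3 scale
         (mult3 (mult3 \<Phi> [(h11, h12, h2). (h1, h2) \<leftarrow> \<Delta> h, (h11, h12) \<leftarrow> \<Delta> h1]) \<Phi>')"
    and counit_right: "(\<Sum>(h1, h2)\<leftarrow>\<Delta> h. \<epsilon> h2 *s h1) = h"
    and counit_left: "(\<Sum>(h1, h2)\<leftarrow>\<Delta> h. \<epsilon> h1 *s h2) = h"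
    and pentagon:
      "tensor4 scale
         (mult4
           (mult4 [(1, X1, X2, X3). (X1, X2, X3) \<leftarrow> \<Phi>]
             [(X1, X21, X22, X3). (X1, X2, X3) \<leftarrow> \<Phi>, (X21, X22) \<leftarrow> \<Delta> X2])
           [(X1, X2, X3, 1). (X1, X2, X3) \<leftarrow> \<Phi>]) =
       tensor4 scale
         (mult4 [(X1, X2, X31, X32). (X1, X2, X3) \<leftarrow> \<Phi>, (X31, X32) \<leftarrow> \<Delta> X3]
           [(X11, X12, X2, X3). (X1, X2, X3) \<leftarrow> \<Phi>, (X11, X12) \<leftarrow> \<Delta> X1])"
    and assoc_counit: "tensor2 scale [(\<epsilon> X2 *s X1, X3). (X1, X2, X3) \<leftarrow> \<Phi>] = tensor2 scale [(1, 1)]"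

locale quasi_hopf_algebra = quasi_bialgebra scale \<Delta> \<epsilon> \<Phi> \<Phi>'
  for scale :: "'k::field \<Rightarrow> 'h::ring_1 \<Rightarrow> 'h" (infixr \<open>*s\<close> 75)
    and \<Delta> :: "'h \<Rightarrow> ('h \<times> 'h) list"
    and \<epsilon> :: "'h \<Rightarrow> 'k"
    and \<Phi> \<Phi>' :: "('h \<times> 'h \<times> 'h) list" +
  fixes \<alpha> \<beta> :: 'h
    and S :: "'h \<Rightarrow> 'h"
  assumes antipode_linear: "Vector_Spaces.linear scale scale S"
    and antipode_mult: "S (a * b) = S b * S a"
    and antipode_one: "S 1 = 1"
    and antipode_alpha: "(\<Sum>(h1, h2)\<leftarrow>\<Delta> h. S h1 * \<alpha> * h2) = \<epsilon> h *s \<alpha>"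
    and antipode_beta: "(\<Sum>(h1, h2)\<leftarrow>\<Delta> h. h1 * \<beta> * S h2) = \<epsilon> h *s \<beta>"
    and antipode_assoc: "(\<Sum>(X1, X2, X3)\<leftarrow>\<Phi>. X1 * \<beta> * S X2 * \<alpha> * X3) = 1"
    and antipode_assoc_inv: "(\<Sum>(x1, x2, x3)\<leftarrow>\<Phi>'. S x1 * \<alpha> * x2 * \<beta> * S x3) = 1"


section \<open>The first Heisenberg double\<close>

text \<open>
  Pure tensors \<open>a # \<xi>\<close> of the Heisenberg double \<open>H \<otimes> H\<^sup>*\<close> are pairs \<open>(a, \<xi>)\<close>. Its third tensor power
  is formed as \<open>(H \<otimes> H\<^sup>*) \<otimes> (H \<otimes> H\<^sup>*) \<otimes> (H \<otimes> H\<^sup>*)\<close>, linear in each of the six entries.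
\<close>

definition heis_tensor3 ::
  "('k::field \<Rightarrow> 'h::ring_1 \<Rightarrow> 'h)
    \<Rightarrow> (('h \<times> ('h \<Rightarrow> 'k)) \<times> ('h \<times> ('h \<Rightarrow> 'k)) \<times> ('h \<times> ('h \<Rightarrow> 'k))) list
    \<Rightarrow> (('h \<times> ('h \<Rightarrow> 'k)) \<times> ('h \<times> ('h \<Rightarrow> 'k)) \<times> ('h \<times> ('h \<Rightarrow> 'k)) \<Rightarrow>\<^sub>0 'k) set" where
  "heis_tensor3 scale =
     (let P = UNIV \<times> dual scale;
          A = pair_slots {\<lambda>x. x} UNIV {} (dual scale);
          B = pair_slots {} UNIV {\<lambda>\<xi>. \<xi>} (dual scale)
      in tensor_class
          (linearity_rels scale UNIV (pair_slots A P (pair_slots A P A P) (P \<times> P)) \<union>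
           linearity_rels dual_scale (dual scale) (pair_slots B P (pair_slots B P B P) (P \<times> P))))"

definition leg12 :: "'m \<Rightarrow> ('m \<times> 'm) list \<Rightarrow> ('m \<times> 'm \<times> 'm) list" where
  "leg12 u A = [(a, a', u). (a, a') \<leftarrow> A]"

definition leg13 :: "'m \<Rightarrow> ('m \<times> 'm) list \<Rightarrow> ('m \<times> 'm \<times> 'm) list" where
  "leg13 u A = [(a, u, a'). (a, a') \<leftarrow> A]"

definition leg23 :: "'m \<Rightarrow> ('m \<times> 'm) list \<Rightarrow> ('m \<times> 'm \<times> 'm) list" where
  "leg23 u A = [(u, a, a'). (a, a') \<leftarrow> A]"

definition act_right :: "('h::ring_1 \<Rightarrow> 'k) \<Rightarrow> 'h \<Rightarrow> ('h \<Rightarrow> 'k)" (infixl \<open>\<leftharpoonup>\<close> 75) where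
  "\<xi> \<leftharpoonup> h = (\<lambda>a. \<xi> (h * a))"

context quasi_bialgebra
begin

definition convolution :: "('h \<Rightarrow> 'k) \<Rightarrow> ('h \<Rightarrow> 'k) \<Rightarrow> ('h \<Rightarrow> 'k)" where
  "convolution \<xi> \<nu> = (\<lambda>a. \<Sum>(a1, a2)\<leftarrow>\<Delta> a. \<xi> a1 * \<nu> a2)"

fun heis_mult :: "'h \<times> ('h \<Rightarrow> 'k) \<Rightarrow> 'h \<times> ('h \<Rightarrow> 'k) \<Rightarrow> ('h \<times> ('h \<Rightarrow> 'k)) list" where
  "heis_mult (a, \<xi>) (b, \<nu>) =
     [(a * b1 * x1, convolution (\<xi> \<leftharpoonup> (b2 * x2)) (\<nu> \<leftharpoonup> x3)).
       (b1, b2) \<leftarrow> \<Delta> b, (x1, x2, x3) \<leftarrow> \<Phi>']"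

definition heis_unit :: "'h \<times> ('h \<Rightarrow> 'k)" where
  "heis_unit = (1, \<epsilon>)"

definition heis_mult3 ::
  "(('h \<times> ('h \<Rightarrow> 'k)) \<times> ('h \<times> ('h \<Rightarrow> 'k)) \<times> ('h \<times> ('h \<Rightarrow> 'k))) list
    \<Rightarrow> (('h \<times> ('h \<Rightarrow> 'k)) \<times> ('h \<times> ('h \<Rightarrow> 'k)) \<times> ('h \<times> ('h \<Rightarrow> 'k))) list
    \<Rightarrow> (('h \<times> ('h \<Rightarrow> 'k)) \<times> ('h \<times> ('h \<Rightarrow> 'k)) \<times> ('h \<times> ('h \<Rightarrow> 'k))) list" where
  "heis_mult3 s t =
     [(p, q, r). (m1, m2, m3) \<leftarrow> s, (n1, n2, n3) \<leftarrow> t,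
       p \<leftarrow> heis_mult m1 n1, q \<leftarrow> heis_mult m2 n2, r \<leftarrow> heis_mult m3 n3]"

definition W_bar ::
  "'i set \<Rightarrow> ('i \<Rightarrow> 'h) \<Rightarrow> ('i \<Rightarrow> 'h \<Rightarrow> 'k) \<Rightarrow> (('h \<times> ('h \<Rightarrow> 'k)) \<times> ('h \<times> ('h \<Rightarrow> 'k))) list" where
  "W_bar I e e' = [((e i, \<epsilon>), (1, e' i)). i \<leftarrow> enum_list I]"

definition Phi_inv_321 ::
  "(('h \<times> ('h \<Rightarrow> 'k)) \<times> ('h \<times> ('h \<Rightarrow> 'k)) \<times> ('h \<times> ('h \<Rightarrow> 'k))) list" where
  "Phi_inv_321 = [((x3, \<epsilon>), (x2, \<epsilon>), (x1, \<epsilon>)). (x1, x2, x3) \<leftarrow> \<Phi>']"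

end

context quasi_hopf_algebra
begin

definition gamma :: "('h \<times> 'h) list" where
  "gamma = [(S (X2 * x12) * \<alpha> * X3 * x2, S (X1 * x11) * \<alpha> * x3).
     (X1, X2, X3) \<leftarrow> \<Phi>, (x1, x2, x3) \<leftarrow> \<Phi>', (x11, x12) \<leftarrow> \<Delta> x1]"

definition drinfeld_twist :: "('h \<times> 'h) list" where
  "drinfeld_twist = [(S x12 * g1 * d1, S x11 * g2 * d2).
     (x1, x2, x3) \<leftarrow> \<Phi>', (x11, x12) \<leftarrow> \<Delta> x1, (g1, g2) \<leftarrow> gamma, (d1, d2) \<leftarrow> \<Delta> (x2 * \<beta> * S x3)]"

text \<open>
  \<open>inv S\<close> is the inverse function of \<open>S\<close> because the antipode of a finite-dimensional quasi-Hopf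
  algebra is bijective.
\<close>

definition p_L :: "('h \<times> 'h) list" where
  "p_L = [(X2 * inv S (X1 * \<beta>), X3). (X1, X2, X3) \<leftarrow> \<Phi>]"

definition V_tilde :: "('h \<times> 'h) list" where
  "V_tilde = [(S p2 * f1, S p1 * f2). (p1, p2) \<leftarrow> p_L, (f1, f2) \<leftarrow> drinfeld_twist]"

definition W_hat ::
  "'i set \<Rightarrow> ('i \<Rightarrow> 'h) \<Rightarrow> ('i \<Rightarrow> 'h \<Rightarrow> 'k) \<Rightarrow> (('h \<times> ('h \<Rightarrow> 'k)) \<times> ('h \<times> ('h \<Rightarrow> 'k))) list" where
  "W_hat I e e' = [((S (V2 * e i), \<epsilon>), (V1, e' i)). i \<leftarrow> enum_list I, (V1, V2) \<leftarrow> V_tilde]"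

definition Phi_S ::
  "(('h \<times> ('h \<Rightarrow> 'k)) \<times> ('h \<times> ('h \<Rightarrow> 'k)) \<times> ('h \<times> ('h \<Rightarrow> 'k))) list" where
  "Phi_S = [((S X1, \<epsilon>), (S X2, \<epsilon>), (S X3, \<epsilon>)). (X1, X2, X3) \<leftarrow> \<Phi>]"

end

end

theory Submission
  imports Defs
begin

text \<open>
  Two tensors are equal if and only if all multilinear functionals agree on them, so every identity is
  proved as an identity between Sweedler sums of an arbitrary functional. Evaluating the functional parts
  at \<open>y1\<close>, \<open>y2\<close>, \<open>y3\<close> removes the sums over the basis of \<open>H\<close>. The first identity is then immediate from the
  multiplication of the Heisenberg double. The second one becomes an identity in \<open>H\<close> that relates three
  copies of \<open>V_tilde\<close>, the coproduct and \<open>\<Phi>\<close>. It follows from Drinfeld's formulas for the twist \<open>f\<close>: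
  \<open>f \<Delta>(S h) = (S \<otimes> S)(\<Delta>\<^sup>c\<^sup>o\<^sup>p h) f\<close>, \<open>f \<Delta>(\<alpha>) = \<gamma>\<close>, \<open>\<Delta>(\<beta>) f\<^sup>-\<^sup>1 = \<delta>\<close>, and the statement that twisting by \<open>f\<close> turns \<open>\<Phi>\<close>
  into \<open>(S \<otimes> S \<otimes> S)(\<Phi>\<^sup>3\<^sup>2\<^sup>1)\<close>. The inverse of \<open>S\<close> in \<open>p_L\<close> exists because \<open>S\<close> is injective: a nonzero left
  integral \<open>\<Lambda>\<close> exists, and \<open>S a = 0\<close> forces \<open>\<Lambda> \<otimes> a = 0\<close>.
\<close>

section \<open>Tensors and functionals\<close>

text \<open>The twist f comes from the uniqueness of antipodes up to an invertible element, carried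
  out along the algebra map \<Delta>. Both \<Delta> S with \<Delta>(\<alpha>), \<Delta>(\<beta>) and
  (S \<otimes> S) \<open>\<Delta>\<^sup>c\<^sup>o\<^sup>p\<close> with \<open>gamma\<close>,
  \<open>delta\<close> satisfy the antipode axioms relative to \<Delta>, and f is the comparison
  element of the two. For the second triple these axioms are \<open>gamma_invariant\<close>,
  \<open>delta_invariant\<close>, \<open>P_delta_gamma\<close> and \<open>N_gamma_delta\<close>. The
  obstacle is that every regrouping of a coproduct conjugates by \<Phi>. The pentagon is therefore
  solved for several products of its factors. The typical cancellation picks a form in which two
  adjacent legs surround \<alpha> or \<beta>, contracts them, and lets the resulting counit erase a
  whole associator. The usual formulas for p and for the projection onto integrals contain the
  inverse of S. They are used only after S has been applied to the leg concerned, for example as X1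
  \<beta> S(X2) \<otimes> X3. Hence the calculus of twists and integrals is available before S is
  known to be bijective.\<close>

lemma lookup_free_scale: "Poly_Mapping.lookup (free_scale c q) p = c * Poly_Mapping.lookup q p"
  by (simp add: free_scale_def Poly_Mapping.map.rep_eq when_def)

lemma vector_space_free_scale: "vector_space (free_scale :: 'k::field \<Rightarrow> ('p \<Rightarrow>\<^sub>0 'k) \<Rightarrow> _)"
  by unfold_locales
    (simp_all add: poly_mapping_eq_iff fun_eq_iff lookup_free_scale lookup_add algebra_simps)

lemma vector_space_mult: "vector_space ((*) :: 'k::field \<Rightarrow> 'k \<Rightarrow> 'k)"
  by unfold_locales (simp_all add: algebra_simps)

definition formal_eval :: "('p \<Rightarrow> 'k::field) \<Rightarrow> ('p \<Rightarrow>\<^sub>0 'k) \<Rightarrow> 'k" where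
  "formal_eval F q = (\<Sum>p\<in>Poly_Mapping.keys q. Poly_Mapping.lookup q p * F p)"

lemma formal_eval_superset:
  assumes "finite A" and "Poly_Mapping.keys q \<subseteq> A"
  shows "formal_eval F q = (\<Sum>p\<in>A. Poly_Mapping.lookup q p * F p)"
  unfolding formal_eval_def
  by (rule sum.mono_neutral_left) (use assms in \<open>auto simp: in_keys_iff\<close>)

lemma formal_eval_add: "formal_eval F (q + r) = formal_eval F q + formal_eval F r"
proof -
  let ?A = "Poly_Mapping.keys q \<union> Poly_Mapping.keys r"
  have "Poly_Mapping.keys (q + r) \<subseteq> ?A" by (rule Poly_Mapping.keys_add)
  then show ?thesis
    by (simp add: formal_eval_superset[of ?A] lookup_add distrib_right sum.distrib)
qed

lemma formal_eval_scale: "formal_eval F (free_scale c q) = c * formal_eval F q"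
proof -
  have "Poly_Mapping.keys (free_scale c q) \<subseteq> Poly_Mapping.keys q"
    by (auto simp: in_keys_iff lookup_free_scale)
  then show ?thesis
    by (simp add: formal_eval_superset[of "Poly_Mapping.keys q"] lookup_free_scale
        sum_distrib_left mult.assoc)
qed

lemma linear_mult_iff:
  fixes f :: "'v::ab_group_add \<Rightarrow> 'k::field"
  assumes "vector_space s"
  shows "Vector_Spaces.linear s (*) f \<longleftrightarrow>
    (\<forall>x y. f (x + y) = f x + f y) \<and> (\<forall>c x. f (s c x) = c * f x)"
  unfolding Vector_Spaces.linear_def module_hom_def module_hom_axioms_def
  using assms vector_space_mult[where 'k = 'k] by (simp add: module_iff_vector_space)

lemma linear_formal_eval: "Vector_Spaces.linear free_scale (*) (formal_eval F)"
  by (simp add: linear_mult_iff vector_space_free_scale formal_eval_add formal_eval_scale)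

lemma formal_eval_single [simp]: "formal_eval F (Poly_Mapping.single p c) = c * F p"
  by (simp add: formal_eval_superset[of "{p}"])

lemma formal_eval_formal_sum: "formal_eval F (formal_sum ps) = (\<Sum>p\<leftarrow>ps. F p)"
proof (induction ps)
  case Nil
  show ?case by (simp add: formal_sum_def formal_eval_def)
next
  case (Cons p ps)
  then show ?case by (simp add: formal_sum_def formal_eval_add)
qed

lemma tensor_class_eq_iff:
  "tensor_class R ps = tensor_class R qs \<longleftrightarrow>
   formal_sum ps - formal_sum qs \<in> module.span free_scale R"
proof -
  interpret vector_space "free_scale :: 'b \<Rightarrow> ('a \<Rightarrow>\<^sub>0 'b) \<Rightarrow> _" by (rule vector_space_free_scale)
  show ?thesis
  proof
    assume "tensor_class R ps = tensor_class R qs"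
    moreover have "formal_sum ps \<in> tensor_class R ps"
      by (simp add: tensor_class_def span_zero)
    ultimately show "formal_sum ps - formal_sum qs \<in> span R"
      by (simp add: tensor_class_def)
  next
    assume *: "formal_sum ps - formal_sum qs \<in> span R"
    have "q - formal_sum ps \<in> span R \<longleftrightarrow> q - formal_sum qs \<in> span R" for q
    proof -
      have "q - formal_sum qs = (q - formal_sum ps) + (formal_sum ps - formal_sum qs)" by simp
      then show ?thesis using span_add_eq2[OF *, of "q - formal_sum ps"] by simp
    qed
    then show "tensor_class R ps = tensor_class R qs" by (simp add: tensor_class_def)
  qed
qed

lemma tensor_class_eq_D:
  assumes "tensor_class R ps = tensor_class R qs" and "\<And>r. r \<in> R \<Longrightarrow> formal_eval F r = 0"
  shows "(\<Sum>p\<leftarrow>ps. F p) = (\<Sum>p\<leftarrow>qs. F p)"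
proof -
  interpret L: Vector_Spaces.linear "free_scale" "(*)" "formal_eval F" by (rule linear_formal_eval)
  have "formal_eval F (formal_sum ps - formal_sum qs) = 0"
    using assms L.eq_0_on_span by (auto simp: tensor_class_eq_iff)
  then show ?thesis by (simp add: L.diff formal_eval_formal_sum)
qed

text \<open>A point is separated from a subspace: if the difference of the two formal sums lay
  outside the span of \<open>R\<close>, some functional would vanish on \<open>R\<close> and be 1 on
  the difference. On a free space a functional is the linear extension of its values on pure
  tensors, hence of the form \<open>formal_eval F\<close>.\<close>

lemma tensor_class_eqI:
  fixes ps qs :: "'p list" and R :: "('p \<Rightarrow>\<^sub>0 'k::field) set"
  assumes "\<And>F. (\<And>r. r \<in> R \<Longrightarrow> formal_eval F r = 0) \<Longrightarrow> (\<Sum>p\<leftarrow>ps. F p) = (\<Sum>p\<leftarrow>qs. F p)"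
  shows "tensor_class R ps = tensor_class R qs"
proof (rule ccontr)
  interpret vector_space_pair "free_scale :: 'k \<Rightarrow> ('p \<Rightarrow>\<^sub>0 'k) \<Rightarrow> _" "(*) :: 'k \<Rightarrow> _"
    by (simp add: vector_space_pair_def vector_space_free_scale vector_space_mult)
  let ?d = "formal_sum ps - formal_sum qs"
  assume "tensor_class R ps \<noteq> tensor_class R qs"
  then have d: "?d \<notin> vs1.span R" by (simp add: tensor_class_eq_iff)
  obtain B where B: "B \<subseteq> R" "vs1.independent B" "R \<subseteq> vs1.span B"
    by (rule vs1.maximal_independent_subset)
  have "vs1.span R = vs1.span B"
    using B by (metis vs1.span_mono vs1.span_span subset_antisym)
  with d have d': "?d \<notin> vs1.span B" by simp
  then have "vs1.independent (insert ?d B)" by (simp add: vs1.independent_insertI B)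
  then obtain g where g: "Vector_Spaces.linear free_scale (*) g"
    and gB: "\<forall>x\<in>insert ?d B. g x = (if x = ?d then 1 else 0)"
    using linear_independent_extend[of _ "\<lambda>x. if x = ?d then 1 else 0"] by blast
  interpret g: Vector_Spaces.linear free_scale "(*)" g by (rule g)
  define F where "F p = g (Poly_Mapping.single p 1)" for p
  have g_sum: "g (formal_sum xs) = (\<Sum>p\<leftarrow>xs. F p)" for xs
    by (induction xs) (simp_all add: formal_sum_def F_def g.add g.zero)
  have g_eval: "g q = formal_eval F q" for q
  proof (induction q rule: update_induct)
    case const
    show ?case by (simp add: g.zero formal_eval_def)
  next
    case (update q p c)
    have "Poly_Mapping.update p c q = q + free_scale c (Poly_Mapping.single p 1)"
      using update by (auto simp: poly_mapping_eq_iff fun_eq_iff lookup_free_scale lookup_single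
          lookup_update lookup_add when_def in_keys_iff)
    then show ?case
      by (simp add: g.add g.scale formal_eval_add formal_eval_scale update.IH F_def)
  qed
  have "g r = 0" if "r \<in> R" for r
  proof -
    have "g x = 0" if "x \<in> B" for x using gB d' that vs1.span_base by force
    then show ?thesis using B(3) that g.eq_0_on_span by blast
  qed
  then have "(\<Sum>p\<leftarrow>ps. F p) = (\<Sum>p\<leftarrow>qs. F p)" using assms by (simp add: g_eval)
  then have "g ?d = 0" by (simp add: g.diff g_sum)
  with gB show False by simp
qed

section \<open>Sweedler sums\<close>

text \<open>
  The index \<open>i\<close> of a sum has no meaning. It only names the sum, so that the rewrite rules
  \<open>sum_sort\<close> can bring independent nested sums into a canonical order.
\<close>

definition sum2 :: "nat \<Rightarrow> ('a \<times> 'b) list \<Rightarrow> ('a \<Rightarrow> 'b \<Rightarrow> 'k::comm_semiring_0) \<Rightarrow> 'k" where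
  "sum2 i L F = (\<Sum>(a, b)\<leftarrow>L. F a b)"

definition sum3 :: "nat \<Rightarrow> ('a \<times> 'b \<times> 'c) list \<Rightarrow> ('a \<Rightarrow> 'b \<Rightarrow> 'c \<Rightarrow> 'k::comm_semiring_0) \<Rightarrow> 'k" where
  "sum3 i L F = (\<Sum>(a, b, c)\<leftarrow>L. F a b c)"

definition sum4 :: "('a \<times> 'b \<times> 'c \<times> 'd) list \<Rightarrow> ('a \<Rightarrow> 'b \<Rightarrow> 'c \<Rightarrow> 'd \<Rightarrow> 'k::comm_semiring_0) \<Rightarrow> 'k" where
  "sum4 L F = (\<Sum>(a, b, c, d)\<leftarrow>L. F a b c d)"

text \<open>Input syntax of low priority that nests to the right, so that iterated Sweedler sums
  need no closing brackets.\<close>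

abbreviation (input) apply_to :: "('a \<Rightarrow> 'b) \<Rightarrow> 'a \<Rightarrow> 'b"  (\<open>_ $ _\<close> [4, 3] 3) where
  "(f $ x) \<equiv> f x"

lemma sum_list_swap:
  fixes F :: "'a \<Rightarrow> 'b \<Rightarrow> 'k::comm_semiring_0"
  shows "(\<Sum>x\<leftarrow>xs. \<Sum>y\<leftarrow>ys. F x y) = (\<Sum>y\<leftarrow>ys. \<Sum>x\<leftarrow>xs. F x y)"
  by (induction xs) (simp_all add: sum_list_addf)

lemma sum_list_map_concat_map:
  fixes F :: "'a \<Rightarrow> 'k::comm_semiring_0"
  shows "(\<Sum>y\<leftarrow>concat (map G xs). F y) = (\<Sum>x\<leftarrow>xs. \<Sum>y\<leftarrow>G x. F y)"
  by (induction xs) simp_all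

lemma sum2_Nil [simp]: "sum2 i [] F = 0" and sum3_Nil [simp]: "sum3 i [] G = 0"
  by (simp_all add: sum2_def sum3_def)

lemma sum2_Cons [simp]: "sum2 i ((a, b) # L) F = F a b + sum2 i L F"
  and sum3_Cons [simp]: "sum3 i ((a, b, c) # M) G = G a b c + sum3 i M G"
  by (simp_all add: sum2_def sum3_def)

lemma sum2_append: "sum2 i (L @ M) F = sum2 i L F + sum2 i M F"
  by (simp add: sum2_def)

text \<open>The condition \<open>j < i\<close> is decided on numerals and keeps the rewriting from
  looping. The inner list cannot mention the variables of the outer sum, so a sum over the coproduct
  of a bound variable is never pulled out of its scope. The numerals in later instances are chosen
  so that both sides reach the same order.\<close>

lemma sum_sort:
  fixes F :: "'a \<Rightarrow> 'b \<Rightarrow> 'c \<Rightarrow> 'd \<Rightarrow> 'k::comm_semiring_0"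
    and G :: "'a \<Rightarrow> 'b \<Rightarrow> 'c \<Rightarrow> 'd \<Rightarrow> 'e \<Rightarrow> 'k"
    and G' :: "'x \<Rightarrow> 'y \<Rightarrow> 'z \<Rightarrow> 'c \<Rightarrow> 'd \<Rightarrow> 'k"
    and H :: "'x \<Rightarrow> 'y \<Rightarrow> 'z \<Rightarrow> 'c \<Rightarrow> 'd \<Rightarrow> 'e \<Rightarrow> 'k"
  shows "j < i \<Longrightarrow> sum2 i L2 (\<lambda>a b. sum2 j M2 (\<lambda>c d. F a b c d)) =
      sum2 j M2 (\<lambda>c d. sum2 i L2 (\<lambda>a b. F a b c d))"
    and "j < i \<Longrightarrow> sum2 i L2 (\<lambda>a b. sum3 j M3 (\<lambda>c d e. G a b c d e)) =
      sum3 j M3 (\<lambda>c d e. sum2 i L2 (\<lambda>a b. G a b c d e))"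
    and "j < i \<Longrightarrow> sum3 i L3 (\<lambda>a b c. sum2 j M2 (\<lambda>d e. G' a b c d e)) =
      sum2 j M2 (\<lambda>d e. sum3 i L3 (\<lambda>a b c. G' a b c d e))"
    and "j < i \<Longrightarrow> sum3 i L3 (\<lambda>a b c. sum3 j M3 (\<lambda>d e f. H a b c d e f)) =
      sum3 j M3 (\<lambda>d e f. sum3 i L3 (\<lambda>a b c. H a b c d e f))"
  unfolding sum2_def sum3_def case_prod_unfold by (rule sum_list_swap)+

lemma sum_mult_left:
  "sum2 i L (\<lambda>a b. c * F a b) = c * sum2 i L F"
  "sum3 i M (\<lambda>a b d. c * G a b d) = c * sum3 i M G"
  by (simp_all add: sum2_def sum3_def case_prod_unfold sum_list_const_mult)

lemma sum2_map: "sum2 i [(f a b, g a b). (a, b) \<leftarrow> L] F = sum2 j L (\<lambda>a b. F (f a b) (g a b))"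
  by (simp add: sum2_def case_prod_unfold o_def)

lemma sum2_mult2:
  "sum2 i (mult2 s t) F = sum2 j s (\<lambda>a b. sum2 k t (\<lambda>a' b'. F (a * a') (b * b')))"
  by (simp add: sum2_def case_prod_unfold o_def sum_list_map_concat_map)

lemma sum3_mult3:
  "sum3 i (mult3 s t) F = sum3 j s (\<lambda>a b c. sum3 k t (\<lambda>a' b' c'. F (a * a') (b * b') (c * c')))"
  by (simp add: sum3_def case_prod_unfold o_def sum_list_map_concat_map)

lemma sum4_mult4:
  "sum4 (mult4 s t) F =
   sum4 s (\<lambda>a b c d. sum4 t (\<lambda>a' b' c' d'. F (a * a') (b * b') (c * c') (d * d')))"
  by (simp add: sum4_def case_prod_unfold o_def sum_list_map_concat_map)

lemma pair_slots_fst: "i \<in> A \<Longrightarrow> q \<in> Q \<Longrightarrow> (\<lambda>x. (i x, q)) \<in> pair_slots A P B Q"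
  and pair_slots_snd: "p \<in> P \<Longrightarrow> j \<in> B \<Longrightarrow> (\<lambda>x. (p, j x)) \<in> pair_slots A P B Q"
  by (auto simp: pair_slots_def)

lemma slots4_intros:
  "(\<lambda>x. (x, b, c, d)) \<in> slots4" "(\<lambda>x. (a, x, c, d)) \<in> slots4"
  "(\<lambda>x. (a, b, x, d)) \<in> slots4" "(\<lambda>x. (a, b, c, x)) \<in> slots4"
proof -
  have 2: "(\<lambda>x. (x, d)) \<in> slots2" "(\<lambda>x. (c, x)) \<in> slots2" for c d
    unfolding slots2_def by (rule pair_slots_fst pair_slots_snd; simp)+
  have 3: "(\<lambda>x. (x, c, d)) \<in> slots3" "(\<lambda>x. (b, x, d)) \<in> slots3" "(\<lambda>x. (b, c, x)) \<in> slots3" for b c d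
    unfolding slots3_def by (rule pair_slots_fst pair_slots_snd; simp add: 2)+
  show "(\<lambda>x. (x, b, c, d)) \<in> slots4" "(\<lambda>x. (a, x, c, d)) \<in> slots4"
    "(\<lambda>x. (a, b, x, d)) \<in> slots4" "(\<lambda>x. (a, b, c, x)) \<in> slots4"
    unfolding slots4_def by (rule pair_slots_fst pair_slots_snd; simp add: 3)+
qed

section \<open>Multilinear functionals on tensors\<close>

context unital_algebra
begin

definition lin :: "('h \<Rightarrow> 'k) \<Rightarrow> bool" where
  "lin g \<longleftrightarrow> (\<forall>x y. g (x + y) = g x + g y) \<and> (\<forall>c x. g (c *s x) = c * g x)"

definition lin_map :: "('h \<Rightarrow> 'h) \<Rightarrow> bool" where
  "lin_map g \<longleftrightarrow> (\<forall>x y. g (x + y) = g x + g y) \<and> (\<forall>c x. g (c *s x) = c *s g x)"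

definition lin2 :: "('h \<Rightarrow> 'h \<Rightarrow> 'k) \<Rightarrow> bool" where
  "lin2 F \<longleftrightarrow> (\<forall>b. lin (\<lambda>a. F a b)) \<and> (\<forall>a. lin (\<lambda>b. F a b))"

definition lin3 :: "('h \<Rightarrow> 'h \<Rightarrow> 'h \<Rightarrow> 'k) \<Rightarrow> bool" where
  "lin3 F \<longleftrightarrow> (\<forall>b c. lin (\<lambda>a. F a b c)) \<and> (\<forall>a c. lin (\<lambda>b. F a b c)) \<and> (\<forall>a b. lin (\<lambda>c. F a b c))"

definition lin4 :: "('h \<Rightarrow> 'h \<Rightarrow> 'h \<Rightarrow> 'h \<Rightarrow> 'k) \<Rightarrow> bool" where
  "lin4 F \<longleftrightarrow> (\<forall>b c d. lin (\<lambda>a. F a b c d)) \<and> (\<forall>a c d. lin (\<lambda>b. F a b c d)) \<and>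
     (\<forall>a b d. lin (\<lambda>c. F a b c d)) \<and> (\<forall>a b c. lin (\<lambda>d. F a b c d))"

lemma lin_compose: "lin g \<Longrightarrow> lin_map E \<Longrightarrow> lin (\<lambda>x. g (E x))"
  by (simp add: lin_def lin_map_def)

lemma lin2_slots:
  assumes "lin2 F"
  shows "lin_map E \<Longrightarrow> lin (\<lambda>x. F (E x) b)" "lin_map E \<Longrightarrow> lin (\<lambda>x. F a (E x))"
  using assms by (auto simp: lin2_def lin_def lin_map_def)

lemma lin3_slots:
  assumes "lin3 F"
  shows "lin_map E \<Longrightarrow> lin (\<lambda>x. F (E x) b c)" "lin_map E \<Longrightarrow> lin (\<lambda>x. F a (E x) c)"
    "lin_map E \<Longrightarrow> lin (\<lambda>x. F a b (E x))"
  using assms by (auto simp: lin3_def lin_def lin_map_def)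

lemma lin4_slots:
  assumes "lin4 F"
  shows "lin_map E \<Longrightarrow> lin (\<lambda>x. F (E x) b c d)" "lin_map E \<Longrightarrow> lin (\<lambda>x. F a (E x) c d)"
    "lin_map E \<Longrightarrow> lin (\<lambda>x. F a b (E x) d)" "lin_map E \<Longrightarrow> lin (\<lambda>x. F a b c (E x))"
  using assms by (auto simp: lin4_def lin_def lin_map_def)

lemma lin_map_intros:
  "lin_map (\<lambda>x. x)"
  "lin_map E \<Longrightarrow> lin_map (\<lambda>x. a * E x)"
  "lin_map E \<Longrightarrow> lin_map (\<lambda>x. E x * a)"
  by (simp_all add: lin_map_def distrib_left distrib_right scale_mult_left scale_mult_right)

lemma lin_sum2: "(\<And>a b. lin (\<lambda>x. F x a b)) \<Longrightarrow> lin (\<lambda>x. sum2 i L (\<lambda>a b. F x a b))"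
  by (simp add: lin_def sum2_def case_prod_unfold sum_list_addf sum_list_const_mult)

lemma lin_sum3: "(\<And>a b c. lin (\<lambda>x. F x a b c)) \<Longrightarrow> lin (\<lambda>x. sum3 i L (\<lambda>a b c. F x a b c))"
  by (simp add: lin_def sum3_def case_prod_unfold sum_list_addf sum_list_const_mult)

lemma lin_mult:
  "lin F \<Longrightarrow> lin (\<lambda>x. F x * c)" "lin F \<Longrightarrow> lin (\<lambda>x. c * F x)"
  by (simp_all add: lin_def algebra_simps)

lemma formal_eval_slot_rels:
  assumes "r \<in> linearity_rels scale UNIV A" and "\<And>s. s \<in> A \<Longrightarrow> lin (\<lambda>x. F (s x))"
  shows "formal_eval F r = 0"
proof -
  interpret L: Vector_Spaces.linear free_scale "(*)" "formal_eval F" by (rule linear_formal_eval)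
  show ?thesis
    using assms by (auto simp: linearity_rels_def lin_def L.diff L.scale)
qed

text \<open>A bilinear functional kills the linearity relations and so depends on the coset alone.
  The indices on the two sides may differ because they only name the sums.\<close>

lemma sum2_tensor2:
  assumes "tensor2 scale s = tensor2 scale t" "lin2 F"
  shows "sum2 i s F = sum2 j t F"
  unfolding sum2_def
proof (rule tensor_class_eq_D[OF assms(1)[unfolded tensor2_def]])
  fix r assume "r \<in> linearity_rels scale UNIV (slots2 :: ('h \<Rightarrow> _) set)"
  then show "formal_eval (\<lambda>(a, b). F a b) r = 0"
    by (rule formal_eval_slot_rels) (use assms(2) in \<open>auto simp: lin2_def slots2_def pair_slots_def\<close>)
qed

lemma sum3_tensor3:
  assumes "tensor3 scale s = tensor3 scale t" "lin3 F"
  shows "sum3 i s F = sum3 j t F"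
  unfolding sum3_def
proof (rule tensor_class_eq_D[OF assms(1)[unfolded tensor3_def]])
  fix r assume "r \<in> linearity_rels scale UNIV (slots3 :: ('h \<Rightarrow> _) set)"
  then show "formal_eval (\<lambda>(a, b, c). F a b c) r = 0"
    by (rule formal_eval_slot_rels)
      (use assms(2) in \<open>auto simp: lin3_def slots3_def slots2_def pair_slots_def\<close>)
qed

lemma sum4_tensor4:
  assumes "tensor4 scale s = tensor4 scale t" "lin4 F"
  shows "sum4 s F = sum4 t F"
  unfolding sum4_def
proof (rule tensor_class_eq_D[OF assms(1)[unfolded tensor4_def]])
  fix r assume "r \<in> linearity_rels scale UNIV (slots4 :: ('h \<Rightarrow> _) set)"
  then show "formal_eval (\<lambda>(a, b, c, d). F a b c d) r = 0"
    by (rule formal_eval_slot_rels)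
      (use assms(2) in \<open>auto simp: lin4_def slots4_def slots3_def slots2_def pair_slots_def\<close>)
qed

text \<open>With this converse, products in the fourth tensor power can be manipulated as cosets,
  which is how the pentagon is solved for its factors.\<close>

lemma tensor4_eqI:
  assumes "\<And>F. lin4 F \<Longrightarrow> sum4 s F = sum4 t F"
  shows "tensor4 scale s = tensor4 scale t"
  unfolding tensor4_def
proof (rule tensor_class_eqI)
  fix F :: "'h \<times> 'h \<times> 'h \<times> 'h \<Rightarrow> 'k"
  assume F: "\<And>r. r \<in> linearity_rels scale UNIV slots4 \<Longrightarrow> formal_eval F r = 0"
  interpret L: Vector_Spaces.linear free_scale "(*)" "formal_eval F" by (rule linear_formal_eval)
  have "lin (\<lambda>x. F (s x))" if "s \<in> slots4" for s
  proof -
    have "formal_eval F (Poly_Mapping.single (s (x + y)) 1 - Poly_Mapping.single (s x) 1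
        - Poly_Mapping.single (s y) 1) = 0" for x y
      using that by (intro F) (unfold linearity_rels_def, blast)
    moreover have "formal_eval F (Poly_Mapping.single (s (c *s x)) 1
        - free_scale c (Poly_Mapping.single (s x) 1)) = 0" for c x
      using that by (intro F) (unfold linearity_rels_def, blast)
    ultimately show ?thesis by (simp add: L.diff L.scale formal_eval_add lin_def diff_diff_eq)
  qed
  then have "lin4 (\<lambda>a b c d. F (a, b, c, d))"
    by (simp add: lin4_def slots4_intros)
  then show "(\<Sum>p\<leftarrow>s. F p) = (\<Sum>p\<leftarrow>t. F p)"
    using assms by (fastforce simp: sum4_def case_prod_unfold)
qed

lemma lin_sum_list: "lin g \<Longrightarrow> g (\<Sum>x\<leftarrow>xs. f x) = (\<Sum>x\<leftarrow>xs. g (f x))"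
proof (induction xs)
  case Nil
  have "g (0 *s 0) = 0 * g 0" using Nil unfolding lin_def by blast
  then show ?case by simp
qed (simp add: lin_def)

definition legs123 where "legs123 L = [(X1, X2, X3, 1::'h). (X1, X2, X3) \<leftarrow> L]"
definition legs234 where "legs234 L = [(1::'h, X1, X2, X3). (X1, X2, X3) \<leftarrow> L]"

lemma sum4_legs:
  "sum4 (legs123 L) F = sum3 0 L (\<lambda>X1 X2 X3. F X1 X2 X3 1)"
  "sum4 (legs234 L) F = sum3 0 L (\<lambda>X1 X2 X3. F 1 X1 X2 X3)"
  by (simp_all add: sum4_def sum3_def legs123_def legs234_def case_prod_unfold o_def)

lemma sum4_One [simp]: "sum4 [(a, b, c, d)] F = F a b c d"
  by (simp add: sum4_def)

lemma lin_sum4: "(\<And>a b c d. lin (\<lambda>x. F x a b c d)) \<Longrightarrow> lin (\<lambda>x. sum4 L (\<lambda>a b c d. F x a b c d))"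
  by (simp add: lin_def sum4_def case_prod_unfold sum_list_addf sum_list_const_mult)

lemma tensor4_mult_cong:
  assumes "tensor4 scale s = tensor4 scale s'" "tensor4 scale t = tensor4 scale t'"
  shows "tensor4 scale (mult4 s t) = tensor4 scale (mult4 s' t')"
proof (rule tensor4_eqI)
  fix F assume F: "lin4 F"
  note F' = lin4_slots[OF F]
  have "sum4 t (\<lambda>a' b' c' d'. F (a * a') (b * b') (c * c') (d * d')) =
      sum4 t' (\<lambda>a' b' c' d'. F (a * a') (b * b') (c * c') (d * d'))" for a b c d
    by (rule sum4_tensor4[OF assms(2)]) (simp add: lin4_def F' lin_map_intros)
  moreover have "sum4 s (\<lambda>a b c d. sum4 t' (\<lambda>a' b' c' d'. F (a * a') (b * b') (c * c') (d * d'))) =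
    sum4 s' (\<lambda>a b c d. sum4 t' (\<lambda>a' b' c' d'. F (a * a') (b * b') (c * c') (d * d')))"
    by (rule sum4_tensor4[OF assms(1)]) (simp add: lin4_def F' lin_map_intros lin_sum4)
  ultimately show "sum4 (mult4 s t) F = sum4 (mult4 s' t') F"
    by (simp add: sum4_mult4 del: mult4.simps)
qed

lemma tensor4_mult_assoc:
  "tensor4 scale (mult4 (mult4 s t) u) = tensor4 scale (mult4 s (mult4 t u))"
  by (rule tensor4_eqI) (simp add: sum4_mult4 mult.assoc del: mult4.simps)

lemma tensor4_mult_one:
  "tensor4 scale (mult4 s [(1, 1, 1, 1)]) = tensor4 scale s"
  "tensor4 scale (mult4 [(1, 1, 1, 1)] s) = tensor4 scale s"
  by (rule tensor4_eqI, simp add: sum4_mult4 del: mult4.simps)+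

lemma tensor4_shift_right:
  assumes "tensor4 scale (mult4 s t) = tensor4 scale u"
    and "tensor4 scale (mult4 t t') = tensor4 scale [(1, 1, 1, 1)]"
  shows "tensor4 scale s = tensor4 scale (mult4 u t')"
  using tensor4_mult_cong[OF refl assms(2), of s] tensor4_mult_cong[OF assms(1) refl, of t']
    tensor4_mult_assoc[of s t t'] tensor4_mult_one(1)[of s] by metis

lemma tensor4_shift_left:
  assumes "tensor4 scale (mult4 s t) = tensor4 scale u"
    and "tensor4 scale (mult4 s' s) = tensor4 scale [(1, 1, 1, 1)]"
  shows "tensor4 scale t = tensor4 scale (mult4 s' u)"
  using tensor4_mult_cong[OF assms(2) refl, of t] tensor4_mult_cong[OF refl assms(1), of s']
    tensor4_mult_assoc[of s' s t] tensor4_mult_one(2)[of t] by metis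

end

section \<open>Sweedler calculus for the coproduct and the associator\<close>

context quasi_bialgebra
begin

abbreviation D :: "nat \<Rightarrow> 'h \<Rightarrow> ('h \<Rightarrow> 'h \<Rightarrow> 'k) \<Rightarrow> 'k" where
  "D i h \<equiv> sum2 i (\<Delta> h)"
abbreviation P :: "nat \<Rightarrow> ('h \<Rightarrow> 'h \<Rightarrow> 'h \<Rightarrow> 'k) \<Rightarrow> 'k" where
  "P i \<equiv> sum3 i \<Phi>"
abbreviation N :: "nat \<Rightarrow> ('h \<Rightarrow> 'h \<Rightarrow> 'h \<Rightarrow> 'k) \<Rightarrow> 'k" where
  "N i \<equiv> sum3 i \<Phi>'"

text \<open>The list \<open>\<Delta> h\<close> is not linear in \<open>h\<close>, only its class is.
  Linearity in \<open>h\<close> therefore needs a bilinear \<open>F\<close> to pass to the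
  class.\<close>

lemma lin_D:
  assumes "lin_map E" "lin2 F"
  shows "lin (\<lambda>x. D i (E x) F)"
proof -
  have "lin (\<lambda>x. D i x F)"
    unfolding lin_def
  proof (intro conjI allI)
    show "D i (x + y) F = D i x F + D i y F" for x y
      using sum2_tensor2[OF comult_add assms(2), of i x y i] by (simp add: sum2_append)
    show "D i (c *s x) F = c * D i x F" for c x
    proof -
      have "D i (c *s x) F = D i x (\<lambda>a b. F (c *s a) b)"
        using sum2_tensor2[OF comult_scale assms(2), of i c x i] by (simp add: sum2_map[of _ _ _ _ _ i])
      then show ?thesis using assms(2) by (simp add: lin2_def lin_def sum_mult_left)
    qed
  qed
  then show ?thesis using assms(1) by (rule lin_compose)
qed

lemma lin_counit: "lin_map E \<Longrightarrow> lin (\<lambda>x. \<epsilon> (E x))"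
  using counit_linear vector_space_axioms by (auto simp: linear_mult_iff lin_def lin_map_def)

lemmas lin_rules = lin_map_intros lin_sum2 lin_sum3 lin_mult lin_D lin_counit lin2_def lin3_def lin4_def

lemma D_mult:
  assumes "lin2 F"
  shows "D i (a * b) F = D j a (\<lambda>a1 a2. D k b (\<lambda>b1 b2. F (a1 * b1) (a2 * b2)))"
  using sum2_tensor2[OF comult_mult assms] by (simp add: sum2_mult2[of _ _ _ _ j k] del: mult2.simps)

lemma D_one: "lin2 F \<Longrightarrow> D i 1 F = F 1 1"
  using sum2_tensor2[OF comult_one, of F i i] by simp

lemma D_counit:
  assumes "lin g"
  shows "D i h (\<lambda>a b. \<epsilon> b * g a) = g h" "D i h (\<lambda>a b. \<epsilon> a * g b) = g h"
proof -
  have "g h = g (\<Sum>(h1, h2)\<leftarrow>\<Delta> h. \<epsilon> h2 *s h1)" "g h = g (\<Sum>(h1, h2)\<leftarrow>\<Delta> h. \<epsilon> h1 *s h2)"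
    by (simp_all add: counit_right counit_left)
  moreover have "g (c *s x) = c * g x" for c x using assms by (simp add: lin_def)
  ultimately show "D i h (\<lambda>a b. \<epsilon> b * g a) = g h" "D i h (\<lambda>a b. \<epsilon> a * g b) = g h"
    by (simp_all add: sum2_def case_prod_unfold lin_sum_list[OF assms])
qed

lemma PN: "lin3 F \<Longrightarrow> P i (\<lambda>X1 X2 X3. N j (\<lambda>x1 x2 x3. F (X1 * x1) (X2 * x2) (X3 * x3))) = F 1 1 1"
  using sum3_tensor3[OF assoc_right_inverse, of F i i] by (simp add: sum3_mult3[of _ _ _ _ i j] del: mult3.simps)

lemma NP: "lin3 F \<Longrightarrow> N i (\<lambda>X1 X2 X3. P j (\<lambda>x1 x2 x3. F (X1 * x1) (X2 * x2) (X3 * x3))) = F 1 1 1"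
  using sum3_tensor3[OF assoc_left_inverse, of F i i] by (simp add: sum3_mult3[of _ _ _ _ i j] del: mult3.simps)

lemma coassoc_sum:
  assumes "lin3 F"
  shows "D i h (\<lambda>h1 h2. D j h2 (\<lambda>a b. F h1 a b)) =
    P k (\<lambda>X1 X2 X3. D i h (\<lambda>h1 h2. D j h1 (\<lambda>a b.
      N l (\<lambda>x1 x2 x3. F (X1 * a * x1) (X2 * b * x2) (X3 * h2 * x3)))))"
proof -
  have 1: "sum3 n [(h1, h21, h22). (h1, h2) \<leftarrow> \<Delta> h, (h21, h22) \<leftarrow> \<Delta> h2] F =
      D i h (\<lambda>h1 h2. D j h2 (\<lambda>a b. F h1 a b))" for n
    by (simp add: sum3_def sum2_def case_prod_unfold o_def sum_list_map_concat_map)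
  have 2: "sum3 n [(h11, h12, h2). (h1, h2) \<leftarrow> \<Delta> h, (h11, h12) \<leftarrow> \<Delta> h1] F =
      D i h (\<lambda>h1 h2. D j h1 (\<lambda>a b. F a b h2))" for n F
    by (simp add: sum3_def sum2_def case_prod_unfold o_def sum_list_map_concat_map)
  show ?thesis
    using sum3_tensor3[OF quasi_coassoc assms, of 0 h 0]
    unfolding 1 sum3_mult3[of 0 _ _ _ 1 l] sum3_mult3[of 1 _ _ _ k 0] 2 .
qed

text \<open>Multiplying quasi-coassociativity by \<Phi> on the right clears the inverse.
  \<open>coassoc_N\<close> is obtained in the same way by multiplying with \<Phi>' on the left. In
  these two forms \<open>h\<close> simply moves from one side of the associator to the
  other.\<close>

lemma coassoc_P:
  assumes F: "lin3 F"
  shows "D i h (\<lambda>h1 h2. D j h2 (\<lambda>a b. P k (\<lambda>X1 X2 X3. F (h1 * X1) (a * X2) (b * X3)))) =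
    P k (\<lambda>X1 X2 X3. D i h (\<lambda>h1 h2. D j h1 (\<lambda>a b. F (X1 * a) (X2 * b) (X3 * h2))))"
proof -
  note F' = lin3_slots[OF F]
  \<comment> \<open>Cancels \<Phi>' against \<Phi> with arbitrary factors standing to their
    left.\<close>
  have *: "N i (\<lambda>x1 x2 x3. P j (\<lambda>X1 X2 X3.
      F (a * (p * (x1 * X1))) (b * (q * (x2 * X2))) (c * (r * (x3 * X3))))) = F (a * p) (b * q) (c * r)"
    for i j a b c p q r
    using NP[of "\<lambda>x y z. F (a * (p * x)) (b * (q * y)) (c * (r * z))" i j] by (simp add: lin_rules F')
  show ?thesis
    by (subst coassoc_sum[where k = k and l = k]) (simp_all add: lin_rules F' mult.assoc *)
qed

lemma coassoc_N:
  assumes F: "lin3 F"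
  shows "N k (\<lambda>x1 x2 x3. D i h (\<lambda>h1 h2. D j h2 (\<lambda>a b. F (x1 * h1) (x2 * a) (x3 * b)))) =
    N k (\<lambda>x1 x2 x3. D i h (\<lambda>h1 h2. D j h1 (\<lambda>a b. F (a * x1) (b * x2) (h2 * x3))))"
proof -
  note F' = lin3_slots[OF F]
  let ?R = "\<lambda>a b c. D i h (\<lambda>h1 h2. D j h1 (\<lambda>p q. N k (\<lambda>x1 x2 x3. F (a * (p * x1)) (b * (q * x2)) (c * (h2 * x3)))))"
  have "N k (\<lambda>x1 x2 x3. D i h (\<lambda>h1 h2. D j h2 (\<lambda>a b. F (x1 * h1) (x2 * a) (x3 * b)))) =
      N k (\<lambda>x1 x2 x3. P k (\<lambda>X1 X2 X3. ?R (x1 * X1) (x2 * X2) (x3 * X3)))"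
    by (subst coassoc_sum[where k = k and l = k]) (simp_all add: lin_rules F' mult.assoc)
  also have "\<dots> = ?R 1 1 1" by (rule NP) (simp add: lin_rules F')
  also have "\<dots> = N k (\<lambda>x1 x2 x3. D i h (\<lambda>h1 h2. D j h1 (\<lambda>a b. F (a * x1) (b * x2) (h2 * x3))))"
    unfolding sum2_def sum3_def case_prod_unfold by (simp add: sum_list_swap[of _ "\<Phi>'"])
  finally show ?thesis .
qed

section \<open>The pentagon in the fourth tensor power\<close>

definition cop1 where "cop1 L = [(a, b, X2, X3). (X1, X2, X3) \<leftarrow> L, (a, b) \<leftarrow> \<Delta> X1]"
definition cop2 where "cop2 L = [(X1, a, b, X3). (X1, X2, X3) \<leftarrow> L, (a, b) \<leftarrow> \<Delta> X2]"
definition cop3 where "cop3 L = [(X1, X2, a, b). (X1, X2, X3) \<leftarrow> L, (a, b) \<leftarrow> \<Delta> X3]"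

lemma sum4_cop:
  "sum4 (cop1 L) F = sum3 0 L (\<lambda>X1 X2 X3. D 0 X1 (\<lambda>a b. F a b X2 X3))"
  "sum4 (cop2 L) F = sum3 0 L (\<lambda>X1 X2 X3. D 0 X2 (\<lambda>a b. F X1 a b X3))"
  "sum4 (cop3 L) F = sum3 0 L (\<lambda>X1 X2 X3. D 0 X3 (\<lambda>a b. F X1 X2 a b))"
  by (simp_all add: sum4_def sum3_def sum2_def cop1_def cop2_def cop3_def case_prod_unfold o_def
      sum_list_map_concat_map)

lemma sum2_sum3_commute:
  "sum2 i L (\<lambda>a b. sum3 j M (\<lambda>c d e. G a b c d e)) = sum3 j M (\<lambda>c d e. sum2 i L (\<lambda>a b. G a b c d e))"
  unfolding sum2_def sum3_def case_prod_unfold by (rule sum_list_swap)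

text \<open>All five embeddings of the third tensor power into the fourth are unital algebra maps,
  so they preserve inverse pairs. Keeping \<open>L\<close> and \<open>M\<close> general yields both
  \<Phi> \<Phi>' and \<Phi>' \<Phi>.\<close>

lemma inverse_legs:
  assumes inv: "tensor3 scale (mult3 L M) = tensor3 scale [(1, 1, 1)]"
  shows "tensor4 scale (mult4 (legs123 L) (legs123 M)) = tensor4 scale [(1, 1, 1, 1)]"
    "tensor4 scale (mult4 (legs234 L) (legs234 M)) = tensor4 scale [(1, 1, 1, 1)]"
    "tensor4 scale (mult4 (cop1 L) (cop1 M)) = tensor4 scale [(1, 1, 1, 1)]"
    "tensor4 scale (mult4 (cop2 L) (cop2 M)) = tensor4 scale [(1, 1, 1, 1)]"
    "tensor4 scale (mult4 (cop3 L) (cop3 M)) = tensor4 scale [(1, 1, 1, 1)]"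
proof -
  have *: "sum3 0 L (\<lambda>a b c. sum3 0 M (\<lambda>a' b' c'. F (a * a') (b * b') (c * c'))) = F 1 1 1"
    if "lin3 F" for F
    using sum3_tensor3[OF inv that, of 0 0] by (simp add: sum3_mult3[of _ _ _ _ 0 0] del: mult3.simps)
  note simps = sum4_mult4 sum4_legs sum4_cop lin_rules D_mult[of _ _ _ _ 0 0] D_one sum2_sum3_commute
  show "tensor4 scale (mult4 (legs123 L) (legs123 M)) = tensor4 scale [(1, 1, 1, 1)]"
  proof (rule tensor4_eqI)
    fix F assume "lin4 F"
    from lin4_slots[OF this] show "sum4 (mult4 (legs123 L) (legs123 M)) F = sum4 [(1, 1, 1, 1)] F"
      using *[of "\<lambda>a b c. F a b c 1"] by (simp add: simps del: mult4.simps)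
  qed
  show "tensor4 scale (mult4 (legs234 L) (legs234 M)) = tensor4 scale [(1, 1, 1, 1)]"
  proof (rule tensor4_eqI)
    fix F assume "lin4 F"
    from lin4_slots[OF this] show "sum4 (mult4 (legs234 L) (legs234 M)) F = sum4 [(1, 1, 1, 1)] F"
      using *[of "\<lambda>a b c. F 1 a b c"] by (simp add: simps del: mult4.simps)
  qed
  show "tensor4 scale (mult4 (cop1 L) (cop1 M)) = tensor4 scale [(1, 1, 1, 1)]"
  proof (rule tensor4_eqI)
    fix F assume "lin4 F"
    from lin4_slots[OF this] show "sum4 (mult4 (cop1 L) (cop1 M)) F = sum4 [(1, 1, 1, 1)] F"
      using *[of "\<lambda>a b c. D 0 a (\<lambda>p q. F p q b c)"] by (simp add: simps del: mult4.simps)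
  qed
  show "tensor4 scale (mult4 (cop2 L) (cop2 M)) = tensor4 scale [(1, 1, 1, 1)]"
  proof (rule tensor4_eqI)
    fix F assume "lin4 F"
    from lin4_slots[OF this] show "sum4 (mult4 (cop2 L) (cop2 M)) F = sum4 [(1, 1, 1, 1)] F"
      using *[of "\<lambda>a b c. D 0 b (\<lambda>p q. F a p q c)"] by (simp add: simps del: mult4.simps)
  qed
  show "tensor4 scale (mult4 (cop3 L) (cop3 M)) = tensor4 scale [(1, 1, 1, 1)]"
  proof (rule tensor4_eqI)
    fix F assume "lin4 F"
    from lin4_slots[OF this] show "sum4 (mult4 (cop3 L) (cop3 M)) F = sum4 [(1, 1, 1, 1)] F"
      using *[of "\<lambda>a b c. D 0 c (\<lambda>p q. F a b p q)"] by (simp add: simps del: mult4.simps)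
  qed
qed

lemmas inverse_Phi = inverse_legs[OF assoc_right_inverse]
lemmas inverse_Phi' = inverse_legs[OF assoc_left_inverse]

text \<open>This relates five invertible elements of the fourth tensor power. The lemmas below move
  some of them across the equation. Each solved form places a different pair of legs next to each
  other for a contraction with \<alpha> or \<beta>.\<close>

lemma pentagon_tensor:
  "tensor4 scale (mult4 (mult4 (legs234 \<Phi>) (cop2 \<Phi>)) (legs123 \<Phi>)) =
   tensor4 scale (mult4 (cop3 \<Phi>) (cop1 \<Phi>))"
  unfolding legs234_def cop2_def legs123_def cop3_def cop1_def by (rule pentagon)

lemma pentagon_tensor_4:
  "tensor4 scale (mult4 (legs234 \<Phi>) (cop2 \<Phi>)) =
   tensor4 scale (mult4 (mult4 (cop3 \<Phi>) (cop1 \<Phi>)) (legs123 \<Phi>'))"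
  by (rule tensor4_shift_right[OF pentagon_tensor inverse_Phi(1)])

lemma pentagon_tensor_2:
  "tensor4 scale (mult4 (cop2 \<Phi>) (legs123 \<Phi>)) =
   tensor4 scale (mult4 (legs234 \<Phi>') (mult4 (cop3 \<Phi>) (cop1 \<Phi>)))"
  by (rule tensor4_shift_left[OF _ inverse_Phi'(2)])
    (simp only: pentagon_tensor tensor4_mult_assoc[symmetric])

lemma pentagon_tensor_2':
  "tensor4 scale (mult4 (mult4 (cop2 \<Phi>) (legs123 \<Phi>)) (cop1 \<Phi>')) =
   tensor4 scale (mult4 (legs234 \<Phi>') (cop3 \<Phi>))"
  by (rule tensor4_shift_right[OF _ inverse_Phi(3), symmetric])
    (simp only: pentagon_tensor_2 tensor4_mult_assoc)

lemma pentagon_tensor_3':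
  "tensor4 scale (mult4 (cop1 \<Phi>) (legs123 \<Phi>')) =
   tensor4 scale (mult4 (cop3 \<Phi>') (mult4 (legs234 \<Phi>) (cop2 \<Phi>)))"
  by (rule tensor4_shift_left[OF _ inverse_Phi'(5)])
    (simp only: pentagon_tensor_4 tensor4_mult_assoc)

lemma pentagon_tensor_3:
  "tensor4 scale (mult4 (mult4 (cop1 \<Phi>) (legs123 \<Phi>')) (cop2 \<Phi>')) =
   tensor4 scale (mult4 (cop3 \<Phi>') (legs234 \<Phi>))"
  by (rule tensor4_shift_right[OF _ inverse_Phi(4), symmetric])
    (simp only: pentagon_tensor_3' tensor4_mult_assoc)

lemma pentagon_tensor_1:
  "tensor4 scale (mult4 (legs123 \<Phi>) (cop1 \<Phi>')) =
   tensor4 scale (mult4 (cop2 \<Phi>') (mult4 (legs234 \<Phi>') (cop3 \<Phi>)))"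
  by (rule tensor4_shift_left[OF _ inverse_Phi'(4)])
    (simp only: pentagon_tensor_2' tensor4_mult_assoc[symmetric])

lemma pentagon_tensor_inverse:
  "tensor4 scale (mult4 (cop1 \<Phi>') (cop3 \<Phi>')) =
   tensor4 scale (mult4 (legs123 \<Phi>') (mult4 (cop2 \<Phi>') (legs234 \<Phi>')))"
proof -
  have "tensor4 scale (cop1 \<Phi>') =
      tensor4 scale (mult4 (legs123 \<Phi>') (mult4 (cop2 \<Phi>') (mult4 (legs234 \<Phi>') (cop3 \<Phi>))))"
    by (rule tensor4_shift_left[OF pentagon_tensor_1 inverse_Phi'(1)])
  also have "\<dots> = tensor4 scale (mult4 (mult4 (legs123 \<Phi>') (mult4 (cop2 \<Phi>') (legs234 \<Phi>'))) (cop3 \<Phi>))"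
    by (metis tensor4_mult_assoc tensor4_mult_cong)
  finally show ?thesis
    by (intro tensor4_shift_right[OF _ inverse_Phi(5), symmetric]) simp
qed

subsection \<open>The pentagon\<close>

lemmas pentagon_simps = sum4_mult4 sum4_legs sum4_cop mult.assoc sum2_def sum3_def

lemma pentagon_1:
  assumes "lin4 F"
  shows "P i (\<lambda>X1 X2 X3. N j (\<lambda>x1 x2 x3. D k x1 (\<lambda>a b. F (X1 * a) (X2 * b) (X3 * x2) x3))) =
    N i' (\<lambda>z1 z2 z3. D m z2 (\<lambda>a b. N j' (\<lambda>w1 w2 w3. P k' (\<lambda>X1 X2 X3. D n X3 (\<lambda>c d.
      F (z1 * X1) (a * w1 * X2) (b * w2 * c) (z3 * w3 * d))))))"
  using sum4_tensor4[OF pentagon_tensor_1 assms] by (simp add: pentagon_simps del: mult4.simps)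

lemma pentagon_2:
  assumes "lin4 F"
  shows "P i (\<lambda>X1 X2 X3. D k X2 (\<lambda>a b. P j (\<lambda>Y1 Y2 Y3. F (X1 * Y1) (a * Y2) (b * Y3) X3))) =
    N i' (\<lambda>x1 x2 x3. P j' (\<lambda>X1 X2 X3. D m X3 (\<lambda>c d. P k' (\<lambda>Y1 Y2 Y3. D n Y1 (\<lambda>a b.
      F (X1 * a) (x1 * X2 * b) (x2 * c * Y2) (x3 * d * Y3))))))"
  using sum4_tensor4[OF pentagon_tensor_2 assms] by (simp add: pentagon_simps del: mult4.simps)

lemma pentagon_2':
  assumes "lin4 F"
  shows "P i (\<lambda>X1 X2 X3. D k X2 (\<lambda>a b. P j (\<lambda>Y1 Y2 Y3. N l (\<lambda>y1 y2 y3. D m y1 (\<lambda>c d.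
      F (X1 * Y1 * c) (a * Y2 * d) (b * Y3 * y2) (X3 * y3)))))) =
    N i' (\<lambda>x1 x2 x3. P j' (\<lambda>X1 X2 X3. D n X3 (\<lambda>c d. F X1 (x1 * X2) (x2 * c) (x3 * d))))"
  using sum4_tensor4[OF pentagon_tensor_2' assms] by (simp add: pentagon_simps del: mult4.simps)

lemma pentagon_3:
  assumes "lin4 F"
  shows "N i (\<lambda>x1 x2 x3. D k x3 (\<lambda>a b. P j (\<lambda>X1 X2 X3. F x1 (x2 * X1) (a * X2) (b * X3)))) =
    P i' (\<lambda>X1 X2 X3. D m X1 (\<lambda>a b. N j' (\<lambda>z1 z2 z3. N k' (\<lambda>w1 w2 w3. D n w2 (\<lambda>c d.
      F (a * z1 * w1) (b * z2 * c) (X2 * z3 * d) (X3 * w3))))))"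
  using sum4_tensor4[OF pentagon_tensor_3 assms] by (simp add: pentagon_simps del: mult4.simps)

lemma pentagon_3':
  assumes "lin4 F"
  shows "P i (\<lambda>X1 X2 X3. D k X1 (\<lambda>a b. N j (\<lambda>z1 z2 z3. F (a * z1) (b * z2) (X2 * z3) X3))) =
    N i' (\<lambda>x1 x2 x3. D m x3 (\<lambda>a b. P j' (\<lambda>X1 X2 X3. P k' (\<lambda>Y1 Y2 Y3. D n Y2 (\<lambda>c d.
      F (x1 * Y1) (x2 * X1 * c) (a * X2 * d) (b * X3 * Y3))))))"
  using sum4_tensor4[OF pentagon_tensor_3' assms] by (simp add: pentagon_simps del: mult4.simps)

lemma pentagon_4:
  assumes "lin4 F"
  shows "P i (\<lambda>X1 X2 X3. P j (\<lambda>Y1 Y2 Y3. D k Y2 (\<lambda>a b. F Y1 (X1 * a) (X2 * b) (X3 * Y3)))) =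
    P i' (\<lambda>X1 X2 X3. D m X3 (\<lambda>c d. P j' (\<lambda>Y1 Y2 Y3. D n Y1 (\<lambda>a b. N k' (\<lambda>z1 z2 z3.
      F (X1 * a * z1) (X2 * b * z2) (c * Y2 * z3) (d * Y3))))))"
  using sum4_tensor4[OF pentagon_tensor_4 assms] by (simp add: pentagon_simps del: mult4.simps)

lemma pentagon_inverse:
  assumes "lin4 F"
  shows "N i (\<lambda>x1 x2 x3. D k x1 (\<lambda>a b. N j (\<lambda>y1 y2 y3. D l y3 (\<lambda>c d.
      F (a * y1) (b * y2) (x2 * c) (x3 * d))))) =
    N i' (\<lambda>x1 x2 x3. N j' (\<lambda>y1 y2 y3. D m y2 (\<lambda>a b. N k' (\<lambda>z1 z2 z3.
      F (x1 * y1) (x2 * a * z1) (x3 * b * z2) (y3 * z3)))))"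
  using sum4_tensor4[OF pentagon_tensor_inverse assms] by (simp add: pentagon_simps del: mult4.simps)

section \<open>The counit on a leg of the associator\<close>

lemma P_counit_2:
  assumes "lin2 F"
  shows "P i (\<lambda>X1 X2 X3. \<epsilon> X2 * F X1 X3) = F 1 1"
proof -
  have "F (c *s a) b = c * F a b" for a b c using assms by (simp add: lin2_def lin_def)
  then show ?thesis
    using sum2_tensor2[OF assoc_counit assms, of i i]
    by (simp add: sum2_def sum3_def case_prod_unfold o_def)
qed

lemma pentagon_sum:
  assumes "lin4 F"
  shows "P i (\<lambda>X1 X2 X3. P j (\<lambda>Y1 Y2 Y3. D k Y2 (\<lambda>a b. P l (\<lambda>Z1 Z2 Z3.
      F (Y1 * Z1) (X1 * a * Z2) (X2 * b * Z3) (X3 * Y3))))) =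
    P i' (\<lambda>X1 X2 X3. D m X3 (\<lambda>c d. P j' (\<lambda>Y1 Y2 Y3. D n Y1 (\<lambda>a b.
      F (X1 * a) (X2 * b) (c * Y2) (d * Y3)))))"
  using sum4_tensor4[OF pentagon_tensor assms] by (simp add: pentagon_simps del: mult4.simps)

lemma P_counit_1:
  assumes F: "lin2 F"
  shows "P i (\<lambda>X1 X2 X3. \<epsilon> X1 * F X2 X3) = F 1 1"
proof -
  note F' = lin2_slots[OF F]
  define K where "K a b c = N 3 (\<lambda>x1 x2 x3. \<epsilon> (a * x1) * F (b * x2) (c * x3))" for a b c
  have K: "lin3 K" by (simp add: K_def lin_rules F')
  note K' = lin3_slots[OF K]
  have 1: "P 4 (\<lambda>Z1 Z2 Z3. \<epsilon> Z2 * K (a * Z1) (b * (c * Z3)) d) = K a (b * c) d" for a b c d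
    using P_counit_2[of "\<lambda>x y. K (a * x) (b * (c * y)) d" 4] by (simp add: lin_rules K')
  have 2: "D 3 h (\<lambda>a b. \<epsilon> a * K x (y * b) z) = K x (y * h) z" for h x y z
    by (rule D_counit) (simp add: lin_rules K')
  have 3: "D 4 h (\<lambda>a b. \<epsilon> b * K (x * a) y z) = K (x * h) y z" for h x y z
    by (rule D_counit) (simp add: lin_rules K')
  have "P 1 (\<lambda>X1 X2 X3. \<epsilon> X2 * D 2 X3 (\<lambda>c d. P 3 (\<lambda>Y1 Y2 Y3. K (X1 * Y1) (c * Y2) (d * Y3)))) =
      P 3 (\<lambda>Y1 Y2 Y3. K Y1 Y2 Y3)"
    using P_counit_2[of "\<lambda>x y. D 2 y (\<lambda>c d. P 3 (\<lambda>Y1 Y2 Y3. K (x * Y1) (c * Y2) (d * Y3)))" 1]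
    by (simp add: lin_rules K' D_one)
  moreover have "P 1 (\<lambda>X1 X2 X3. P 2 (\<lambda>Y1 Y2 Y3. \<epsilon> X1 * K Y1 (X2 * Y2) (X3 * Y3))) =
      P 1 (\<lambda>X1 X2 X3. \<epsilon> X2 * D 2 X3 (\<lambda>c d. P 3 (\<lambda>Y1 Y2 Y3. K (X1 * Y1) (c * Y2) (d * Y3))))"
    using pentagon_sum[of "\<lambda>a b c d. \<epsilon> b * K a c d" 1 2 3 4 1 2 3 4]
    by (simp add: lin_rules K' counit_mult sum_mult_left mult.assoc 1 2 3)
  ultimately have 5: "P 1 (\<lambda>X1 X2 X3. P 2 (\<lambda>Y1 Y2 Y3. \<epsilon> X1 * K Y1 (X2 * Y2) (X3 * Y3))) =
      P 3 (\<lambda>Y1 Y2 Y3. K Y1 Y2 Y3)" by simp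
  have 6: "P j (\<lambda>Y1 Y2 Y3. K Y1 (p * Y2) (q * Y3)) = F p q" for j p q
    using PN[of "\<lambda>a b c. \<epsilon> a * F (p * b) (q * c)" j 3]
    by (simp add: K_def lin_rules F' counit_one mult.assoc)
  show ?thesis
    using 5 6[of 2] 6[of 3 1 1] by (simp add: sum_mult_left sum3_def)
qed

text \<open>Here \<epsilon> is applied to the third factor of the pentagon. The surviving \<Phi>
  stands on the left, so \<open>K\<close> multiplies by \<Phi>' from the left.\<close>

lemma P_counit_3:
  assumes F: "lin2 F"
  shows "P i (\<lambda>X1 X2 X3. \<epsilon> X3 * F X1 X2) = F 1 1"
proof -
  note F' = lin2_slots[OF F]
  define K where "K a b c = N 3 (\<lambda>x1 x2 x3. F (x1 * a) (x2 * b) * \<epsilon> (x3 * c))" for a b c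
  have K: "lin3 K" by (simp add: K_def lin_rules F')
  note K' = lin3_slots[OF K]
  have 1: "P 9 (\<lambda>X1 X2 X3. \<epsilon> X2 * (r * (s * K x (X1 * y) (X3 * z)))) = r * (s * K x y z)" for r s x y z
    using P_counit_2[of "\<lambda>a b. r * (s * K x (a * y) (b * z))" 9] by (simp add: lin_rules K')
  have 2: "D 7 h (\<lambda>a b. \<epsilon> b * (r * K x (a * y) z)) = r * K x (h * y) z" for r h x y z
    by (rule D_counit) (simp add: lin_rules K')
  have 3: "D 3 h (\<lambda>c d. \<epsilon> c * K x y d) = K x y h" for h x y
    by (rule D_counit) (simp add: lin_rules K')
  have 4: "P 4 (\<lambda>Y1 Y2 Y3. D 5 Y1 (\<lambda>a b. r * (\<epsilon> Y2 * K (x * a) (y * b) (z * Y3)))) = r * K x y z" for r x y z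
    using P_counit_2[of "\<lambda>u v. D 5 u (\<lambda>a b. r * K (x * a) (y * b) (z * v))" 4]
    by (simp add: lin_rules K' D_one sum_mult_left mult.left_commute)
  have 5: "P 2 (\<lambda>Z1 Z2 Z3. P 5 (\<lambda>Y1 Y2 Y3. \<epsilon> Z3 * K (Y1 * Z1) (Y2 * Z2) Y3)) =
      P 2 (\<lambda>X1 X2 X3. K X1 X2 X3)"
    using pentagon_sum[of "\<lambda>a b c d. \<epsilon> c * K a b d" 9 5 7 2 2 3 4 5]
    by (simp add: lin_rules K' counit_mult mult.assoc sum_sort 1 2 3 4)
  have 6: "P 5 (\<lambda>Y1 Y2 Y3. K (Y1 * p) (Y2 * q) Y3) = F p q" for p q
    using NP[of "\<lambda>a b c. F (a * p) (b * q) * \<epsilon> c" 3 5]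
    by (simp add: K_def lin_rules F' counit_one mult.assoc sum_sort)
  show ?thesis
    using 5 6 6[of 1 1] by (simp add: sum3_def case_prod_unfold sum_list_const_mult)
qed

text \<open>The counit of \<open>\<Phi>\<close> on a leg determines that of \<open>\<Phi>'\<close>, since \<open>\<Phi>\<close> and \<open>\<Phi>'\<close> are inverse.\<close>

lemma N_counit_1:
  assumes F: "lin2 F"
  shows "N i (\<lambda>X1 X2 X3. \<epsilon> X1 * F X2 X3) = F 1 1"
proof -
  note F' = lin2_slots[OF F]
  have "P 2 (\<lambda>X1 X2 X3. N i (\<lambda>x1 x2 x3. \<epsilon> X1 * (\<epsilon> x1 * F (X2 * x2) (X3 * x3)))) = F 1 1"
    using PN[of "\<lambda>a b c. \<epsilon> a * F b c" 2 i] by (simp add: lin_rules F' counit_mult counit_one mult.assoc)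
  then show ?thesis
    using P_counit_1[of "\<lambda>a b. N i (\<lambda>x1 x2 x3. \<epsilon> x1 * F (a * x2) (b * x3))" 2]
    by (simp add: lin_rules F' sum_mult_left)
qed

lemma N_counit_2:
  assumes F: "lin2 F"
  shows "N i (\<lambda>X1 X2 X3. \<epsilon> X2 * F X1 X3) = F 1 1"
proof -
  note F' = lin2_slots[OF F]
  have "P 2 (\<lambda>X1 X2 X3. N i (\<lambda>x1 x2 x3. \<epsilon> X2 * (\<epsilon> x2 * F (X1 * x1) (X3 * x3)))) = F 1 1"
    using PN[of "\<lambda>a b c. \<epsilon> b * F a c" 2 i] by (simp add: lin_rules F' counit_mult counit_one mult.assoc)
  then show ?thesis
    using P_counit_2[of "\<lambda>a b. N i (\<lambda>x1 x2 x3. \<epsilon> x2 * F (a * x1) (b * x3))" 2]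
    by (simp add: lin_rules F' sum_mult_left)
qed

lemma N_counit_3:
  assumes F: "lin2 F"
  shows "N i (\<lambda>X1 X2 X3. \<epsilon> X3 * F X1 X2) = F 1 1"
proof -
  note F' = lin2_slots[OF F]
  have "P 2 (\<lambda>X1 X2 X3. N i (\<lambda>x1 x2 x3. \<epsilon> X3 * (\<epsilon> x3 * F (X1 * x1) (X2 * x2)))) = F 1 1"
    using PN[of "\<lambda>a b c. \<epsilon> c * F a b" 2 i] by (simp add: lin_rules F' counit_mult counit_one mult.assoc)
  then show ?thesis
    using P_counit_3[of "\<lambda>a b. N i (\<lambda>x1 x2 x3. \<epsilon> x3 * F (a * x1) (b * x2))" 2]
    by (simp add: lin_rules F' sum_mult_left)
qed

end

context quasi_hopf_algebra
begin

subsection \<open>The antipode\<close>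

lemma lin_map_antipode: "lin_map E \<Longrightarrow> lin_map (\<lambda>x. S (E x))"
proof -
  interpret S: Vector_Spaces.linear scale scale S by (rule antipode_linear)
  show "lin_map E \<Longrightarrow> lin_map (\<lambda>x. S (E x))"
    by (simp add: lin_map_def S.add S.scale)
qed

lemmas lin_antipode = lin_rules lin_map_antipode

text \<open>Normal form of a Sweedler expression: products associated to the right, \<open>S\<close>
  distributed over factors, independent sums sorted, linearity conditions discharged. Where it
  closes a goal, the mathematics lies in the instances supplied to it.\<close>

lemmas sweedler = lin_antipode sum_sort mult.assoc antipode_mult

lemma D_alpha:
  assumes "lin g"
  shows "D i h (\<lambda>a b. g (S a * (\<alpha> * b))) = \<epsilon> h * g \<alpha>"
proof -
  have "\<epsilon> h * g \<alpha> = g (\<Sum>(h1, h2)\<leftarrow>\<Delta> h. S h1 * \<alpha> * h2)"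
    using assms by (simp add: antipode_alpha lin_def)
  then show ?thesis
    by (simp add: sum2_def case_prod_unfold lin_sum_list[OF assms] mult.assoc)
qed

lemma D_beta:
  assumes "lin g"
  shows "D i h (\<lambda>a b. g (a * (\<beta> * S b))) = \<epsilon> h * g \<beta>"
proof -
  have "\<epsilon> h * g \<beta> = g (\<Sum>(h1, h2)\<leftarrow>\<Delta> h. h1 * \<beta> * S h2)"
    using assms by (simp add: antipode_beta lin_def)
  then show ?thesis
    by (simp add: sum2_def case_prod_unfold lin_sum_list[OF assms] mult.assoc)
qed

lemma P_antipode:
  assumes "lin g"
  shows "P i (\<lambda>X1 X2 X3. g (X1 * (\<beta> * (S X2 * (\<alpha> * X3))))) = g 1"
proof -
  have "g 1 = g (\<Sum>(X1, X2, X3)\<leftarrow>\<Phi>. X1 * \<beta> * S X2 * \<alpha> * X3)" by (simp add: antipode_assoc)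
  then show ?thesis
    by (simp add: sum3_def case_prod_unfold lin_sum_list[OF assms] mult.assoc)
qed

lemma N_antipode:
  assumes "lin g"
  shows "N i (\<lambda>X1 X2 X3. g (S X1 * (\<alpha> * (X2 * (\<beta> * S X3))))) = g 1"
proof -
  have "g 1 = g (\<Sum>(X1, X2, X3)\<leftarrow>\<Phi>'. S X1 * \<alpha> * X2 * \<beta> * S X3)" by (simp add: antipode_assoc_inv)
  then show ?thesis
    by (simp add: sum3_def case_prod_unfold lin_sum_list[OF assms] mult.assoc)
qed

lemma D_contract:
  assumes F: "lin3 F"
  shows "D j h (\<lambda>a b. F (S a * (\<alpha> * b)) x y) = \<epsilon> h * F \<alpha> x y"
    "D j h (\<lambda>a b. F x (S a * (\<alpha> * b)) y) = \<epsilon> h * F x \<alpha> y"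
    "D j h (\<lambda>a b. F x y (S a * (\<alpha> * b))) = \<epsilon> h * F x y \<alpha>"
    "D j h (\<lambda>a b. F (a * (\<beta> * S b)) x y) = \<epsilon> h * F \<beta> x y"
    "D j h (\<lambda>a b. F x (a * (\<beta> * S b)) y) = \<epsilon> h * F x \<beta> y"
    "D j h (\<lambda>a b. F x y (a * (\<beta> * S b))) = \<epsilon> h * F x y \<beta>"
  using lin3_slots[OF F] by (intro D_alpha D_beta; simp add: lin_antipode)+

text \<open>
  Contracting a leg of \<open>\<Phi>\<close> or \<open>\<Phi>'\<close> with \<open>\<alpha>\<close> or \<open>\<beta>\<close> puts the counit on that leg, which makes
  the whole associator disappear.
\<close>

lemma contract_P:
  assumes F: "lin3 F"
  shows "P i (\<lambda>X1 X2 X3. D j X1 (\<lambda>a b. F (S a * (\<alpha> * b)) X2 X3)) = F \<alpha> 1 1"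
    "P i (\<lambda>X1 X2 X3. D j X2 (\<lambda>a b. F X1 (S a * (\<alpha> * b)) X3)) = F 1 \<alpha> 1"
    "P i (\<lambda>X1 X2 X3. D j X3 (\<lambda>a b. F X1 X2 (S a * (\<alpha> * b)))) = F 1 1 \<alpha>"
    "P i (\<lambda>X1 X2 X3. D j X1 (\<lambda>a b. F (a * (\<beta> * S b)) X2 X3)) = F \<beta> 1 1"
    "P i (\<lambda>X1 X2 X3. D j X2 (\<lambda>a b. F X1 (a * (\<beta> * S b)) X3)) = F 1 \<beta> 1"
    "P i (\<lambda>X1 X2 X3. D j X3 (\<lambda>a b. F X1 X2 (a * (\<beta> * S b)))) = F 1 1 \<beta>"
  using F by (simp_all add: D_contract P_counit_1 P_counit_2 P_counit_3 lin2_def lin3_def)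

lemma contract_N:
  assumes F: "lin3 F"
  shows "N i (\<lambda>X1 X2 X3. D j X1 (\<lambda>a b. F (S a * (\<alpha> * b)) X2 X3)) = F \<alpha> 1 1"
    "N i (\<lambda>X1 X2 X3. D j X2 (\<lambda>a b. F X1 (S a * (\<alpha> * b)) X3)) = F 1 \<alpha> 1"
    "N i (\<lambda>X1 X2 X3. D j X3 (\<lambda>a b. F X1 X2 (S a * (\<alpha> * b)))) = F 1 1 \<alpha>"
    "N i (\<lambda>X1 X2 X3. D j X1 (\<lambda>a b. F (a * (\<beta> * S b)) X2 X3)) = F \<beta> 1 1"
    "N i (\<lambda>X1 X2 X3. D j X2 (\<lambda>a b. F X1 (a * (\<beta> * S b)) X3)) = F 1 \<beta> 1"
    "N i (\<lambda>X1 X2 X3. D j X3 (\<lambda>a b. F X1 X2 (a * (\<beta> * S b)))) = F 1 1 \<beta>"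
  using F by (simp_all add: D_contract N_counit_1 N_counit_2 N_counit_3 lin2_def lin3_def)

section \<open>Shift and zigzag identities for p and q\<close>

text \<open>The element q = S(x1) \<alpha> x2 \<otimes> x3 lets \<open>h\<close> pass:
  \<open>coassoc_N\<close> brings the first two parts of \<open>h\<close> around \<alpha>, where
  they contract to a counit.\<close>

lemma q_shift:
  assumes F: "lin2 F"
  shows "D i h (\<lambda>h1 h2. D j h2 (\<lambda>a b. N k (\<lambda>x1 x2 x3. F (S h1 * (S x1 * (\<alpha> * (x2 * a)))) (x3 * b)))) =
    N k (\<lambda>x1 x2 x3. F (S x1 * (\<alpha> * x2)) (h * x3))"
proof -
  note F' = lin2_slots[OF F]
  have 1: "D 4 h1 (\<lambda>a b. F (S x1 * (S a * (\<alpha> * (b * x2)))) y) = \<epsilon> h1 * F (S x1 * (\<alpha> * x2)) y" for h1 x1 x2 y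
    using D_alpha[of "\<lambda>t. F (S x1 * t * x2) y" 4] by (simp add: sweedler F')
  have 2: "D 3 h (\<lambda>a b. \<epsilon> a * F x (b * y)) = F x (h * y)" for x y
    by (rule D_counit) (simp add: sweedler F')
  \<comment> \<open>The calculation uses numerals so that \<open>sum_sort\<close> can decide its
    side conditions. Unfolding the sums afterwards discards the indices. Most later lemmas end in
    the same way.\<close>
  have "D 3 h (\<lambda>h1 h2. D 4 h2 (\<lambda>a b. N 2 (\<lambda>x1 x2 x3. F (S h1 * (S x1 * (\<alpha> * (x2 * a)))) (x3 * b)))) =
    N 2 (\<lambda>x1 x2 x3. F (S x1 * (\<alpha> * x2)) (h * x3))"
    using coassoc_N[of "\<lambda>a b c. F (S a * (\<alpha> * b)) c" 2 3 h 4] by (simp add: sweedler F' 1 2)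
  then show ?thesis by (simp add: sum2_def sum3_def)
qed

text \<open>The pair X1 \<beta> S(X2) \<otimes> X3 is \<open>p_L\<close> with S applied to its first
  leg. The argument is that of \<open>q_shift\<close>, with \<open>coassoc_P\<close> and
  \<beta>.\<close>

lemma p_shift:
  assumes F: "lin2 F"
  shows "D i h (\<lambda>h1 h2. D j h2 (\<lambda>a b. P k (\<lambda>X1 X2 X3. F (h1 * (X1 * (\<beta> * (S X2 * S a)))) (b * X3)))) =
    P k (\<lambda>X1 X2 X3. F (X1 * (\<beta> * S X2)) (X3 * h))"
proof -
  note F' = lin2_slots[OF F]
  have 1: "D 4 h1 (\<lambda>a b. F (x1 * (a * (\<beta> * (S b * S x2)))) y) = \<epsilon> h1 * F (x1 * (\<beta> * S x2)) y" for h1 x1 x2 y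
    using D_beta[of "\<lambda>t. F (x1 * t * S x2) y" 4] by (simp add: sweedler F')
  have 2: "D 3 h (\<lambda>a b. \<epsilon> a * F x (y * b)) = F x (y * h)" for x y
    by (rule D_counit) (simp add: sweedler F')
  have "D 3 h (\<lambda>h1 h2. D 4 h2 (\<lambda>a b. P 5 (\<lambda>X1 X2 X3. F (h1 * (X1 * (\<beta> * (S X2 * S a)))) (b * X3)))) =
    P 2 (\<lambda>X1 X2 X3. F (X1 * (\<beta> * S X2)) (X3 * h))"
    using coassoc_P[of "\<lambda>a b c. F (a * (\<beta> * S b)) c" 3 h 4 5] by (simp add: sweedler F' 1 2 sum3_def)
  then show ?thesis by (simp add: sum2_def sum3_def)
qed

text \<open>In the form \<open>pentagon_3\<close> the first two legs surround \<alpha>, so one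
  associator is contracted and two inverse ones remain.\<close>

lemma q_coproduct:
  assumes F: "lin3 F"
  shows "N i (\<lambda>x1 x2 x3. D j x3 (\<lambda>a b. P k (\<lambda>X1 X2 X3. F (S x1 * (\<alpha> * (x2 * X1))) (a * X2) (b * X3)))) =
    N i' (\<lambda>x1 x2 x3. D j' x2 (\<lambda>a b. N k' (\<lambda>y1 y2 y3. F (S x1 * (S y1 * (\<alpha> * (y2 * a)))) (y3 * b) x3)))"
proof -
  note F' = lin3_slots[OF F]
  have "N 2 (\<lambda>x1 x2 x3. P 3 (\<lambda>X1 X2 X3. D 4 x3 (\<lambda>a b. F (S x1 * (\<alpha> * (x2 * X1))) (a * X2) (b * X3)))) =
    N 2 (\<lambda>x1 x2 x3. N 3 (\<lambda>y1 y2 y3. D 4 x2 (\<lambda>a b. F (S x1 * (S y1 * (\<alpha> * (y2 * a)))) (y3 * b) x3)))"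
    using pentagon_3[of "\<lambda>a b c d. F (S a * (\<alpha> * b)) c d" 2 4 3 5 6 3 2 4]
     contract_P(1)[of "\<lambda>t p q. N 2 (\<lambda>x1 x2 x3. N 3 (\<lambda>y1 y2 y3. D 4 x2 (\<lambda>a b.
       F (S x1 * (S y1 * (t * (y2 * a)))) (p * (y3 * b)) (q * x3))))" 5 6]
    by (simp add: sweedler F')
  then show ?thesis by (simp add: sum2_sum3_commute) (simp add: sum2_def sum3_def)
qed

text \<open>In the form \<open>pentagon_2'\<close>, \<beta> erases the inverse associator, \<alpha>
  erases one copy of \<Phi>, and the other copy is evaluated by X1 \<beta> S(X2) \<alpha> X3 = 1.
  The lemma serves to insert or remove a pair p, q.\<close>

lemma zigzag_pq:
  assumes F: "lin2 F"
  shows "P i (\<lambda>X1 X2 X3. D j X3 (\<lambda>a b. N k (\<lambda>x1 x2 x3.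
      F (X1 * (\<beta> * (S X2 * (S x1 * (\<alpha> * (x2 * a)))))) (x3 * b)))) = F 1 1"
proof -
  note F' = lin2_slots[OF F]
  have "P 2 (\<lambda>X1 X2 X3. N 3 (\<lambda>x1 x2 x3. D 4 X3 (\<lambda>a b.
      F (X1 * (\<beta> * (S X2 * (S x1 * (\<alpha> * (x2 * a)))))) (x3 * b)))) = F 1 1"
    using pentagon_2'[of "\<lambda>a b c d. F (a * (\<beta> * (S b * (\<alpha> * c)))) d" 2 4 3 5 6 3 2 4]
      contract_N(4)[of "\<lambda>t p q. P 2 (\<lambda>X1 X2 X3. P 3 (\<lambda>Y1 Y2 Y3. D 4 X2 (\<lambda>a b.
        F (X1 * (Y1 * (t * (S Y2 * (S a * (\<alpha> * (b * (Y3 * p)))))))) (X3 * q))))" 5 6]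
      contract_P(2)[of "\<lambda>p t q. P 3 (\<lambda>Y1 Y2 Y3. F (p * (Y1 * (\<beta> * (S Y2 * (t * Y3))))) q)" 2 4]
      P_antipode[of "\<lambda>t. F t 1" 3]
    by (simp add: sweedler F')
  then show ?thesis by (simp add: sum2_sum3_commute) (simp add: sum2_def sum3_def)
qed

lemma q_shift_nested:
  assumes F: "\<And>d. lin2 (\<lambda>u v. F u v d)"
  shows "D i h (\<lambda>c d. D j c (\<lambda>c1 c2. D k c2 (\<lambda>a b. N l (\<lambda>x1 x2 x3.
      F (S c1 * (S x1 * (\<alpha> * (x2 * a)))) (x3 * b) d)))) =
    D i h (\<lambda>c d. N l (\<lambda>x1 x2 x3. F (S x1 * (\<alpha> * x2)) (c * x3) d))"
  using q_shift[OF F] by simp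

section \<open>The Drinfeld twist\<close>

text \<open>The counterpart of \<open>gamma\<close> for \<open>\<beta>\<close>: the element \<open>\<Delta>(\<beta>) f\<^sup>-\<^sup>1\<close>, see \<open>twist_beta\<close>.\<close>

definition delta :: "('h \<times> 'h) list" where
  "delta = [(X11 * x1 * \<beta> * S X3, X12 * x2 * \<beta> * S (X2 * x3)).
     (X1, X2, X3) \<leftarrow> \<Phi>, (x1, x2, x3) \<leftarrow> \<Phi>', (X11, X12) \<leftarrow> \<Delta> X1]"

lemma sum_gamma:
  "sum2 i gamma F = P j (\<lambda>X1 X2 X3. N k (\<lambda>x1 x2 x3. D l x1 (\<lambda>a b.
     F (S (X2 * b) * \<alpha> * X3 * x2) (S (X1 * a) * \<alpha> * x3))))"
  by (simp add: sum2_def sum3_def gamma_def case_prod_unfold o_def sum_list_map_concat_map)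

lemma sum_delta:
  "sum2 i delta F = P j (\<lambda>X1 X2 X3. N k (\<lambda>x1 x2 x3. D l X1 (\<lambda>a b.
     F (a * (x1 * (\<beta> * S X3))) (b * (x2 * (\<beta> * (S x3 * S X2)))))))"
  by (simp add: sum2_def sum3_def delta_def case_prod_unfold o_def sum_list_map_concat_map
      antipode_mult mult.assoc)

text \<open>\<open>pentagon_1\<close> trades the coproduct of \<open>x1\<close> for one of
  \<open>X3\<close> and an extra inverse associator. The middle leg of the latter surrounds
  \<alpha>, so \<open>contract_N\<close> erases it. \<open>sum_delta'\<close> is the analogue for
  \<beta>, by \<open>pentagon_3'\<close>.\<close>

lemma sum_gamma':
  assumes F: "lin2 F"
  shows "sum2 i gamma F = P j (\<lambda>X1 X2 X3. N k (\<lambda>x1 x2 x3. D l X3 (\<lambda>a b.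
     F (S X2 * (S x1 * (\<alpha> * (x2 * a)))) (S X1 * (\<alpha> * (x3 * b))))))"
proof -
  note F' = lin2_slots[OF F]
  have "sum2 2 gamma F = P 2 (\<lambda>X1 X2 X3. N 3 (\<lambda>x1 x2 x3. D 4 X3 (\<lambda>a b.
     F (S X2 * (S x1 * (\<alpha> * (x2 * a)))) (S X1 * (\<alpha> * (x3 * b))))))"
    using sum_gamma[of 2 F 2 3 4]
      pentagon_1[of "\<lambda>a b c d. F (S b * (\<alpha> * c)) (S a * (\<alpha> * d))" 2 3 4 5 6 3 2 4]
      contract_N(2)[of "\<lambda>p t q. P 2 (\<lambda>X1 X2 X3. N 3 (\<lambda>w1 w2 w3. D 4 X3 (\<lambda>c d.
        F (S X2 * (S w1 * (t * (w2 * c)))) (S X1 * (S p * (\<alpha> * (q * (w3 * d))))))))" 5 6]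
    by (simp add: sweedler F' antipode_one)
  then show ?thesis by (simp add: sum2_def sum3_def)
qed

lemma sum_delta':
  assumes F: "lin2 F"
  shows "sum2 i delta F = N j (\<lambda>x1 x2 x3. P k (\<lambda>X1 X2 X3. D l x3 (\<lambda>a b.
     F (x1 * (\<beta> * (S X3 * S b))) (x2 * (X1 * (\<beta> * (S X2 * S a)))))))"
proof -
  note F' = lin2_slots[OF F]
  have "sum2 2 delta F = N 2 (\<lambda>x1 x2 x3. P 3 (\<lambda>X1 X2 X3. D 4 x3 (\<lambda>a b.
     F (x1 * (\<beta> * (S X3 * S b))) (x2 * (X1 * (\<beta> * (S X2 * S a)))))))"
    using sum_delta[of 2 F 2 3 4]
      pentagon_3'[of "\<lambda>a b c d. F (a * (\<beta> * S d)) (b * (\<beta> * S c))" 2 4 3 2 4 3 5 6]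
      contract_P(5)[of "\<lambda>p t q. N 2 (\<lambda>x1 x2 x3. P 3 (\<lambda>X1 X2 X3. D 4 x3 (\<lambda>a b.
        F (x1 * (p * (\<beta> * (S q * (S X3 * S b))))) (x2 * (X1 * (t * (S X2 * S a)))))))" 5 6]
    by (simp add: sweedler F' antipode_one)
  then show ?thesis by (simp add: sum2_def sum3_def)
qed

text \<open>In the form \<open>sum_gamma'\<close> the legs of \<Phi> are the outermost factors, so
  multiplying by \<Phi>' cancels them. The same cancellation in the two forms of
  \<open>delta\<close> gives \<open>P_delta\<close> and \<open>N_delta\<close>.\<close>

lemma N_gamma:
  assumes F: "lin2 F"
  shows "N i (\<lambda>v1 v2 v3. D j v3 (\<lambda>c d. sum2 k gamma (\<lambda>u w. F (S v2 * (u * c)) (S v1 * (w * d))))) =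
    N i (\<lambda>x1 x2 x3. F (S x1 * (\<alpha> * x2)) (\<alpha> * x3))"
proof -
  note F' = lin2_slots[OF F]
  have "N 2 (\<lambda>v1 v2 v3. P 3 (\<lambda>X1 X2 X3. N 4 (\<lambda>x1 x2 x3. D 5 v3 (\<lambda>c d. D 6 X3 (\<lambda>a b.
      F (S v2 * (S X2 * (S x1 * (\<alpha> * (x2 * (a * c)))))) (S v1 * (S X1 * (\<alpha> * (x3 * (b * d))))))))))
    = N 4 (\<lambda>x1 x2 x3. F (S x1 * (\<alpha> * x2)) (\<alpha> * x3))"
    using PN[of "\<lambda>p q r. N 4 (\<lambda>x1 x2 x3. D 5 r (\<lambda>c d.
      F (S q * (S x1 * (\<alpha> * (x2 * c)))) (S p * (\<alpha> * (x3 * d)))))" 3 2]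
    by (simp add: sweedler F' antipode_one D_one D_mult[of _ 5 _ _ 6 5])
  then show ?thesis
    by (subst sum_gamma'[where j = 2 and k = 3 and l = 4])
      (simp_all add: lin_antipode F' mult.assoc sum2_sum3_commute, simp add: sum2_def sum3_def)
qed

lemma P_delta:
  assumes F: "lin2 F"
  shows "P i (\<lambda>X1 X2 X3. D j X3 (\<lambda>a b. sum2 k delta (\<lambda>u w. F (X1 * (u * S b)) (X2 * (w * S a))))) =
    P i (\<lambda>X1 X2 X3. F (\<beta> * S X3) (X1 * (\<beta> * S X2)))"
proof -
  note F' = lin2_slots[OF F]
  have "P 2 (\<lambda>Z1 Z2 Z3. N 3 (\<lambda>x1 x2 x3. P 4 (\<lambda>X1 X2 X3. D 5 Z3 (\<lambda>a b. D 6 x3 (\<lambda>c d.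
      F (Z1 * (x1 * (\<beta> * (S X3 * (S d * S b))))) (Z2 * (x2 * (X1 * (\<beta> * (S X2 * (S c * S a)))))))))))
    = P 4 (\<lambda>X1 X2 X3. F (\<beta> * S X3) (X1 * (\<beta> * S X2)))"
    using PN[of "\<lambda>p q r. P 4 (\<lambda>X1 X2 X3. D 5 r (\<lambda>a b.
      F (p * (\<beta> * (S X3 * S b))) (q * (X1 * (\<beta> * (S X2 * S a))))))" 2 3]
    by (simp add: sweedler F' antipode_one D_one D_mult[of _ 5 _ _ 5 6])
  then show ?thesis
    by (subst sum_delta'[where j = 3 and k = 4 and l = 6])
      (simp_all add: lin_antipode F' mult.assoc sum2_sum3_commute, simp add: sum2_def sum3_def)
qed

lemma N_delta:
  assumes F: "lin2 F"
  shows "N i (\<lambda>v1 v2 v3. D j v1 (\<lambda>a b. sum2 k delta (\<lambda>u w. F (a * (u * S v3)) (b * (w * S v2))))) =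
    N i (\<lambda>x1 x2 x3. F (x1 * \<beta>) (x2 * (\<beta> * S x3)))"
proof -
  note F' = lin2_slots[OF F]
  have "N 2 (\<lambda>v1 v2 v3. P 3 (\<lambda>X1 X2 X3. N 4 (\<lambda>x1 x2 x3. D 5 v1 (\<lambda>a b. D 6 X1 (\<lambda>c d.
      F (a * (c * (x1 * (\<beta> * (S X3 * S v3))))) (b * (d * (x2 * (\<beta> * (S x3 * (S X2 * S v2)))))))))))
    = N 4 (\<lambda>x1 x2 x3. F (x1 * \<beta>) (x2 * (\<beta> * S x3)))"
    using NP[of "\<lambda>p q r. N 4 (\<lambda>x1 x2 x3. D 5 p (\<lambda>a b.
      F (a * (x1 * (\<beta> * S r))) (b * (x2 * (\<beta> * (S x3 * S q))))))" 2 3]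
    by (simp add: sweedler F' antipode_one D_one D_mult[of _ 5 _ _ 5 6])
  then show ?thesis
    by (subst sum_delta[where j = 3 and k = 4 and l = 6])
      (simp_all add: lin_antipode F' mult.assoc sum2_sum3_commute, simp add: sum2_def sum3_def)
qed

text \<open>\<open>coassoc_P\<close> carries \<open>h\<close> through \<Phi>, \<open>q_shift\<close>
  collects its last two parts, and \<alpha> contracts what is left. The result is the \<alpha>-axiom
  of the antipode with (S \<otimes> S) \<open>\<Delta>\<^sup>c\<^sup>o\<^sup>p\<close> and
  \<open>gamma\<close> in place of S and \<alpha>.\<close>

lemma gamma_invariant:
  assumes F: "lin2 F"
  shows "D i h (\<lambda>h1 h2. D j h1 (\<lambda>a b. D k h2 (\<lambda>c d. sum2 l gamma (\<lambda>u v.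
      F (S b * (u * c)) (S a * (v * d)))))) = \<epsilon> h * sum2 l gamma F"
proof -
  note F' = lin2_slots[OF F]
  have q: "D 4 h2 (\<lambda>a b. N 6 (\<lambda>x1 x2 x3. D 8 X3 (\<lambda>e g. D 10 b (\<lambda>c d. 
        F (S X2 * (S a * (S x1 * (\<alpha> * (x2 * (c * e)))))) (S X1 * (S h1 * (\<alpha> * (x3 * (d * g)))))))))
    = N 6 (\<lambda>x1 x2 x3. D 8 X3 (\<lambda>e g. 
        F (S X2 * (S x1 * (\<alpha> * (x2 * e)))) (S X1 * (S h1 * (\<alpha> * (h2 * (x3 * g)))))))"
    for h2 X1 X2 X3 h1
    using q_shift[of "\<lambda>u v. D 8 X3 (\<lambda>e g. F (S X2 * (u * e)) (S X1 * (S h1 * (\<alpha> * (v * g)))))" 4 h2 10 6]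
    by (simp add: sweedler F')
  have al: "D 3 h (\<lambda>h1 h2. N 6 (\<lambda>x1 x2 x3. D 8 X3 (\<lambda>e g. 
        F (S X2 * (S x1 * (\<alpha> * (x2 * e)))) (S X1 * (S h1 * (\<alpha> * (h2 * (x3 * g)))))))) =
      \<epsilon> h * N 6 (\<lambda>x1 x2 x3. D 8 X3 (\<lambda>e g. 
        F (S X2 * (S x1 * (\<alpha> * (x2 * e)))) (S X1 * (\<alpha> * (x3 * g)))))"
    for X1 X2 X3
    using D_alpha[of "\<lambda>t. N 6 (\<lambda>x1 x2 x3. D 8 X3 (\<lambda>e g. 
        F (S X2 * (S x1 * (\<alpha> * (x2 * e)))) (S X1 * (t * (x3 * g)))))" 3 h]
    by (simp add: lin_antipode F' mult.assoc antipode_mult)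
  have "D 3 h (\<lambda>h1 h2. D 4 h1 (\<lambda>a b. D 8 h2 (\<lambda>c d. sum2 2 gamma (\<lambda>u v.
      F (S b * (u * c)) (S a * (v * d)))))) = \<epsilon> h * sum2 3 gamma F"
    using coassoc_P[of "\<lambda>a b c. D 8 c (\<lambda>c d. N 6 (\<lambda>x1 x2 x3.
        F (S b * (S x1 * (\<alpha> * (x2 * c)))) (S a * (\<alpha> * (x3 * d)))))" 3 h 4 2]
    by (simp add: sweedler F' D_mult[of _ 8 _ _ 10 8] sum_gamma'[of _ 2 2 6 10] sum_gamma'[of _ 3 2 6 8] q al sum_mult_left)
  then show ?thesis by (simp add: sum2_def)
qed

text \<open>The analogue of \<open>p_shift\<close> for the right-handed element x1 \<otimes> x2
  \<beta> S(x3).\<close>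

lemma beta_absorb:
  assumes F: "lin2 F"
  shows "D i h (\<lambda>h1 h2. D j h1 (\<lambda>a b. N k (\<lambda>z1 z2 z3. F (a * z1) (b * (z2 * (\<beta> * (S z3 * S h2))))))) =
    N k (\<lambda>z1 z2 z3. F (z1 * h) (z2 * (\<beta> * S z3)))"
proof -
  note F' = lin2_slots[OF F]
  have 1: "D 4 h (\<lambda>a b. N 5 (\<lambda>z1 z2 z3. F (z1 * x) (z2 * (a * (\<beta> * (S b * S z3)))))) =
      \<epsilon> h * N 5 (\<lambda>z1 z2 z3. F (z1 * x) (z2 * (\<beta> * S z3)))" for h x
    using D_beta[of "\<lambda>t. N 5 (\<lambda>z1 z2 z3. F (z1 * x) (z2 * (t * S z3)))" 4] by (simp add: sweedler F')
  have 2: "D 3 h (\<lambda>a b. \<epsilon> b * N 5 (\<lambda>z1 z2 z3. F (z1 * a) (z2 * (\<beta> * S z3)))) =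
      N 5 (\<lambda>z1 z2 z3. F (z1 * h) (z2 * (\<beta> * S z3)))"
    by (rule D_counit) (simp add: sweedler F')
  have "D 3 h (\<lambda>h1 h2. D 4 h1 (\<lambda>a b. N 5 (\<lambda>z1 z2 z3. F (a * z1) (b * (z2 * (\<beta> * (S z3 * S h2))))))) =
    N 5 (\<lambda>z1 z2 z3. F (z1 * h) (z2 * (\<beta> * S z3)))"
    using coassoc_N[of "\<lambda>a b c. F a (b * (\<beta> * S c))" 5 3 h 4]
    by (simp add: sweedler F' 1 2)
  then show ?thesis by (simp add: sum2_def sum3_def)
qed

lemma delta_invariant:
  assumes F: "lin2 F"
  shows "D i h (\<lambda>h1 h2. D j h1 (\<lambda>a b. D k h2 (\<lambda>c d. sum2 l delta (\<lambda>u v.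
      F (a * (u * S d)) (b * (v * S c)))))) = \<epsilon> h * sum2 l delta F"
proof -
  note F' = lin2_slots[OF F]
  have ab: "D 4 h1 (\<lambda>a b. N 6 (\<lambda>z1 z2 z3. D 8 a (\<lambda>e g. D 10 X1 (\<lambda>c d.
        F (c * (e * (z1 * (\<beta> * (S h2 * S X3))))) (d * (g * (z2 * (\<beta> * (S z3 * (S b * S X2)))))))))) =
      N 6 (\<lambda>z1 z2 z3. D 10 X1 (\<lambda>c d.
        F (c * (z1 * (h1 * (\<beta> * (S h2 * S X3))))) (d * (z2 * (\<beta> * (S z3 * S X2))))))"
    for h1 h2 X1 X2 X3
    using beta_absorb[of "\<lambda>u v. D 10 X1 (\<lambda>c d. F (c * (u * (\<beta> * (S h2 * S X3)))) (d * (v * S X2)))" 4 h1 8 6]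
    by (simp add: sweedler F')
  have be: "D 3 h (\<lambda>h1 h2. N 6 (\<lambda>z1 z2 z3. D 10 X1 (\<lambda>c d.
        F (c * (z1 * (h1 * (\<beta> * (S h2 * S X3))))) (d * (z2 * (\<beta> * (S z3 * S X2))))))) =
      \<epsilon> h * N 6 (\<lambda>z1 z2 z3. D 10 X1 (\<lambda>c d.
        F (c * (z1 * (\<beta> * S X3))) (d * (z2 * (\<beta> * (S z3 * S X2))))))"
    for X1 X2 X3
    using D_beta[of "\<lambda>t. N 6 (\<lambda>z1 z2 z3. D 10 X1 (\<lambda>c d.
        F (c * (z1 * (t * S X3))) (d * (z2 * (\<beta> * (S z3 * S X2))))))" 3 h]
    by (simp add: lin_antipode F' mult.assoc antipode_mult)
  have "D 3 h (\<lambda>h1 h2. D 10 h1 (\<lambda>a b. D 4 h2 (\<lambda>c d. sum2 2 delta (\<lambda>u v.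
      F (a * (u * S d)) (b * (v * S c)))))) = \<epsilon> h * sum2 3 delta F"
    using coassoc_P[of "\<lambda>p q r. D 8 p (\<lambda>p1 p2. N 6 (\<lambda>z1 z2 z3.
      F (p1 * (z1 * (\<beta> * S r))) (p2 * (z2 * (\<beta> * (S z3 * S q))))))" 3 h 4 2]
    by (simp add: sweedler F' D_mult[of _ 8 _ _ 10 8] sum_delta[of 2 _ 2 6 8] sum_delta[of 3 _ 2 6 10] ab be sum_mult_left)
  then show ?thesis by (simp add: sum2_def)
qed

text \<open>This is X1 \<beta> S(X2) \<alpha> X3 = 1 for the triple with \<open>gamma\<close> and
  \<open>delta\<close>. \<open>pentagon_2\<close> puts an inverse associator around
  \<open>gamma\<close>, which \<open>N_gamma\<close> then simplifies. After
  \<open>beta_absorb\<close> and \<open>q_shift\<close> only \<open>zigzag_pq\<close> and its mirror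
  image remain.\<close>

lemma P_delta_gamma:
  assumes F: "lin2 F"
  shows "(P i $ \<lambda>X1 X2 X3. D j X1 $ \<lambda>a b. D k X2 $ \<lambda>c d. D l X3 $ \<lambda>e g.
      sum2 m delta $ \<lambda>u v. sum2 n gamma $ \<lambda>r s. F (a * u * S d * r * e) (b * v * S c * s * g)) = F 1 1"
proof -
  note F' = lin2_slots[OF F]
  have g: "(D 3 Y1 $ \<lambda>a b. P 4 $ \<lambda>X1 X2 X3. N 5 $ \<lambda>x1 x2 x3. N 6 $ \<lambda>z1 z2 z3. D 7 X3 $ \<lambda>c d.
      sum2 8 gamma $ \<lambda>r s. D 9 X1 $ \<lambda>e g. D 10 a $ \<lambda>a1 a2. D 11 x3 $ \<lambda>e1 g1. D 11 d $ \<lambda>e2 g2. D 13 Y3 $ \<lambda>e3 g3.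
        F (e * a1 * z1 * \<beta> * S Y2 * S c * S x2 * r * e1 * e2 * e3)
          (g * a2 * z2 * \<beta> * S z3 * S b * S X2 * S x1 * s * g1 * g2 * g3)) =
    (P 4 $ \<lambda>X1 X2 X3. D 7 X3 $ \<lambda>c d. N 5 $ \<lambda>x1 x2 x3. N 6 $ \<lambda>z1 z2 z3. D 9 X1 $ \<lambda>e g. D 11 d $ \<lambda>e2 g2. D 13 Y3 $ \<lambda>e3 g3.
        F (e * z1 * Y1 * \<beta> * S Y2 * S c * S x1 * \<alpha> * x2 * e2 * e3)
          (g * z2 * \<beta> * S z3 * S X2 * \<alpha> * x3 * g2 * g3))" for Y1 Y2 Y3
    using N_gamma[of "\<lambda>u w. D 3 Y1 $ \<lambda>a b. P 4 $ \<lambda>X1 X2 X3. N 6 $ \<lambda>z1 z2 z3. D 7 X3 $ \<lambda>c d.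
        D 9 X1 $ \<lambda>e g. D 10 a $ \<lambda>a1 a2. D 11 d $ \<lambda>e2 g2. D 13 Y3 $ \<lambda>e3 g3.
        F (e * a1 * z1 * \<beta> * S Y2 * S c * u * e2 * e3) (g * a2 * z2 * \<beta> * S z3 * S b * S X2 * w * g2 * g3)" 5 11 8]
      beta_absorb[of "\<lambda>u v. P 4 $ \<lambda>X1 X2 X3. N 5 $ \<lambda>x1 x2 x3. D 7 X3 $ \<lambda>c d. D 9 X1 $ \<lambda>e g. D 11 d $ \<lambda>e2 g2. D 13 Y3 $ \<lambda>e3 g3.
        F (e * u * \<beta> * S Y2 * S c * S x1 * \<alpha> * x2 * e2 * e3) (g * v * S X2 * \<alpha> * x3 * g2 * g3)" 3 Y1 10 6]
    by (simp add: sweedler F')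
  have q: "(D 7 X3 $ \<lambda>c d. N 5 $ \<lambda>x1 x2 x3. N 6 $ \<lambda>z1 z2 z3. D 9 X1 $ \<lambda>e g. D 11 d $ \<lambda>e2 g2. D 13 Y3 $ \<lambda>e3 g3.
        F (e * z1 * Y1 * \<beta> * S Y2 * S c * S x1 * \<alpha> * x2 * e2 * e3)
          (g * z2 * \<beta> * S z3 * S X2 * \<alpha> * x3 * g2 * g3)) =
    (N 5 $ \<lambda>x1 x2 x3. N 6 $ \<lambda>z1 z2 z3. D 9 X1 $ \<lambda>e g. D 13 Y3 $ \<lambda>e3 g3.
        F (e * z1 * Y1 * \<beta> * S Y2 * S x1 * \<alpha> * x2 * e3)
          (g * z2 * \<beta> * S z3 * S X2 * \<alpha> * X3 * x3 * g3))" for X1 X2 X3 Y1 Y2 Y3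
    using q_shift[of "\<lambda>u v. N 6 $ \<lambda>z1 z2 z3. D 9 X1 $ \<lambda>e g. D 13 Y3 $ \<lambda>e3 g3.
        F (e * z1 * Y1 * \<beta> * S Y2 * u * e3) (g * z2 * \<beta> * S z3 * S X2 * \<alpha> * v * g3)" 7 X3 11 5]
    by (simp add: sweedler F')
  have "(P 3 $ \<lambda>X1 X2 X3. D 9 X1 $ \<lambda>a b. D 4 X2 $ \<lambda>c d. D 13 X3 $ \<lambda>e g.
      sum2 6 delta $ \<lambda>u v. sum2 8 gamma $ \<lambda>r s. F (a * u * S d * r * e) (b * v * S c * s * g)) =
     (P 4 $ \<lambda>X1 X2 X3. N 6 $ \<lambda>z1 z2 z3. D 9 X1 $ \<lambda>e g. F (e * z1) (g * z2 * \<beta> * S z3 * S X2 * \<alpha> * X3))"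
    using pentagon_2[of "\<lambda>p q t w. D 10 p $ \<lambda>p1 p2. D 13 w $ \<lambda>e g. sum2 8 gamma $ \<lambda>r s. N 6 $ \<lambda>z1 z2 z3.
        F (p1 * z1 * \<beta> * S t * r * e) (p2 * z2 * \<beta> * S z3 * S q * s * g)" 3 4 2 5 4 7 2 3]
      g q zigzag_pq[of "\<lambda>u v. P 4 $ \<lambda>X1 X2 X3. N 6 $ \<lambda>z1 z2 z3. D 9 X1 $ \<lambda>e g.
        F (e * z1 * u) (g * z2 * \<beta> * S z3 * S X2 * \<alpha> * X3 * v)" 2 13 5]
    by (simp add: sweedler F' D_mult[of _ 10 _ _ 9 10] D_mult[of _ 13 _ _ 11 13] sum_delta[of 6 _ 2 6 10])
  \<comment> \<open>The mirror image of \<open>zigzag_pq\<close>, with x1 \<otimes> x2 \<beta> S(x3)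
    and X1 \<otimes> S(X2) \<alpha> X3 as its two elements.\<close>
  moreover have "(P 4 $ \<lambda>X1 X2 X3. N 6 $ \<lambda>z1 z2 z3. D 9 X1 $ \<lambda>e g.
      F (e * z1) (g * z2 * \<beta> * S z3 * S X2 * \<alpha> * X3)) = F 1 1"
    using pentagon_3'[of "\<lambda>a b c d. F a (b * \<beta> * S c * \<alpha> * d)" 4 9 6 2 3 4 5 6]
      contract_P(5)[of "\<lambda>p t q. N 2 $ \<lambda>x1 x2 x3. D 3 x3 $ \<lambda>a b. P 4 $ \<lambda>X1 X2 X3.
        F (x1 * p) (x2 * X1 * t * S X2 * S a * \<alpha> * b * X3 * q)" 5 6]
      contract_N(3)[of "\<lambda>p q t. P 4 $ \<lambda>X1 X2 X3. F p (q * X1 * \<beta> * S X2 * t * X3)" 2 3]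
      P_antipode[of "\<lambda>t. F 1 t" 4]
    by (simp add: sweedler F')
  ultimately show ?thesis by (simp add: sum2_def sum3_def)
qed

text \<open>The companion of \<open>P_delta_gamma\<close> for S(x1) \<alpha> x2 \<beta> S(x3) = 1.
  \<open>pentagon_1\<close> is applied to the legs around \<open>gamma\<close>, then
  \<open>gamma\<close> and \<open>delta\<close> are eliminated in turn.\<close>

lemma N_gamma_delta:
  assumes F: "lin2 F"
  shows "(N i $ \<lambda>x1 x2 x3. D j x1 $ \<lambda>a b. D k x2 $ \<lambda>e g. D l x3 $ \<lambda>c d.
      sum2 m gamma $ \<lambda>r s. sum2 n delta $ \<lambda>u v. F (S b * r * e * u * S d) (S a * s * g * v * S c)) = F 1 1"
proof -
  note F' = lin2_slots[OF F]
  have q: "(D 3 z2 $ \<lambda>a b. N 4 $ \<lambda>w1 w2 w3. P 5 $ \<lambda>X1 X2 X3. D 6 X3 $ \<lambda>c d. N 7 $ \<lambda>y1 y2 y3.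
      sum2 9 delta $ \<lambda>u v. D 10 b $ \<lambda>b1 b2. D 10 w2 $ \<lambda>p1 p2. D 12 z3 $ \<lambda>k1 k2. D 12 w3 $ \<lambda>l1 l2. D 13 c $ \<lambda>c1 c2. D 14 d $ \<lambda>d1 d2.
        F (S X2 * S w1 * S a * S y1 * \<alpha> * y2 * b1 * p1 * c1 * u * S d2 * S l2 * S k2)
          (S X1 * S z1 * \<alpha> * y3 * b2 * p2 * c2 * v * S d1 * S l1 * S k1)) =
    (N 4 $ \<lambda>w1 w2 w3. P 5 $ \<lambda>X1 X2 X3. D 6 X3 $ \<lambda>c d. N 7 $ \<lambda>y1 y2 y3.
      sum2 9 delta $ \<lambda>u v. D 10 w2 $ \<lambda>p1 p2. D 12 z3 $ \<lambda>k1 k2. D 12 w3 $ \<lambda>l1 l2. D 13 c $ \<lambda>c1 c2. D 14 d $ \<lambda>d1 d2.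
        F (S X2 * S w1 * S y1 * \<alpha> * y2 * p1 * c1 * u * S d2 * S l2 * S k2)
          (S X1 * S z1 * \<alpha> * z2 * y3 * p2 * c2 * v * S d1 * S l1 * S k1))" for z1 z2 z3
    using q_shift[of "\<lambda>U V. N 4 $ \<lambda>w1 w2 w3. P 5 $ \<lambda>X1 X2 X3. D 6 X3 $ \<lambda>c d.
      sum2 9 delta $ \<lambda>u v. D 10 w2 $ \<lambda>p1 p2. D 12 z3 $ \<lambda>k1 k2. D 12 w3 $ \<lambda>l1 l2. D 13 c $ \<lambda>c1 c2. D 14 d $ \<lambda>d1 d2.
        F (S X2 * S w1 * U * p1 * c1 * u * S d2 * S l2 * S k2)
          (S X1 * S z1 * \<alpha> * V * p2 * c2 * v * S d1 * S l1 * S k1)" 3 z2 10 7]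
    by (simp add: sweedler F')
  \<comment> \<open>The coproducts of both parts of \<open>X3\<close> surround \<open>delta\<close>.
    By \<open>delta_invariant\<close> they collapse to \<epsilon>(X3), and this counit erases
    \<Phi>.\<close>
  have d: "(P 5 $ \<lambda>X1 X2 X3. D 6 X3 $ \<lambda>c d. N 7 $ \<lambda>y1 y2 y3.
      sum2 9 delta $ \<lambda>u v. D 10 w2 $ \<lambda>p1 p2. D 12 z3 $ \<lambda>k1 k2. D 12 w3 $ \<lambda>l1 l2. D 13 c $ \<lambda>c1 c2. D 14 d $ \<lambda>d1 d2.
        F (S X2 * S w1 * S y1 * \<alpha> * y2 * p1 * c1 * u * S d2 * S l2 * S k2)
          (S X1 * S z1 * \<alpha> * z2 * y3 * p2 * c2 * v * S d1 * S l1 * S k1)) =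
    (N 7 $ \<lambda>y1 y2 y3. sum2 9 delta $ \<lambda>u v. D 10 w2 $ \<lambda>p1 p2. D 12 z3 $ \<lambda>k1 k2. D 12 w3 $ \<lambda>l1 l2.
        F (S w1 * S y1 * \<alpha> * y2 * p1 * u * S l2 * S k2)
          (S z1 * \<alpha> * z2 * y3 * p2 * v * S l1 * S k1))" for z1 z2 z3 w1 w2 w3
  proof -
    have "(D 6 X3 $ \<lambda>c d. N 7 $ \<lambda>y1 y2 y3.
      sum2 9 delta $ \<lambda>u v. D 10 w2 $ \<lambda>p1 p2. D 12 z3 $ \<lambda>k1 k2. D 12 w3 $ \<lambda>l1 l2. D 13 c $ \<lambda>c1 c2. D 14 d $ \<lambda>d1 d2.
        F (S X2 * S w1 * S y1 * \<alpha> * y2 * p1 * c1 * u * S d2 * S l2 * S k2)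
          (S X1 * S z1 * \<alpha> * z2 * y3 * p2 * c2 * v * S d1 * S l1 * S k1)) =
      \<epsilon> X3 * (N 7 $ \<lambda>y1 y2 y3. sum2 9 delta $ \<lambda>u v. D 10 w2 $ \<lambda>p1 p2. D 12 z3 $ \<lambda>k1 k2. D 12 w3 $ \<lambda>l1 l2.
        F (S X2 * S w1 * S y1 * \<alpha> * y2 * p1 * u * S l2 * S k2)
          (S X1 * S z1 * \<alpha> * z2 * y3 * p2 * v * S l1 * S k1))" for X1 X2 X3
      using delta_invariant[of "\<lambda>U V. N 7 $ \<lambda>y1 y2 y3. D 10 w2 $ \<lambda>p1 p2. D 12 z3 $ \<lambda>k1 k2. D 12 w3 $ \<lambda>l1 l2.
        F (S X2 * S w1 * S y1 * \<alpha> * y2 * p1 * U * S l2 * S k2)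
          (S X1 * S z1 * \<alpha> * z2 * y3 * p2 * V * S l1 * S k1)" 6 X3 13 14 9]
      by (simp add: sweedler F')
    then show ?thesis
      using P_counit_3[of "\<lambda>p q. N 7 $ \<lambda>y1 y2 y3. sum2 9 delta $ \<lambda>u v. D 10 w2 $ \<lambda>p1 p2. D 12 z3 $ \<lambda>k1 k2. D 12 w3 $ \<lambda>l1 l2.
        F (S q * S w1 * S y1 * \<alpha> * y2 * p1 * u * S l2 * S k2)
          (S p * S z1 * \<alpha> * z2 * y3 * p2 * v * S l1 * S k1)" 5]
      by (simp add: sweedler F' antipode_one)
  qed
  have "(N 3 $ \<lambda>x1 x2 x3. D 4 x1 $ \<lambda>a b. D 13 x2 $ \<lambda>e g. D 14 x3 $ \<lambda>c d.
      sum2 8 gamma $ \<lambda>r s. sum2 9 delta $ \<lambda>u v. F (S b * r * e * u * S d) (S a * s * g * v * S c)) =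
    (N 2 $ \<lambda>z1 z2 z3. N 4 $ \<lambda>w1 w2 w3. N 7 $ \<lambda>y1 y2 y3. sum2 9 delta $ \<lambda>u v. D 10 w2 $ \<lambda>p1 p2. D 12 z3 $ \<lambda>k1 k2. D 12 w3 $ \<lambda>l1 l2.
        F (S w1 * S y1 * \<alpha> * y2 * p1 * u * S l2 * S k2)
          (S z1 * \<alpha> * z2 * y3 * p2 * v * S l1 * S k1))"
    using pentagon_1[of "\<lambda>p q t w. D 13 t $ \<lambda>e g. D 14 w $ \<lambda>c d. sum2 9 delta $ \<lambda>u v. N 7 $ \<lambda>y1 y2 y3.
        F (S q * S y1 * \<alpha> * y2 * e * u * S d) (S p * \<alpha> * y3 * g * v * S c)" 2 3 4 2 3 4 5 6] q d
    by (simp add: sweedler F' D_mult[of _ 13 _ _ 10 13] D_mult[of _ 14 _ _ 12 14] sum_gamma'[of _ 8 2 7 10])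
  \<comment> \<open>\<open>q_coproduct\<close> exchanges an inverse associator for an associator in
    front of \<open>delta\<close>, where \<open>P_delta\<close> applies.\<close>
  moreover have "\<dots> = (N 2 $ \<lambda>z1 z2 z3. N 4 $ \<lambda>x1 x2 x3. P 7 $ \<lambda>X1 X2 X3. D 10 x3 $ \<lambda>a b. D 12 z3 $ \<lambda>k1 k2. D 13 b $ \<lambda>b1 b2.
      F (S x1 * \<alpha> * x2 * \<beta> * S X3 * S b2 * S k2) (S z1 * \<alpha> * z2 * a * X1 * \<beta> * S X2 * S b1 * S k1))"
    using q_coproduct[of "\<lambda>p q r. N 2 $ \<lambda>z1 z2 z3. sum2 9 delta $ \<lambda>u v. D 12 z3 $ \<lambda>k1 k2. D 12 r $ \<lambda>l1 l2.
        F (p * u * S l2 * S k2) (S z1 * \<alpha> * z2 * q * v * S l1 * S k1)" 4 10 7 4 10 7]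
      P_delta[of "\<lambda>U V. N 4 $ \<lambda>x1 x2 x3. N 2 $ \<lambda>z1 z2 z3. D 10 x3 $ \<lambda>a b. D 12 z3 $ \<lambda>k1 k2. D 13 b $ \<lambda>b1 b2.
        F (S x1 * \<alpha> * x2 * U * S b2 * S k2) (S z1 * \<alpha> * z2 * a * V * S b1 * S k1)" 7 14 9]
    by (simp add: sweedler F' D_mult[of _ 12 _ _ 13 14])
  moreover have "\<dots> = F 1 1"
  proof -
    have "(D 10 x3 $ \<lambda>a b. P 7 $ \<lambda>X1 X2 X3. D 12 z3 $ \<lambda>k1 k2. D 13 b $ \<lambda>b1 b2.
        F (S x1 * \<alpha> * x2 * \<beta> * S X3 * S b2 * S k2) (S z1 * \<alpha> * z2 * a * X1 * \<beta> * S X2 * S b1 * S k1)) =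
      (P 7 $ \<lambda>X1 X2 X3. D 12 z3 $ \<lambda>k1 k2.
        F (S x1 * \<alpha> * x2 * \<beta> * S x3 * S X3 * S k2) (S z1 * \<alpha> * z2 * X1 * \<beta> * S X2 * S k1))" for x1 x2 x3 z1 z2 z3
      using p_shift[of "\<lambda>U V. D 12 z3 $ \<lambda>k1 k2. F (S x1 * \<alpha> * x2 * \<beta> * S V * S k2) (S z1 * \<alpha> * z2 * U * S k1)" 10 x3 13 7]
      by (simp add: sweedler F')
    then show ?thesis
      using N_antipode[of "\<lambda>t. N 2 $ \<lambda>z1 z2 z3. P 7 $ \<lambda>X1 X2 X3. D 12 z3 $ \<lambda>k1 k2.
          F (t * S X3 * S k2) (S z1 * \<alpha> * z2 * X1 * \<beta> * S X2 * S k1)" 4]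
        q_coproduct[of "\<lambda>p q r. F (S r) (p * \<beta> * S q)" 2 12 7 2 12 7]
        contract_N(5)[of "\<lambda>p t q. N 7 $ \<lambda>y1 y2 y3. F (S q) (S p * S y1 * \<alpha> * y2 * t * S y3)" 2 12]
        N_antipode[of "\<lambda>t. F 1 t" 7]
      by (simp add: sweedler F' antipode_one)
  qed
  ultimately show ?thesis by (simp add: sum2_def sum3_def)
qed

text \<open>
  The twist is \<open>twist_form\<close> at \<open>x1\<close> and \<open>x2 \<beta> S(x3)\<close>. The pairing is left invariant because \<open>gamma\<close> satisfies the
  same equation as \<open>\<alpha>\<close>. This lets \<open>h\<close> pass through the twist as it passes through \<open>S(x1) \<alpha> x2 \<beta> S(x3)\<close>.
\<close>

definition twist_form :: "('h \<Rightarrow> 'h \<Rightarrow> 'k) \<Rightarrow> 'h \<Rightarrow> 'h \<Rightarrow> 'k" where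
  "twist_form F p q = (D 3 p $ \<lambda>a b. sum2 2 gamma $ \<lambda>r s. D 4 q $ \<lambda>c d. F (S b * r * c) (S a * s * d))"

lemma lin_twist_form:
  assumes F: "lin2 F"
  shows "lin_map E \<Longrightarrow> lin (\<lambda>x. twist_form F (E x) q)" "lin_map E \<Longrightarrow> lin (\<lambda>x. twist_form F p (E x))"
  using lin2_slots[OF F] by (simp_all add: twist_form_def lin_antipode)

lemma lin_twist_form_body:
  assumes "\<And>u v. lin (\<lambda>x. F x u v)"
  shows "lin (\<lambda>x. twist_form (\<lambda>u v. F x u v) p q)"
  unfolding twist_form_def by (intro lin_sum2 assms)

lemma twist_form_right:
  assumes F: "lin2 F"
  shows "D i c (\<lambda>a b. twist_form (\<lambda>u v. F (u * a) (v * b)) p q) = twist_form F p (q * c)"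
proof -
  note F' = lin2_slots[OF F]
  have "D 5 c (\<lambda>a b. twist_form (\<lambda>u v. F (u * a) (v * b)) p q) = twist_form F p (q * c)"
    by (simp add: twist_form_def sweedler F' D_mult[of _ 4 _ _ 4 5])
  then show ?thesis by (simp add: sum2_def)
qed

lemma twist_form_left:
  assumes F: "lin2 F"
  shows "D i c (\<lambda>a b. twist_form (\<lambda>u v. F (S b * u) (S a * v)) p q) = twist_form F (p * c) q"
proof -
  note F' = lin2_slots[OF F]
  have "D 5 c (\<lambda>a b. twist_form (\<lambda>u v. F (S b * u) (S a * v)) p q) = twist_form F (p * c) q"
    by (simp add: twist_form_def sweedler F' D_mult[of _ 3 _ _ 3 5])
  then show ?thesis by (simp add: sum2_def)
qed

lemma twist_form_one:
  assumes F: "lin2 F"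
  shows "twist_form F 1 1 = sum2 i gamma F"
  using lin2_slots[OF F]
  by (simp add: twist_form_def D_one lin_antipode antipode_one) (simp add: sum2_def)

lemma twist_form_invariant:
  assumes F: "lin2 F"
  shows "D i h (\<lambda>a b. twist_form F (a * p) (b * q)) = \<epsilon> h * twist_form F p q"
proof -
  note F' = lin2_slots[OF F]
  have "D 5 h (\<lambda>a b. twist_form F (a * p) (b * q)) = \<epsilon> h * twist_form F p q"
    using gamma_invariant[of "\<lambda>u v. D 3 p $ \<lambda>a b. D 4 q $ \<lambda>c d. F (S b * u * c) (S a * v * d)" 5 h 6 7 2]
    by (simp add: twist_form_def sweedler F' D_mult[of _ 3 _ _ 6 3] D_mult[of _ 4 _ _ 7 4])
  then show ?thesis by (simp add: sum2_def)
qed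

lemma sum_twist: "sum2 i drinfeld_twist F = (N j $ \<lambda>x1 x2 x3. twist_form F x1 (x2 * \<beta> * S x3))"
  by (simp add: sum2_def sum3_def drinfeld_twist_def twist_form_def case_prod_unfold o_def
      sum_list_map_concat_map)

lemma twist_antipode:
  assumes F: "lin2 F"
  shows "(D i (S h) $ \<lambda>a b. sum2 j drinfeld_twist $ \<lambda>u v. F (u * a) (v * b)) =
    (D i h $ \<lambda>a b. sum2 j drinfeld_twist $ \<lambda>u v. F (S b * u) (S a * v))"
proof -
  note F' = lin2_slots[OF F]
  note T = lin_twist_form[OF F]
  \<comment> \<open>By \<open>twist_form_left\<close> the right-hand side of the lemma is the twist
    with \<open>x1\<close> replaced by \<open>x1 * h\<close>. Writing h as h1 \<epsilon>(h2), and
    \<epsilon>(h2) \<beta> as a contracted coproduct, spreads \<open>h\<close> over all three legs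
    of \<Phi>'.\<close>
  have "(N 2 $ \<lambda>x1 x2 x3. twist_form F (x1 * h) (x2 * \<beta> * S x3)) =
      (N 2 $ \<lambda>x1 x2 x3. D 3 h $ \<lambda>h1 h2. D 4 h2 $ \<lambda>a b. twist_form F (x1 * h1) (x2 * a * \<beta> * S b * S x3))"
  proof -
    have "D 4 h2 (\<lambda>a b. twist_form F p (x2 * (a * (\<beta> * (S b * S x3))))) = \<epsilon> h2 * twist_form F p (x2 * (\<beta> * S x3))"
      for h2 p x2 x3
      using D_beta[of "\<lambda>t. twist_form F p (x2 * t * S x3)" 4] by (simp add: sweedler T)
    moreover have "D 3 h (\<lambda>h1 h2. \<epsilon> h2 * twist_form F (x1 * h1) q) = twist_form F (x1 * h) q" for x1 q
      by (rule D_counit) (simp add: sweedler T)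
    ultimately show ?thesis by (simp add: mult.assoc)
  qed
  \<comment> \<open>\<open>coassoc_N\<close> carries \<open>h\<close> to the left of \<Phi>'. There
    \<open>twist_form_invariant\<close> absorbs its first part and leaves \<open>S h\<close> at the
    right end.\<close>
  also have "\<dots> = (N 2 $ \<lambda>x1 x2 x3. twist_form F x1 (x2 * \<beta> * S x3 * S h))"
  proof -
    have "D 4 h1 (\<lambda>a b. twist_form F (a * x1) (b * (x2 * y))) = \<epsilon> h1 * twist_form F x1 (x2 * y)" for h1 x1 x2 y
      by (rule twist_form_invariant) (rule F)
    moreover have "D 3 h (\<lambda>h1 h2. \<epsilon> h1 * twist_form F p (q * (r * (s * S h2)))) = twist_form F p (q * (r * (s * S h)))"
      for p q r s
      by (rule D_counit) (simp add: sweedler T)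
    ultimately show ?thesis
      using coassoc_N[of "\<lambda>a b c. twist_form F a (b * \<beta> * S c)" 2 3 h 4]
      by (simp add: sweedler T)
  qed
  finally show ?thesis
    by (subst (1 2) sum_twist[of _ _ 2], unfold sum2_sum3_commute)
      (simp add: twist_form_right twist_form_left F)
qed

text \<open>Evaluating \<open>twist_form\<close> on \<open>pentagon_3\<close>, the left side
  collapses to \<open>twist_form F 1 1\<close>, that is, to \<open>gamma\<close>. On the right,
  \<beta> contracts one inverse associator, and invariance leaves the twist times
  \<Delta>(\<alpha>).\<close>

lemma twist_alpha:
  assumes F: "lin2 F"
  shows "(D i \<alpha> $ \<lambda>a b. sum2 j drinfeld_twist $ \<lambda>u v. F (u * a) (v * b)) = sum2 j gamma F"
proof -
  note F' = lin2_slots[OF F]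
  note T = lin_twist_form[OF F]
  have inv: "(D 5 X1 $ \<lambda>a b. N 3 $ \<lambda>z1 z2 z3. twist_form F (a * z1) (b * (z2 * (\<beta> * (S z3 * y))))) =
      \<epsilon> X1 * (N 3 $ \<lambda>z1 z2 z3. twist_form F z1 (z2 * (\<beta> * (S z3 * y))))" for X1 y
  proof -
    have "D 5 X1 (\<lambda>a b. twist_form F (a * z1) (b * (z2 * y))) = \<epsilon> X1 * twist_form F z1 (z2 * y)" for z1 z2 y
      by (rule twist_form_invariant) (rule F)
    then show ?thesis by (simp add: sum_sort sum_mult_left)
  qed
  have "(N 3 $ \<lambda>x1 x2 x3. twist_form F x1 (x2 * \<beta> * S x3 * \<alpha>)) = twist_form F 1 1"
    using pentagon_3[of "\<lambda>a b c d. twist_form F a (b * \<beta> * S c * \<alpha> * d)" 2 4 3 2 5 3 6 7]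
      contract_N(5)[of "\<lambda>p t q. P 2 $ \<lambda>X1 X2 X3. D 5 X1 $ \<lambda>a b. N 3 $ \<lambda>z1 z2 z3.
        twist_form F (a * z1 * p) (b * z2 * t * S z3 * S X2 * \<alpha> * X3 * q)" 6 7]
      contract_N(3)[of "\<lambda>p q t. P 3 $ \<lambda>X1 X2 X3. twist_form F p (q * X1 * \<beta> * S X2 * t * X3)" 2 4]
      P_antipode[of "\<lambda>t. twist_form F 1 t" 3]
      P_counit_1[of "\<lambda>p q. N 3 $ \<lambda>z1 z2 z3. twist_form F z1 (z2 * \<beta> * S z3 * S p * \<alpha> * q)" 2]
    by (simp add: sweedler T inv antipode_one)
  then show ?thesis
    by (subst sum_twist[of _ _ 3], unfold sum2_sum3_commute)
      (simp add: twist_form_right twist_form_one F)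
qed

text \<open>Stated without the inverse twist, so that it can be used in constructing that
  inverse.\<close>

lemma twist_beta:
  assumes F: "lin2 F"
  shows "(sum2 i delta $ \<lambda>u v. sum2 j drinfeld_twist $ \<lambda>r s. F (u * r) (v * s)) = D k \<beta> F"
proof -
  note F' = lin2_slots[OF F]
  \<comment> \<open>\<open>E p q t\<close> evaluates \<Delta>(p) \<delta> (S \<otimes>
    S)(\<open>\<Delta>\<^sup>c\<^sup>o\<^sup>p\<close> q) \<gamma> \<Delta>(t), with
    \<open>delta\<close> and \<open>gamma\<close> written as \<delta> and \<gamma>. Facts
    \<open>b\<close> and \<open>a\<close> are the invariance of \<delta> and \<gamma>, and
    \<open>c\<close> is \<open>P_delta_gamma\<close>. The claim follows by feeding
    \<open>pentagon_2'\<close> into \<open>E\<close>.\<close>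
  define E where "E p q t = (D 8 p $ \<lambda>a b. sum2 7 delta $ \<lambda>u v. twist_form (\<lambda>r s. F (a * u * r) (b * v * s)) q t)" for p q t
  have E: "lin3 E"
    by (simp add: E_def lin_antipode F' lin_twist_form lin_twist_form_body)
  note E' = lin3_slots[OF E]
  have b: "(D 9 h $ \<lambda>a b. E (p * (q * a)) (x * (y * b)) t) = \<epsilon> h * E (p * q) (x * y) t" for h p q x y t
  proof -
    have "(D 9 h $ \<lambda>a b. E (p * a) (x * b) t) = \<epsilon> h * E p x t" for p x
      using delta_invariant[of "\<lambda>U V. D 8 p $ \<lambda>a b. D 3 x $ \<lambda>c d. D 4 t $ \<lambda>e g. sum2 2 gamma $ \<lambda>r s.
        F (a * U * S d * r * e) (b * V * S c * s * g)" 9 h 11 10 7]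
      by (simp add: E_def twist_form_def sweedler F' D_mult[of _ 8 _ _ 8 11] D_mult[of _ 3 _ _ 3 10])
    from this[of "p * q" "x * y"] show ?thesis by (simp add: mult.assoc)
  qed
  have n: "(N 6 $ \<lambda>y1 y2 y3. \<epsilon> y1 * E p q (x * (y * (y2 * (\<beta> * (S y3 * z)))))) = E p q (x * (y * (\<beta> * z)))" for p q x y z
    using N_counit_1[of "\<lambda>u v. E p q (x * y * u * \<beta> * S v * z)" 6] by (simp add: sweedler E' antipode_one)
  have a: "(D 5 h $ \<lambda>a b. E p (a * x) (b * (y * w))) = \<epsilon> h * E p x (y * w)" for h p x y w
  proof -
    have "(D 9 h $ \<lambda>a b. E p (a * x) (b * (y * w))) = \<epsilon> h * E p x (y * w)"
      using twist_form_invariant[of "\<lambda>r s. F (c * u * r) (d * v * s)" 9 h x "y * w" for c u d v]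
      by (simp add: E_def sum_sort lin_antipode F' sum_mult_left mult.assoc)
    then show ?thesis by (simp add: sum2_def)
  qed
  have p: "(P 4 $ \<lambda>X1 X2 X3. \<epsilon> X2 * E (X1 * x) y (z * (w * S X3))) = E x y (z * w)" for x y z w
    using P_counit_2[of "\<lambda>u v. E (u * x) y (z * w * S v)" 4] by (simp add: sweedler E' antipode_one)
  have c: "(P 2 $ \<lambda>X1 X2 X3. E X1 X2 (X3 * w)) = D 5 w F" for w
    using P_delta_gamma[of "\<lambda>U V. D 5 w $ \<lambda>c d. F (U * c) (V * d)" 2 8 3 4 7 2]
    by (simp add: E_def twist_form_def sweedler F' D_mult[of _ 4 _ _ 4 5])
  have "D 5 \<beta> F = (N 2 $ \<lambda>x1 x2 x3. E 1 x1 (x2 * \<beta> * S x3))"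
    using pentagon_2'[of "\<lambda>a b c d. E a b (c * \<beta> * S d)" 4 5 2 6 9 2 3 4]
      contract_P(6)[of "\<lambda>p q t. N 2 $ \<lambda>x1 x2 x3. E p (x1 * q) (x2 * t * S x3)" 3 4]
    by (simp add: sweedler E' b n a p c)
  also have "\<dots> = (sum2 7 delta $ \<lambda>u v. N 2 $ \<lambda>x1 x2 x3. twist_form (\<lambda>r s. F (u * r) (v * s)) x1 (x2 * \<beta> * S x3))"
    by (simp add: E_def D_one lin_antipode F' lin_twist_form_body sum2_sum3_commute)
  finally show ?thesis unfolding sum_twist[of _ _ 2] by (simp add: sum2_def)
qed

section \<open>The inverse of the twist and its counits\<close>

text \<open>The comparison formula that defines f, with the roles of the two triples
  exchanged.\<close>

definition twist_inverse :: "('h \<times> 'h) list" where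
  "twist_inverse = [(d1 * u * S b, d2 * v * S a).
     (y1, y2, y3) \<leftarrow> \<Phi>', (d1, d2) \<leftarrow> \<Delta> (S y1 * \<alpha> * y2), (u, v) \<leftarrow> delta, (a, b) \<leftarrow> \<Delta> y3]"

lemma sum_twist_inverse:
  "sum2 i twist_inverse F = (N j $ \<lambda>y1 y2 y3. D k (S y1 * \<alpha> * y2) $ \<lambda>d1 d2. sum2 l delta $ \<lambda>u v.
     D m y3 $ \<lambda>a b. F (d1 * u * S b) (d2 * v * S a))"
  by (simp add: sum2_def sum3_def twist_inverse_def case_prod_unfold o_def sum_list_map_concat_map)

lemma twist_inverse_right:
  assumes F: "lin2 F"
  shows "(sum2 i drinfeld_twist $ \<lambda>r s. sum2 j twist_inverse $ \<lambda>u v. F (r * u) (s * v)) = F 1 1"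
proof -
  note F' = lin2_slots[OF F]
  have "(sum2 8 drinfeld_twist $ \<lambda>r s. sum2 7 twist_inverse $ \<lambda>u v. F (r * u) (s * v)) = F 1 1"
    using twist_antipode[of "\<lambda>U V. D 5 \<alpha> $ \<lambda>c c'. D 6 y2 $ \<lambda>d d'. sum2 7 delta $ \<lambda>u v. D 9 y3 $ \<lambda>k k'.
        F (U * c * d * u * S k') (V * c' * d' * v * S k)" 4 y1 8 for y1 y2 y3]
      twist_alpha[of "\<lambda>U V. N 2 $ \<lambda>y1 y2 y3. D 4 y1 $ \<lambda>a b. D 6 y2 $ \<lambda>d d'. sum2 7 delta $ \<lambda>u v. D 9 y3 $ \<lambda>k k'.
        F (S b * U * d * u * S k') (S a * V * d' * v * S k)" 5 8]
      N_gamma_delta[OF F, of 2 4 6 9 8 7]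
    by (simp add: sweedler F' sum_twist_inverse[of 7 _ 2 3 7 9] D_mult[of _ 3 _ _ 4 11] D_mult[of _ 11 _ _ 5 6])
  then show ?thesis by (simp add: sum2_def)
qed

text \<open>\<open>twist_antipode\<close> moves f up to \<open>delta\<close>, and
  \<open>twist_beta\<close> merges both into \<Delta>(\<beta>). Everything is then \<Delta> of S(y1)
  \<alpha> y2 \<beta> S(y3), which is 1. On the other side, \<open>twist_inverse_right\<close>
  reduces to \<open>N_gamma_delta\<close>.\<close>

lemma twist_inverse_left:
  assumes F: "lin2 F"
  shows "(sum2 i twist_inverse $ \<lambda>u v. sum2 j drinfeld_twist $ \<lambda>r s. F (u * r) (v * s)) = F 1 1"
proof -
  note F' = lin2_slots[OF F]
  have "(N 2 $ \<lambda>y1 y2 y3. D 4 (S y1) $ \<lambda>a a'. D 5 \<alpha> $ \<lambda>c c'. D 6 y2 $ \<lambda>d d'. D 10 \<beta> $ \<lambda>b b'. D 9 (S y3) $ \<lambda>k k'.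
      F (a * c * d * b * k) (a' * c' * d' * b' * k')) = F 1 1"
    using N_antipode[of "\<lambda>t. D 3 t F" 2]
    by (simp add: sweedler F' D_one D_mult[of _ 3 _ _ 4 11] D_mult[of _ 11 _ _ 5 12] D_mult[of _ 12 _ _ 6 13]
        D_mult[of _ 13 _ _ 10 9])
  then have "(sum2 7 twist_inverse $ \<lambda>u v. sum2 8 drinfeld_twist $ \<lambda>r s. F (u * r) (v * s)) = F 1 1"
    using twist_antipode[of "\<lambda>U V. D 4 (S y1) $ \<lambda>a a'. D 5 \<alpha> $ \<lambda>c c'. D 6 y2 $ \<lambda>d d'. sum2 7 delta $ \<lambda>u v.
        F (a * c * d * u * U) (a' * c' * d' * v * V)" 9 y3 8 for y1 y2 y3, THEN sym]
      twist_beta[of "\<lambda>U V. N 2 $ \<lambda>y1 y2 y3. D 4 (S y1) $ \<lambda>a a'. D 5 \<alpha> $ \<lambda>c c'. D 6 y2 $ \<lambda>d d'. D 9 (S y3) $ \<lambda>k k'.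
        F (a * c * d * U * k) (a' * c' * d' * V * k')" 7 8 10]
    by (simp add: sweedler F' sum_twist_inverse[of 7 _ 2 3 7 9] D_mult[of _ 3 _ _ 4 11] D_mult[of _ 11 _ _ 5 6])
  then show ?thesis by (simp add: sum2_def)
qed

text \<open>Applying \<epsilon> to the antipode axioms shows that \<epsilon>(\<alpha>) is nonzero,
  and dividing by it gives the counit of S. Only the product of \<epsilon>(\<alpha>) and
  \<epsilon>(\<beta>) is 1, so these scalars are carried along below and cancel in pairs.\<close>

lemma counit_alpha_beta: "\<epsilon> \<alpha> * \<epsilon> \<beta> = 1"
  and counit_antipode: "\<epsilon> (S h) = \<epsilon> h"
proof -
  have e: "lin \<epsilon>" using lin_counit[of "\<lambda>x. x"] by (simp add: lin_map_intros)
  have 1: "(P 2 $ \<lambda>X1 X2 X3. \<epsilon> X1 * (\<epsilon> \<beta> * (\<epsilon> (S X2) * (\<epsilon> \<alpha> * \<epsilon> X3)))) = 1"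
    using P_antipode[OF e, of 2] by (simp add: counit_mult counit_one)
  have nz: "\<epsilon> \<alpha> \<noteq> 0"
  proof
    assume "\<epsilon> \<alpha> = 0"
    with 1 show False by (simp add: sum3_def case_prod_unfold)
  qed
  have S: "\<epsilon> (S h) = \<epsilon> h" for h
  proof -
    have "(D 2 h $ \<lambda>a b. \<epsilon> \<alpha> * (\<epsilon> b * \<epsilon> (S a))) = \<epsilon> h * \<epsilon> \<alpha>"
      using D_alpha[OF e, of 2 h] by (simp add: counit_mult mult_ac)
    moreover have "(D 2 h $ \<lambda>a b. \<epsilon> b * \<epsilon> (S a)) = \<epsilon> (S h)"
      by (rule D_counit) (simp add: lin_antipode)
    ultimately show ?thesis using nz by (simp add: sum_mult_left)
  qed
  show "\<epsilon> (S h) = \<epsilon> h" by (rule S)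
  show "\<epsilon> \<alpha> * \<epsilon> \<beta> = 1"
    using 1 P_counit_2[of "\<lambda>a b. \<epsilon> \<alpha> * \<epsilon> \<beta> * (\<epsilon> a * \<epsilon> b)" 2]
    by (simp add: lin_antipode S counit_one mult_ac)
qed

lemma gamma_counit:
  assumes g: "lin g"
  shows "(sum2 i gamma $ \<lambda>u v. \<epsilon> u * g v) = \<epsilon> \<alpha> * g \<alpha>"
proof -
  note g' = lin_compose[OF g]
  have 1: "(D 7 h $ \<lambda>a b. \<epsilon> a * g (x * (y * (z * b)))) = g (x * (y * (z * h)))" for h x y z
    by (rule D_counit) (simp add: lin_antipode g')
  have 2: "(N 6 $ \<lambda>x1 x2 x3. \<epsilon> x1 * (\<epsilon> x2 * g (x * (y * (x3 * z))))) = g (x * (y * z))" for x y z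
    using N_counit_1[of "\<lambda>a b. \<epsilon> a * g (x * y * b * z)" 6] by (simp add: lin_antipode g' counit_one mult.assoc)
  have 3: "(P 5 $ \<lambda>X1 X2 X3. \<epsilon> X2 * g (S X1 * (\<alpha> * X3))) = g \<alpha>"
    using P_counit_2[of "\<lambda>a b. g (S a * \<alpha> * b)" 5] by (simp add: lin_antipode g' antipode_one mult.assoc)
  have "(sum2 2 gamma $ \<lambda>u v. \<epsilon> u * g v) = (P 5 $ \<lambda>X1 X2 X3. N 6 $ \<lambda>x1 x2 x3. D 7 X3 $ \<lambda>a b.
      \<epsilon> \<alpha> * (\<epsilon> X2 * (\<epsilon> x1 * (\<epsilon> x2 * (\<epsilon> a * g (S X1 * (\<alpha> * (x3 * b))))))))"
    by (subst sum_gamma'[of _ _ 5 6 7]) (simp_all add: lin_antipode g' counit_mult counit_antipode mult_ac)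
  then show ?thesis by (simp add: sum_mult_left 1 2 3) (simp add: sum2_def)
qed

lemma twist_counit:
  assumes g: "lin g"
  shows "(sum2 i drinfeld_twist $ \<lambda>u v. \<epsilon> u * g v) = \<epsilon> \<alpha> * g 1"
proof -
  note g' = lin_compose[OF g]
  have 1: "(D 4 h $ \<lambda>a b. \<epsilon> a * g (x * (y * b))) = g (x * (y * h))" for h x y
    by (rule D_counit) (simp add: lin_antipode g')
  have 2: "(D 3 h $ \<lambda>a b. \<epsilon> b * g (S a * x)) = g (S h * x)" for h x
    by (rule D_counit) (simp add: lin_antipode g')
  have 3: "(sum2 2 gamma $ \<lambda>r s. \<epsilon> r * g (x * (s * y))) = \<epsilon> \<alpha> * g (x * (\<alpha> * y))" for x y
    using gamma_counit[of "\<lambda>t. g (x * t * y)" 2] by (simp add: lin_antipode g' mult.assoc)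
  have "twist_form (\<lambda>u v. \<epsilon> u * g v) p q = \<epsilon> \<alpha> * g (S p * (\<alpha> * q))" for p q
    by (simp add: twist_form_def sum_sort counit_mult counit_antipode mult.assoc sum_mult_left 1 3)
      (simp add: mult.left_commute[of _ "\<epsilon> \<alpha>"] sum_mult_left 2)
  then show ?thesis
    using N_antipode[OF g, of 3] by (simp add: sum_twist[of i _ 3] sum_mult_left mult.assoc)
qed

text \<open>Under u \<otimes> v \<mapsto> u \<beta> S(v), the coproduct at the right end of f
  collapses to a counit and \<open>gamma\<close> becomes S(\<alpha>).\<close>

lemma twist_antipode_beta:
  assumes g: "lin g"
  shows "(sum2 i drinfeld_twist $ \<lambda>u v. g (u * \<beta> * S v)) = \<epsilon> \<beta> * g (S \<alpha>)"
proof -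
  note g' = lin_compose[OF g]
  have gam: "(sum2 2 gamma $ \<lambda>r s. g (x * (r * (\<beta> * (S s * y))))) = g (x * (S \<alpha> * y))" for x y
    using contract_P(6)[of "\<lambda>p q t. N 6 $ \<lambda>x1 x2 x3. g (x * S q * S x1 * \<alpha> * x2 * t * S x3 * S \<alpha> * S (S p) * y)" 5 7]
      N_antipode[of "\<lambda>t. g (x * t * S \<alpha> * y)" 6]
    by (simp add: sum_gamma'[of _ _ 5 6 7] sweedler g' antipode_one)
  have "(D 4 q $ \<lambda>c d. sum2 2 gamma $ \<lambda>r s. g (x * (r * (c * (\<beta> * (S d * (S s * y))))))) = \<epsilon> q * g (x * (S \<alpha> * y))" for q x y
    using D_beta[of "\<lambda>t. sum2 2 gamma $ \<lambda>r s. g (x * r * t * S s * y)" 4 q] gam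
    by (simp add: sum_sort lin_antipode g' mult.assoc)
  then have tw: "twist_form (\<lambda>u v. g (u * (\<beta> * S v))) p q = \<epsilon> q * (D 3 p $ \<lambda>a b. g (S b * (S \<alpha> * S (S a))))" for p q
    by (simp add: twist_form_def sum2_def sum_list_const_mult case_prod_unfold antipode_mult mult.assoc
        sum_list_swap[of _ gamma])
  have "(N 2 $ \<lambda>x1 x2 x3. \<epsilon> x2 * (\<epsilon> x3 * (D 3 x1 $ \<lambda>a b. g (S b * (S \<alpha> * S (S a)))))) = g (S \<alpha>)"
    using N_counit_2[of "\<lambda>p q. \<epsilon> q * (D 3 p $ \<lambda>a b. g (S b * (S \<alpha> * S (S a))))" 2]
    by (simp add: lin_antipode g' D_one antipode_one counit_one)
  then show ?thesis
    by (simp add: sum_twist[of i _ 2] mult.assoc tw counit_mult counit_antipode)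
      (simp add: mult.left_commute[of _ "\<epsilon> \<beta>"] sum_mult_left)
qed

lemma twist_inverse_antipode:
  assumes F: "lin2 F"
  shows "(D i (S h) $ \<lambda>a b. sum2 j twist_inverse $ \<lambda>u v. F (a * u) (b * v)) =
    (D i h $ \<lambda>a b. sum2 j twist_inverse $ \<lambda>u v. F (u * S b) (v * S a))"
proof -
  note F' = lin2_slots[OF F]
  have "(D 5 (S h) $ \<lambda>a b. sum2 4 twist_inverse $ \<lambda>u v. F (a * u) (b * v)) =
    (D 5 h $ \<lambda>a b. sum2 2 twist_inverse $ \<lambda>u v. F (u * S b) (v * S a))"
    using twist_inverse_right[of "\<lambda>U V. D 5 h $ \<lambda>a b. sum2 2 twist_inverse $ \<lambda>u v. F (u * S b * U) (v * S a * V)" 3 4]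
      twist_antipode[of "\<lambda>U V. sum2 2 twist_inverse $ \<lambda>u v. sum2 4 twist_inverse $ \<lambda>k l. F (u * U * k) (v * V * l)" 5 h 3]
      twist_inverse_left[of "\<lambda>U V. D 5 (S h) $ \<lambda>a b. sum2 4 twist_inverse $ \<lambda>k l. F (U * a * k) (V * b * l)" 2 3]
    by (simp add: sweedler F')
  then show ?thesis by (simp add: sum2_def)
qed

lemma twist_inverse_beta:
  assumes F: "lin2 F"
  shows "(D i \<beta> $ \<lambda>a b. sum2 j twist_inverse $ \<lambda>u v. F (a * u) (b * v)) = sum2 j delta F"
proof -
  note F' = lin2_slots[OF F]
  have "(D 5 \<beta> $ \<lambda>a b. sum2 4 twist_inverse $ \<lambda>u v. F (a * u) (b * v)) = sum2 2 delta F"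
    using twist_beta[of "\<lambda>U V. sum2 4 twist_inverse $ \<lambda>u v. F (U * u) (V * v)" 2 3 5]
      twist_inverse_right[of "\<lambda>U V. sum2 2 delta $ \<lambda>u v. F (u * U) (v * V)" 3 4]
    by (simp add: sweedler F')
  then show ?thesis by (simp add: sum2_def)
qed

section \<open>Twisting the associator\<close>

lemma twist_form_sum:
  "twist_form F p q = (D i p $ \<lambda>a b. sum2 j gamma $ \<lambda>r s. D k q $ \<lambda>c d. F (S b * r * c) (S a * s * d))"
  by (simp add: twist_form_def sum2_def)

text \<open>Combines \<open>twist_antipode\<close> and \<open>twist_alpha\<close>: a twist in front
  of \<Delta>(S(p) \<alpha> q) can be traded for \<open>gamma\<close>.\<close>

lemma twist_coproduct:
  assumes F: "lin2 F"
  shows "(D i (S p * (\<alpha> * q)) $ \<lambda>a b. sum2 j drinfeld_twist $ \<lambda>u v. F (u * a) (v * b)) = twist_form F p q"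
proof -
  note F' = lin2_slots[OF F]
  have "(D 4 (S p * (\<alpha> * q)) $ \<lambda>a b. sum2 8 drinfeld_twist $ \<lambda>u v. F (u * a) (v * b)) = twist_form F p q"
    using twist_antipode[of "\<lambda>U V. D 5 \<alpha> $ \<lambda>c c'. D 6 q $ \<lambda>d d'. F (U * c * d) (V * c' * d')" 4 p 8]
      twist_alpha[of "\<lambda>U V. D 4 p $ \<lambda>a b. D 6 q $ \<lambda>d d'. F (S b * U * d) (S a * V * d')" 5 8]
    by (simp add: twist_form_sum[of _ _ _ 4 8 6] sweedler F'
        D_mult[of _ 4 _ _ 4 5] D_mult[of _ 5 _ _ 5 6])
  then show ?thesis by (simp add: sum2_def)
qed

text \<open>This is the cocycle identity with the first twist replaced by \<open>gamma\<close>. Both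
  entries of \<open>gamma\<close> contain a factor of the form S(p) \<alpha> q, so
  \<open>twist_coproduct\<close> removes the remaining f. The two sides are then compared by the
  pentagon.\<close>

lemma gamma_cocycle:
  assumes K: "lin3 K"
  shows "(sum2 i gamma $ \<lambda>r s. D j r $ \<lambda>a b. sum2 k drinfeld_twist $ \<lambda>u v. P l $ \<lambda>Z1 Z2 Z3.
      K (S Z3 * u * a) (S Z2 * v * b) (S Z1 * s)) =
    (sum2 i gamma $ \<lambda>r s. D j s $ \<lambda>a b. sum2 k drinfeld_twist $ \<lambda>u v. P l $ \<lambda>Z1 Z2 Z3.
      K (r * Z1) (u * a * Z2) (v * b * Z3))"
proof -
  note K' = lin3_slots[OF K]
  have L1: "(sum2 22 gamma $ \<lambda>r s. D 20 r $ \<lambda>a b. sum2 21 drinfeld_twist $ \<lambda>u v. P 2 $ \<lambda>Z1 Z2 Z3.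
      K (S Z3 * u * a) (S Z2 * v * b) (S Z1 * s)) =
    (P 3 $ \<lambda>X1 X2 X3. P 2 $ \<lambda>Z1 Z2 Z3. N 6 $ \<lambda>x1 x2 x3. D 7 x1 $ \<lambda>l1 l2. D 8 X3 $ \<lambda>a b. D 9 x2 $ \<lambda>m1 m2.
      D 10 a $ \<lambda>a1 a2. D 11 X2 $ \<lambda>k1 k2. sum2 18 gamma $ \<lambda>r s.
      K (S Z3 * S k2 * S l2 * r * m1 * a1) (S Z2 * S k1 * S l1 * s * m2 * a2) (S Z1 * S X1 * \<alpha> * x3 * b))"
    using twist_coproduct[of "\<lambda>U V. K (S Z3 * U) (S Z2 * V) (S Z1 * S X1 * \<alpha> * x3 * b)"
        20 "x1 * X2" "x2 * a" 21 for Z1 Z2 Z3 X1 X2 x1 x2 x3 a b]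
    by (simp add: sum_gamma'[of _ 22 3 6 8] sweedler K' twist_form_sum[of _ _ _ 7 18 9]
        D_mult[of _ 7 _ _ 7 11] D_mult[of _ 9 _ _ 9 10])
  have q: "(D 7 u2 $ \<lambda>q q'. N 5 $ \<lambda>t1 t2 t3. N 6 $ \<lambda>x1 x2 x3. D 10 q' $ \<lambda>q1 q2. D 11 X3 $ \<lambda>c d. D 12 Y1 $ \<lambda>e g.
      D 13 d $ \<lambda>o1 o2. D 14 Y3 $ \<lambda>p p'. D 15 t2 $ \<lambda>s1 s2. D 15 o1 $ \<lambda>k1 k2. D 16 p $ \<lambda>p1 p2.
      K (S Y2 * S c * S t1 * S q * S x1 * \<alpha> * x2 * q1 * s1 * k1 * p1)
        (S g * S X2 * S u1 * \<alpha> * x3 * q2 * s2 * k2 * p2) (S e * S X1 * \<alpha> * u3 * t3 * o2 * p')) =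
    (N 5 $ \<lambda>t1 t2 t3. N 6 $ \<lambda>x1 x2 x3. D 11 X3 $ \<lambda>c d. D 12 Y1 $ \<lambda>e g.
      D 13 d $ \<lambda>o1 o2. D 14 Y3 $ \<lambda>p p'. D 15 t2 $ \<lambda>s1 s2. D 15 o1 $ \<lambda>k1 k2. D 16 p $ \<lambda>p1 p2.
      K (S Y2 * S c * S t1 * S x1 * \<alpha> * x2 * s1 * k1 * p1)
        (S g * S X2 * S u1 * \<alpha> * u2 * x3 * s2 * k2 * p2) (S e * S X1 * \<alpha> * u3 * t3 * o2 * p'))"
    for X1 X2 X3 Y1 Y2 Y3 u1 u2 u3
    using q_shift[of "\<lambda>U V. N 5 $ \<lambda>t1 t2 t3. D 11 X3 $ \<lambda>c d. D 12 Y1 $ \<lambda>e g.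
      D 13 d $ \<lambda>o1 o2. D 14 Y3 $ \<lambda>p p'. D 15 t2 $ \<lambda>s1 s2. D 15 o1 $ \<lambda>k1 k2. D 16 p $ \<lambda>p1 p2.
      K (S Y2 * S c * S t1 * U * s1 * k1 * p1)
        (S g * S X2 * S u1 * \<alpha> * V * s2 * k2 * p2) (S e * S X1 * \<alpha> * u3 * t3 * o2 * p')" 7 u2 10 6]
    by (simp add: sweedler K')
  \<comment> \<open>\<open>pentagon_2\<close> and \<open>pentagon_inverse\<close> place an inverse
    associator around the inner \<open>gamma\<close>, where \<open>N_gamma\<close> applies.\<close>
  have L2: "(P 3 $ \<lambda>X1 X2 X3. P 2 $ \<lambda>Z1 Z2 Z3. N 6 $ \<lambda>x1 x2 x3. D 7 x1 $ \<lambda>l1 l2. D 8 X3 $ \<lambda>a b. D 9 x2 $ \<lambda>m1 m2.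
      D 10 a $ \<lambda>a1 a2. D 11 X2 $ \<lambda>k1 k2. sum2 18 gamma $ \<lambda>r s.
      K (S Z3 * S k2 * S l2 * r * m1 * a1) (S Z2 * S k1 * S l1 * s * m2 * a2) (S Z1 * S X1 * \<alpha> * x3 * b)) =
    (P 2 $ \<lambda>Y1 Y2 Y3. P 3 $ \<lambda>X1 X2 X3. N 4 $ \<lambda>u1 u2 u3. N 5 $ \<lambda>t1 t2 t3. N 6 $ \<lambda>x1 x2 x3. D 11 X3 $ \<lambda>c d. D 12 Y1 $ \<lambda>e g.
      D 13 d $ \<lambda>o1 o2. D 14 Y3 $ \<lambda>p p'. D 15 t2 $ \<lambda>s1 s2. D 15 o1 $ \<lambda>k1 k2. D 16 p $ \<lambda>p1 p2.
      K (S Y2 * S c * S t1 * S x1 * \<alpha> * x2 * s1 * k1 * p1)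
        (S g * S X2 * S u1 * \<alpha> * u2 * x3 * s2 * k2 * p2) (S e * S X1 * \<alpha> * u3 * t3 * o2 * p'))"
    using pentagon_2[of "\<lambda>p q t w. N 6 $ \<lambda>x1 x2 x3. D 7 x1 $ \<lambda>l1 l2. D 8 w $ \<lambda>a b. sum2 18 gamma $ \<lambda>r s.
        D 9 x2 $ \<lambda>m1 m2. D 10 a $ \<lambda>a1 a2.
        K (S t * S l2 * r * m1 * a1) (S q * S l1 * s * m2 * a2) (S p * \<alpha> * x3 * b)" 3 11 2 4 3 11 2 12]
      pentagon_inverse[of "\<lambda>A B C W. P 2 $ \<lambda>Y1 Y2 Y3. P 3 $ \<lambda>X1 X2 X3. D 11 X3 $ \<lambda>c d. D 12 Y1 $ \<lambda>e g. sum2 18 gamma $ \<lambda>r s.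
        D 9 C $ \<lambda>m1 m2. D 13 d $ \<lambda>o1 o2. D 14 Y3 $ \<lambda>p p'. D 15 o1 $ \<lambda>k1 k2. D 16 p $ \<lambda>p1 p2.
        K (S Y2 * S c * S B * r * m1 * k1 * p1) (S g * S X2 * S A * s * m2 * k2 * p2) (S e * S X1 * \<alpha> * W * o2 * p')" 6 7 4 8 6 4 7 5]
      N_gamma[of "\<lambda>U V. P 2 $ \<lambda>Y1 Y2 Y3. P 3 $ \<lambda>X1 X2 X3. N 4 $ \<lambda>u1 u2 u3. N 5 $ \<lambda>t1 t2 t3. D 7 u2 $ \<lambda>q q'. D 10 q' $ \<lambda>q1 q2.
        D 11 X3 $ \<lambda>c d. D 12 Y1 $ \<lambda>e g. D 13 d $ \<lambda>o1 o2. D 14 Y3 $ \<lambda>p p'. D 15 t2 $ \<lambda>s1 s2. D 15 o1 $ \<lambda>k1 k2. D 16 p $ \<lambda>p1 p2.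
        K (S Y2 * S c * S t1 * S q * U * q1 * s1 * k1 * p1)
          (S g * S X2 * S u1 * V * q2 * s2 * k2 * p2) (S e * S X1 * \<alpha> * u3 * t3 * o2 * p')" 6 9 18]
      q
    by (simp add: sweedler K' D_mult[of _ 8 _ _ 8 13] D_mult[of _ 13 _ _ 13 14] D_mult[of _ 9 _ _ 9 10]
        D_mult[of _ 10 _ _ 10 15] D_mult[of _ 15 _ _ 15 16])
  have v: "(N 5 $ \<lambda>t1 t2 t3. N 6 $ \<lambda>x1 x2 x3. D 11 X3 $ \<lambda>c d. D 12 Y1 $ \<lambda>e g.
      D 13 d $ \<lambda>o1 o2. D 14 Y3 $ \<lambda>p p'. D 15 t2 $ \<lambda>s1 s2. D 15 o1 $ \<lambda>k1 k2. D 16 p $ \<lambda>p1 p2.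
      K (S Y2 * S c * S t1 * S x1 * \<alpha> * x2 * s1 * k1 * p1)
        (S g * S X2 * S u1 * \<alpha> * u2 * x3 * s2 * k2 * p2) (S e * S X1 * \<alpha> * u3 * t3 * o2 * p')) =
    (N 5 $ \<lambda>t1 t2 t3. N 6 $ \<lambda>x1 x2 x3. D 11 X3 $ \<lambda>c d. D 12 Y1 $ \<lambda>e g.
      D 14 Y3 $ \<lambda>p p'. D 15 t2 $ \<lambda>s1 s2. D 16 p $ \<lambda>p1 p2.
      K (S Y2 * S t1 * S x1 * \<alpha> * x2 * s1 * p1)
        (S g * S X2 * S u1 * \<alpha> * u2 * c * x3 * s2 * p2) (S e * S X1 * \<alpha> * u3 * d * t3 * p'))"
    for X1 X2 X3 Y1 Y2 Y3 u1 u2 u3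
    using coassoc_N[of "\<lambda>A B C. N 6 $ \<lambda>x1 x2 x3. D 12 Y1 $ \<lambda>e g. D 14 Y3 $ \<lambda>p p'. D 15 B $ \<lambda>b1 b2. D 16 p $ \<lambda>p1 p2.
      K (S Y2 * S A * S x1 * \<alpha> * x2 * b1 * p1)
        (S g * S X2 * S u1 * \<alpha> * u2 * x3 * b2 * p2) (S e * S X1 * \<alpha> * u3 * C * p')" 5 11 X3 13]
      q_shift_nested[of "\<lambda>U V d. N 5 $ \<lambda>t1 t2 t3. D 12 Y1 $ \<lambda>e g. D 14 Y3 $ \<lambda>p p'. D 15 t2 $ \<lambda>s1 s2. D 16 p $ \<lambda>p1 p2.
      K (S Y2 * S t1 * U * s1 * p1)
        (S g * S X2 * S u1 * \<alpha> * u2 * V * s2 * p2) (S e * S X1 * \<alpha> * u3 * d * t3 * p')" 11 X3 13 15 6]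
    by (simp add: sweedler K' D_mult[of _ 15 _ _ 15 15])
  \<comment> \<open>The legs of X and u are recognised as \<open>gamma\<close> in the form
    \<open>sum_gamma'\<close>, which is the form reached from the right-hand side in
    \<open>R\<close>.\<close>
  have L3: "(P 2 $ \<lambda>Y1 Y2 Y3. N 5 $ \<lambda>t1 t2 t3. N 6 $ \<lambda>x1 x2 x3. sum2 30 gamma $ \<lambda>r s. D 12 Y1 $ \<lambda>e g.
      D 14 Y3 $ \<lambda>p p'. D 15 t2 $ \<lambda>s1 s2. D 16 p $ \<lambda>p1 p2.
      K (S Y2 * S t1 * S x1 * \<alpha> * x2 * s1 * p1) (S g * r * x3 * s2 * p2) (S e * s * t3 * p')) =
    (P 2 $ \<lambda>Y1 Y2 Y3. P 3 $ \<lambda>X1 X2 X3. N 4 $ \<lambda>u1 u2 u3. N 5 $ \<lambda>t1 t2 t3. N 6 $ \<lambda>x1 x2 x3. D 11 X3 $ \<lambda>c d. D 12 Y1 $ \<lambda>e g.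
      D 14 Y3 $ \<lambda>p p'. D 15 t2 $ \<lambda>s1 s2. D 16 p $ \<lambda>p1 p2.
      K (S Y2 * S t1 * S x1 * \<alpha> * x2 * s1 * p1)
        (S g * S X2 * S u1 * \<alpha> * u2 * c * x3 * s2 * p2) (S e * S X1 * \<alpha> * u3 * d * t3 * p'))"
    by (simp add: sweedler K' sum_gamma'[of _ 30 3 4 11])
  have R: "(sum2 22 gamma $ \<lambda>r s. D 20 s $ \<lambda>a b. sum2 21 drinfeld_twist $ \<lambda>u v. P 23 $ \<lambda>Z1 Z2 Z3.
      K (r * Z1) (u * a * Z2) (v * b * Z3)) =
    (P 2 $ \<lambda>Y1 Y2 Y3. N 5 $ \<lambda>t1 t2 t3. N 6 $ \<lambda>x1 x2 x3. sum2 30 gamma $ \<lambda>r s. D 12 Y1 $ \<lambda>e g.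
      D 14 Y3 $ \<lambda>p p'. D 15 t2 $ \<lambda>s1 s2. D 16 p $ \<lambda>p1 p2.
      K (S Y2 * S t1 * S x1 * \<alpha> * x2 * s1 * p1) (S g * r * x3 * s2 * p2) (S e * s * t3 * p'))"
    using twist_coproduct[of "\<lambda>U V. P 23 $ \<lambda>Z1 Z2 Z3. K (S Y2 * S y1 * \<alpha> * y2 * p * Z1) (U * Z2) (V * Z3)"
        20 Y1 "y3 * p'" 21 for Y1 Y2 y1 y2 y3 p p']
      coassoc_P[of "\<lambda>A B C. N 6 $ \<lambda>y1 y2 y3. D 12 Y1 $ \<lambda>e g. sum2 30 gamma $ \<lambda>r s. D 17 y3 $ \<lambda>k k'.
        K (S Y2 * S y1 * \<alpha> * y2 * A) (S g * r * k * B) (S e * s * k' * C)" 14 Y3 16 23 for Y1 Y2 Y3]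
      q_coproduct[of "\<lambda>A B C. P 2 $ \<lambda>Y1 Y2 Y3. D 12 Y1 $ \<lambda>e g. sum2 30 gamma $ \<lambda>r s. D 14 Y3 $ \<lambda>p p'. D 16 p $ \<lambda>p1 p2.
        K (S Y2 * A * p1) (S g * r * B * p2) (S e * s * C * p')" 6 17 23 5 15 6]
    by (simp add: sum_gamma'[of _ 22 2 6 14] sweedler K' twist_form_sum[of _ _ _ 12 30 16] D_mult[of _ 16 _ _ 17 16])
  show ?thesis using L1 L2 L3 R v by (simp add: sum2_def sum3_def)
qed

lemma sum_twist_gamma:
  "sum2 i drinfeld_twist F = (N j $ \<lambda>x1 x2 x3. D k x1 $ \<lambda>a b. sum2 l gamma $ \<lambda>r s. D m (x2 * (\<beta> * S x3)) $ \<lambda>c d.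
     F (S b * r * c) (S a * s * d))"
  by (simp add: sum_twist[of i F j] twist_form_sum[of _ _ _ k l m] mult.assoc)

text \<open>Expand the outer twist. \<open>twist_antipode\<close> moves the inner twist past its
  left end, \<open>coassoc_P\<close> moves \<Phi> past the coproducts at both ends, and
  \<open>gamma_cocycle\<close> handles the middle.\<close>

lemma twist_cocycle:
  assumes G: "lin3 G"
  shows "(sum2 i drinfeld_twist $ \<lambda>u v. D j v $ \<lambda>a b. sum2 k drinfeld_twist $ \<lambda>r s. P l $ \<lambda>X1 X2 X3.
      G (u * X1) (r * a * X2) (s * b * X3)) =
    (sum2 i drinfeld_twist $ \<lambda>u v. D j u $ \<lambda>a b. sum2 k drinfeld_twist $ \<lambda>r s. P l $ \<lambda>X1 X2 X3.
      G (S X3 * r * a) (S X2 * s * b) (S X1 * v))"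
proof -
  note G' = lin3_slots[OF G]
  have "(sum2 20 drinfeld_twist $ \<lambda>u v. D 20 v $ \<lambda>a b. sum2 24 drinfeld_twist $ \<lambda>r s. P 22 $ \<lambda>X1 X2 X3.
      G (u * X1) (r * a * X2) (s * b * X3)) =
    (sum2 20 drinfeld_twist $ \<lambda>u v. D 20 u $ \<lambda>a b. sum2 24 drinfeld_twist $ \<lambda>r s. P 22 $ \<lambda>X1 X2 X3.
      G (S X3 * r * a) (S X2 * s * b) (S X1 * v))"
    using twist_antipode[of "\<lambda>U V. D 5 (x2 * (\<beta> * S x3)) $ \<lambda>c d. D 16 d $ \<lambda>d1 d2. sum2 20 gamma $ \<lambda>r s. D 21 s $ \<lambda>s1 s2. P 22 $ \<lambda>Z1 Z2 Z3.
        G (S b * r * c * Z1) (U * s1 * d1 * Z2) (V * s2 * d2 * Z3)" 7 a 24 for a b x2 x3]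
      coassoc_P[of "\<lambda>A B C. D 4 x1 $ \<lambda>a b. D 7 a $ \<lambda>a1 a2. sum2 20 gamma $ \<lambda>r s. D 21 s $ \<lambda>s1 s2. sum2 24 drinfeld_twist $ \<lambda>u v.
        G (S b * r * A) (S a2 * u * s1 * B) (S a1 * v * s2 * C)" 5 "x2 * (\<beta> * S x3)" 16 22 for x1 x2 x3]
      gamma_cocycle[of "\<lambda>A B C. N 2 $ \<lambda>x1 x2 x3. D 4 x1 $ \<lambda>a b. D 7 a $ \<lambda>a1 a2. D 5 (x2 * (\<beta> * S x3)) $ \<lambda>c d. D 16 c $ \<lambda>c1 c2.
        G (S b * A * c1) (S a2 * B * c2) (S a1 * C * d)" 20 21 24 22]
      twist_antipode[of "\<lambda>U V. D 5 (x2 * (\<beta> * S x3)) $ \<lambda>c d. D 16 c $ \<lambda>c1 c2. sum2 20 gamma $ \<lambda>r s. D 21 r $ \<lambda>r1 r2. P 22 $ \<lambda>Z1 Z2 Z3.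
        G (S Z3 * U * r1 * c1) (S Z2 * V * r2 * c2) (S Z1 * S a * s * d)" 7 b 24 for a b x2 x3]
      coassoc_P[of "\<lambda>A B C. D 5 (x2 * (\<beta> * S x3)) $ \<lambda>c d. D 16 c $ \<lambda>c1 c2. sum2 20 gamma $ \<lambda>r s. D 21 r $ \<lambda>r1 r2. sum2 24 drinfeld_twist $ \<lambda>u v.
        G (S C * u * r1 * c1) (S B * v * r2 * c2) (S A * s * d)" 4 x1 7 22 for x1 x2 x3]
    by (simp add: sweedler G' sum_twist_gamma[of 20 _ 2 4 20 5] D_mult[of _ 20 _ _ 7 8] D_mult[of _ 8 _ _ 21 16])
  then show ?thesis by (simp add: sum2_def sum3_def)
qed

lemma twist_cocycle':
  assumes G: "lin3 G"
  shows "(sum2 i drinfeld_twist $ \<lambda>u v. D j u $ \<lambda>a b. sum2 k drinfeld_twist $ \<lambda>r s. N l $ \<lambda>x1 x2 x3.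
      G (r * a * x1) (s * b * x2) (v * x3)) =
    (sum2 i drinfeld_twist $ \<lambda>u v. D j v $ \<lambda>a b. sum2 k drinfeld_twist $ \<lambda>r s. N l $ \<lambda>x1 x2 x3.
      G (S x3 * u) (S x2 * r * a) (S x1 * s * b))"
proof -
  note G' = lin3_slots[OF G]
  have "(sum2 20 drinfeld_twist $ \<lambda>u v. D 21 u $ \<lambda>a b. sum2 24 drinfeld_twist $ \<lambda>r s. N 30 $ \<lambda>x1 x2 x3.
      G (r * a * x1) (s * b * x2) (v * x3)) =
    (sum2 20 drinfeld_twist $ \<lambda>u v. D 21 v $ \<lambda>a b. sum2 24 drinfeld_twist $ \<lambda>r s. N 31 $ \<lambda>x1 x2 x3.
      G (S x3 * u) (S x2 * r * a) (S x1 * s * b))"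
    using twist_cocycle[of "\<lambda>A B C. N 30 $ \<lambda>x1 x2 x3. N 31 $ \<lambda>y1 y2 y3. G (S y3 * A * x1) (S y2 * B * x2) (S y1 * C * x3)" 20 21 24 22]
      PN[of "\<lambda>A B C. sum2 20 drinfeld_twist $ \<lambda>u v. D 21 v $ \<lambda>a b. sum2 24 drinfeld_twist $ \<lambda>r s. N 31 $ \<lambda>y1 y2 y3.
        G (S y3 * u * A) (S y2 * r * a * B) (S y1 * s * b * C)" 22 30]
      PN[of "\<lambda>A B C. sum2 20 drinfeld_twist $ \<lambda>u v. D 21 u $ \<lambda>a b. sum2 24 drinfeld_twist $ \<lambda>r s. N 30 $ \<lambda>x1 x2 x3.
        G (S C * r * a * x1) (S B * s * b * x2) (S A * v * x3)" 22 31]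
    by (simp add: sweedler G' antipode_one)
  then show ?thesis by (simp add: sum2_def sum3_def)
qed

text \<open>Inserting the inverse twist before f makes \<open>twist_cocycle\<close> applicable. A
  coproduct then surrounds \<beta> and becomes a counit, \<open>twist_counit\<close> removes one
  twist, and \<open>twist_antipode_beta\<close> removes the other. The inserted inverse is what
  survives.\<close>

lemma twist_beta_coproduct:
  assumes K: "lin2 K"
  shows "(sum2 i drinfeld_twist $ \<lambda>u v. D j v $ \<lambda>a b. P k $ \<lambda>X1 X2 X3. K (u * X1 * \<beta> * S X2 * S a) (b * X3)) =
    (sum2 i twist_inverse $ \<lambda>u v. P k $ \<lambda>X1 X2 X3. K (S X3 * S \<alpha> * S (S X2) * S u) (v * S X1))"
proof -
  note K' = lin2_slots[OF K]
  have 1: "(D 21 u $ \<lambda>a b. P 22 $ \<lambda>X1 X2 X3. sum2 24 drinfeld_twist $ \<lambda>r s. sum2 30 twist_inverse $ \<lambda>k l.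
        K (S X3 * (r * (a * (\<beta> * (S b * (S s * (S (S X2) * S k))))))) (l * (S X1 * v))) =
      \<epsilon> u * (P 22 $ \<lambda>X1 X2 X3. sum2 24 drinfeld_twist $ \<lambda>r s. sum2 30 twist_inverse $ \<lambda>k l.
        K (S X3 * (r * (\<beta> * (S s * (S (S X2) * S k))))) (l * (S X1 * v)))" for u v
    using D_beta[of "\<lambda>t. P 22 $ \<lambda>X1 X2 X3. sum2 24 drinfeld_twist $ \<lambda>r s. sum2 30 twist_inverse $ \<lambda>k l.
        K (S X3 * r * t * S s * S (S X2) * S k) (l * S X1 * v)" 21]
    by (simp add: sweedler K')
  have "(sum2 20 drinfeld_twist $ \<lambda>u v. D 21 v $ \<lambda>a b. P 22 $ \<lambda>X1 X2 X3. K (u * X1 * \<beta> * S X2 * S a) (b * X3)) =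
    (P 22 $ \<lambda>X1 X2 X3. sum2 30 twist_inverse $ \<lambda>u v. K (S X3 * S \<alpha> * S (S X2) * S u) (v * S X1))"
    using twist_cocycle[of "\<lambda>A B C. sum2 30 twist_inverse $ \<lambda>k l. K (A * \<beta> * S B * S k) (l * C)" 20 21 24 22]
      twist_inverse_left[of "\<lambda>U V. sum2 20 drinfeld_twist $ \<lambda>u v. D 21 v $ \<lambda>a b. P 22 $ \<lambda>X1 X2 X3.
        K (u * X1 * \<beta> * S X2 * S a * S U) (V * b * X3)" 30 24]
      1
      twist_counit[of "\<lambda>t. P 22 $ \<lambda>X1 X2 X3. sum2 24 drinfeld_twist $ \<lambda>r s. sum2 30 twist_inverse $ \<lambda>k l.
        K (S X3 * r * \<beta> * S s * S (S X2) * S k) (l * S X1 * t)" 20]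
      twist_antipode_beta[of "\<lambda>t. P 22 $ \<lambda>X1 X2 X3. sum2 30 twist_inverse $ \<lambda>k l.
        K (S X3 * t * S (S X2) * S k) (l * S X1)" 24]
      counit_alpha_beta
    by (simp add: sweedler K' antipode_one)
  then show ?thesis by (simp add: sum2_sum3_commute) (simp add: sum2_def sum3_def)
qed

end

section \<open>Bijectivity of the antipode\<close>

lemma enum_list:
  assumes "finite I"
  shows "set (enum_list I) = I" "distinct (enum_list I)"
proof -
  have "\<exists>is. set is = I \<and> distinct is" using finite_distinct_list[OF assms] .
  then have "set (enum_list I) = I \<and> distinct (enum_list I)"
    unfolding enum_list_def by (rule someI_ex)
  then show "set (enum_list I) = I" "distinct (enum_list I)" by simp_all
qed

text \<open>Finite dimension enters as the dual basis expansion. Linearity of \<open>e' i\<close> is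
  required for every \<open>i\<close>, so that linearity side conditions carry no membership
  condition.\<close>

locale quasi_hopf_algebra_basis = quasi_hopf_algebra scale \<Delta> \<epsilon> \<Phi> \<Phi>' \<alpha> \<beta> S
  for scale :: "'k::field \<Rightarrow> 'h::ring_1 \<Rightarrow> 'h" (infixr \<open>*s\<close> 75)
    and \<Delta> :: "'h \<Rightarrow> ('h \<times> 'h) list"
    and \<epsilon> :: "'h \<Rightarrow> 'k"
    and \<Phi> \<Phi>' :: "('h \<times> 'h \<times> 'h) list"
    and \<alpha> \<beta> :: 'h
    and S :: "'h \<Rightarrow> 'h" +
  fixes I :: "'i set" and e :: "'i \<Rightarrow> 'h" and e' :: "'i \<Rightarrow> 'h \<Rightarrow> 'k"
  assumes finite_index: "finite I"
    and lin_e': "lin (e' i)"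
    and basis_expansion: "(\<Sum>i\<in>I. e' i x *s e i) = x"
begin

lemma lin_dual: "lin_map E \<Longrightarrow> lin (\<lambda>x. e' i (E x))"
  by (rule lin_compose[OF lin_e'])

text \<open>Sums over the basis are sums over a list of pairs, so that \<open>sum_sort\<close> applies to them.\<close>

definition basis_list :: "('i \<times> unit) list" where
  "basis_list = map (\<lambda>i. (i, ())) (enum_list I)"

abbreviation B :: "nat \<Rightarrow> ('i \<Rightarrow> 'k) \<Rightarrow> 'k" where
  "B j f \<equiv> sum2 j basis_list (\<lambda>i _. f i)"

lemma sum_basis: "B j f = (\<Sum>i\<in>I. f i)"
proof -
  have "B j f = sum_list (map f (enum_list I))" by (simp add: sum2_def basis_list_def o_def)
  also have "\<dots> = sum f (set (enum_list I))"
    by (rule sum_list_distinct_conv_sum_set) (rule enum_list(2)[OF finite_index])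
  finally show ?thesis by (simp only: enum_list(1)[OF finite_index])
qed

lemma lin_sum: "lin g \<Longrightarrow> finite A \<Longrightarrow> g (\<Sum>i\<in>A. f i) = (\<Sum>i\<in>A. g (f i))"
proof (induction A rule: infinite_finite_induct)
  case empty
  then show ?case using lin_sum_list[of g "\<lambda>x. x" "[]"] by simp
qed (simp_all add: lin_def)

lemma basis_sum:
  assumes g: "lin g"
  shows "B j (\<lambda>i. e' i x * g (e i)) = g x"
proof -
  have "g x = g (\<Sum>i\<in>I. e' i x *s e i)" by (simp add: basis_expansion)
  also have "\<dots> = (\<Sum>i\<in>I. g (e' i x *s e i))" by (rule lin_sum[OF g finite_index])
  finally show ?thesis using g by (simp add: sum_basis lin_def)
qed

lemma eqI_dual:
  assumes "\<And>i. e' i x = e' i y"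
  shows "x = y"
proof -
  have "x = (\<Sum>i\<in>I. e' i x *s e i)" by (rule basis_expansion[symmetric])
  also have "\<dots> = (\<Sum>i\<in>I. e' i y *s e i)" by (simp only: assms)
  also have "\<dots> = y" by (rule basis_expansion)
  finally show ?thesis .
qed

lemma lin_zero: "lin g \<Longrightarrow> g 0 = 0"
  using lin_sum_list[of g "\<lambda>x. x" "[]"] by simp

section \<open>Nonzero left integrals\<close>

text \<open>\<open>integral\<close> is a variant of the projection of \<open>H\<close> onto the left integrals by means of a dual basis.\<close>

definition integral_form :: "('h \<Rightarrow> 'k) \<Rightarrow> 'h \<Rightarrow> 'k" where
  "integral_form g h = (B 2 $ \<lambda>i. P 3 $ \<lambda>X1 X2 X3. D 4 (e i) $ \<lambda>a b.
     e' i (\<beta> * S (S (X2 * b) * \<alpha> * X3) * h) * g (X1 * a))"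

definition integral :: "'h \<Rightarrow> 'h" where
  "integral h = (\<Sum>j\<in>I. integral_form (e' j) h *s e j)"

lemma integral_form:
  assumes g: "lin g"
  shows "g (integral h) = integral_form g h"
proof -
  note g' = lin_compose[OF g]
  have 1: "B 9 (\<lambda>j. g (e j) * (c * e' j x)) = c * g x" for c x
    using basis_sum[OF g, of 9 x, symmetric] by (simp add: sum_basis sum_distrib_left mult_ac)
  have "g (integral h) = (\<Sum>j\<in>I. g (integral_form (e' j) h *s e j))"
    unfolding integral_def by (rule lin_sum[OF g finite_index])
  also have "\<dots> = B 9 (\<lambda>j. g (e j) * integral_form (e' j) h)"
    using g by (simp add: sum_basis lin_def mult.commute)
  also have "\<dots> = (B 2 $ \<lambda>i. P 3 $ \<lambda>X1 X2 X3. D 4 (e i) $ \<lambda>a b. B 9 $ \<lambda>j.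
      g (e j) * (e' i (\<beta> * S (S (X2 * b) * \<alpha> * X3) * h) * e' j (X1 * a)))"
    by (simp add: integral_form_def sum_mult_left[symmetric] sum_sort)
  finally show ?thesis by (simp add: 1 integral_form_def)
qed

text \<open>X1 \<otimes> S(X2) \<alpha> X3 is the right-handed q with S applied to its second leg,
  which removes the inverse of S from its usual formula. The argument mirrors
  \<open>q_shift\<close>.\<close>

lemma q_right_shift:
  assumes F: "lin2 F"
  shows "(D i h $ \<lambda>a b. D j a $ \<lambda>c d. P k $ \<lambda>X1 X2 X3. F (X1 * c) (S d * S X2 * \<alpha> * X3 * b)) =
    (P k $ \<lambda>X1 X2 X3. F (h * X1) (S X2 * \<alpha> * X3))"
proof -
  note F' = lin2_slots[OF F]
  have 1: "D 4 h2 (\<lambda>a b. F x (y * (S a * (\<alpha> * (b * z))))) = \<epsilon> h2 * F x (y * (\<alpha> * z))" for h2 x y z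
    using D_alpha[of "\<lambda>t. F x (y * t * z)" 4] by (simp add: sweedler F')
  have 2: "D 3 h (\<lambda>a b. \<epsilon> b * F (a * x) y) = F (h * x) y" for x y
    by (rule D_counit) (simp add: sweedler F')
  have "(D 3 h $ \<lambda>a b. D 4 a $ \<lambda>c d. P 2 $ \<lambda>X1 X2 X3. F (X1 * c) (S d * S X2 * \<alpha> * X3 * b)) =
    (P 2 $ \<lambda>X1 X2 X3. F (h * X1) (S X2 * \<alpha> * X3))"
    using coassoc_P[of "\<lambda>a b c. F a (S b * \<alpha> * c)" 3 h 4 2] by (simp add: sweedler F' 1 2)
  then show ?thesis by (simp add: sum2_sum3_commute) (simp add: sum2_def sum3_def)
qed

text \<open>\<open>q_right_shift\<close> carries \<open>a\<close> into the coproduct of a1 e_i. A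
  sum over dual bases is a trace and hence cyclic: \<open>ex\<close> and \<open>ba\<close> move a1
  from the basis vector to the front of \<beta> S(a2), where the two contract to \<epsilon>(a)
  \<beta>.\<close>

lemma integral_invariant: "a * integral h = \<epsilon> a *s integral h"
proof (rule eqI_dual)
  fix n
  let ?g = "e' n"
  note L = sweedler lin_dual
  have sh: "(P 3 $ \<lambda>X1 X2 X3. D 4 v $ \<lambda>p q. e' i (\<beta> * S (S (X2 * q) * \<alpha> * X3) * h) * ?g (a * (X1 * p))) =
    (P 3 $ \<lambda>X1 X2 X3. D 5 a $ \<lambda>a1 a2. D 10 (a1 * v) $ \<lambda>p q.
      e' i (\<beta> * S a2 * S (S (X2 * q) * \<alpha> * X3) * h) * ?g (X1 * p))" for i v
    using q_right_shift[of "\<lambda>A C. D 7 v $ \<lambda>p q. e' i (\<beta> * S (S q * C) * h) * ?g (A * p)" 5 a 6 3]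
    by (simp add: L D_mult[of _ 10 _ _ 6 7]) (simp add: sum2_def sum3_def)
  have ex: "(D 10 (a1 * e i) $ \<lambda>p q. e' i (\<beta> * S a2 * S (S (X2 * q) * \<alpha> * X3) * h) * ?g (X1 * p)) =
     (B 8 $ \<lambda>j. D 9 (e j) $ \<lambda>p q. e' j (a1 * e i) * (e' i (\<beta> * S a2 * S (S (X2 * q) * \<alpha> * X3) * h) * ?g (X1 * p)))"
    for a1 a2 X1 X2 X3 i
    using basis_sum[of "\<lambda>v. D 9 v $ \<lambda>p q. e' i (\<beta> * S a2 * S (S (X2 * q) * \<alpha> * X3) * h) * ?g (X1 * p)" 8 "a1 * e i"]
    by (simp add: lin_antipode lin_dual sum_mult_left) (simp add: sum2_def)
  have ba: "B 20 (\<lambda>i. e' j (a1 * e i) * (e' i z * c)) = e' j (a1 * z) * c" for j a1 z c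
  proof -
    have "lin (\<lambda>t. e' j (a1 * t) * c)" by (simp add: lin_antipode lin_dual)
    from basis_sum[OF this, of 20 z] show ?thesis by (simp add: mult.assoc mult.left_commute)
  qed
  have be: "(D 5 a $ \<lambda>a1 a2. e' j (a1 * (\<beta> * (S a2 * z))) * c) = \<epsilon> a * (e' j (\<beta> * z) * c)" for j z c
    using D_beta[of "\<lambda>t. e' j (t * z) * c" 5 a] by (simp add: L)
  have "?g (a * integral h) = integral_form (\<lambda>x. ?g (a * x)) h"
    by (rule integral_form) (simp add: L)
  also have "\<dots> = (B 20 $ \<lambda>i. P 3 $ \<lambda>X1 X2 X3. D 4 (e i) $ \<lambda>p q.
      e' i (\<beta> * S (S (X2 * q) * \<alpha> * X3) * h) * ?g (a * (X1 * p)))"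
    by (simp add: integral_form_def sum2_def)
  also have "\<dots> = (B 20 $ \<lambda>i. P 3 $ \<lambda>X1 X2 X3. D 5 a $ \<lambda>a1 a2. B 8 $ \<lambda>j. D 9 (e j) $ \<lambda>p q.
      e' j (a1 * e i) * (e' i (\<beta> * S a2 * S (S (X2 * q) * \<alpha> * X3) * h) * ?g (X1 * p)))"
    by (simp only: sh ex)
  also have "\<dots> = (P 3 $ \<lambda>X1 X2 X3. D 5 a $ \<lambda>a1 a2. B 8 $ \<lambda>j. D 9 (e j) $ \<lambda>p q.
      e' j (a1 * (\<beta> * S a2 * S (S (X2 * q) * \<alpha> * X3) * h)) * ?g (X1 * p))"
    by (simp add: sum_sort ba)
  also have "\<dots> = (P 3 $ \<lambda>X1 X2 X3. B 2 $ \<lambda>j. D 4 (e j) $ \<lambda>p q. D 5 a $ \<lambda>a1 a2.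
      e' j (a1 * (\<beta> * (S a2 * (S (S (X2 * q) * \<alpha> * X3) * h)))) * ?g (X1 * p))"
    unfolding mult.assoc sum2_def sum3_def case_prod_unfold by (simp add: sum_list_swap[of _ "\<Delta> a"])
  also have "\<dots> = \<epsilon> a * integral_form ?g h"
    by (simp add: be sum_mult_left) (simp add: integral_form_def sum_sort mult.assoc)
  also have "\<dots> = ?g (\<epsilon> a *s integral h)"
    using integral_form[OF lin_e', of n h] lin_e'[of n] by (simp add: lin_def)
  finally show "?g (a * integral h) = ?g (\<epsilon> a *s integral h)" .
qed

text \<open>The map x \<mapsto> integral(S(x \<beta>)) has trace \<epsilon>(\<beta>), which is
  nonzero by \<open>counit_alpha_beta\<close>.\<close>

lemma integral_nonzero: "\<exists>h. integral h \<noteq> 0"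
proof (rule ccontr)
  assume "\<not> (\<exists>h. integral h \<noteq> 0)"
  then have z: "integral_form (e' j) h = 0" for j h
    using integral_form[OF lin_e', of j h] lin_zero[OF lin_e'] by simp
  note L = sweedler lin_dual
  have ex: "B 7 (\<lambda>j. e' j x * e' i (c * (S (e j * \<beta>)))) = e' i (c * S (x * \<beta>))" for i x c
    using basis_sum[of "\<lambda>t. e' i (c * S (t * \<beta>))" 7 x] by (simp add: L)
  have be: "(D 4 v $ \<lambda>a b. e' i (c * S (x * (a * (\<beta> * (S b * y)))))) = \<epsilon> v * e' i (c * S (x * (\<beta> * y)))" for v i c x y
    using D_beta[of "\<lambda>t. e' i (c * S (x * t * y))" 4 v] by (simp add: lin_antipode lin_dual mult.assoc)
  have "B 7 (\<lambda>j. integral_form (e' j) (S (e j * \<beta>))) = 0" by (simp add: z sum_basis)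
  moreover have "B 7 (\<lambda>j. integral_form (e' j) (S (e j * \<beta>))) = (B 2 $ \<lambda>i. P 3 $ \<lambda>X1 X2 X3. D 4 (e i) $ \<lambda>a b.
      B 7 $ \<lambda>j. e' j (X1 * a) * e' i (\<beta> * S (S (X2 * b) * \<alpha> * X3) * S (e j * \<beta>)))"
    unfolding integral_form_def by (simp add: sum_sort mult.commute)
  moreover have "\<dots> = (B 2 $ \<lambda>i. P 3 $ \<lambda>X1 X2 X3. D 4 (e i) $ \<lambda>a b.
      e' i (\<beta> * S (X1 * (a * (\<beta> * (S b * (S X2 * (\<alpha> * X3))))))))"
    by (simp only: ex) (simp add: antipode_mult mult.assoc)
  moreover have "\<dots> = (B 2 $ \<lambda>i. \<epsilon> (e i) * (P 3 $ \<lambda>X1 X2 X3. e' i (\<beta> * S (X1 * (\<beta> * (S X2 * (\<alpha> * X3)))))))"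
    by (simp only: be sum_mult_left)
  moreover have "\<dots> = B 2 (\<lambda>i. e' i \<beta> * \<epsilon> (e i))"
    using P_antipode[of "\<lambda>t. e' i (\<beta> * S t)" 3 for i]
    by (simp add: lin_antipode lin_dual antipode_one mult.commute)
  moreover have "\<dots> = \<epsilon> \<beta>"
    using lin_counit[of "\<lambda>x. x"] by (intro basis_sum) (simp add: lin_map_intros)
  ultimately show False using counit_alpha_beta by simp
qed

section \<open>Injectivity and surjectivity of the antipode\<close>

lemma antipode_kernel:
  assumes a: "S a = 0"
  shows "a = 0"
proof -
  note L = sweedler lin_dual
  obtain h where "integral h \<noteq> 0" using integral_nonzero by blast
  then obtain \<Lambda> where \<Lambda>: "\<Lambda> \<noteq> 0" and inv: "b * \<Lambda> = \<epsilon> b *s \<Lambda>" for b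
    using integral_invariant by blast
  have D\<Lambda>: "D i (b * \<Lambda>) F = \<epsilon> b * D i \<Lambda> F" if "lin2 F" for i b F
    using lin_D[OF lin_map_intros(1) that, of i] by (simp add: inv lin_def)
  have kerL: "S (b * c) = 0" if "S c = 0" for b c using that by (simp add: antipode_mult)
  have kerR: "S (c * b) = 0" if "S c = 0" for b c using that by (simp add: antipode_mult)
  \<comment> \<open>Insert \<open>zigzag_pq\<close> in front of the coproduct of \<Lambda>. Since
    \<Lambda> is an integral, it absorbs the coproduct of \<open>X3\<close>. Then
    \<open>q_shift\<close> replaces the factor \<open>c\<close> by S(c), which is 0.\<close>
  have A: "(D 3 \<Lambda> $ \<lambda>u v. F u (c * v)) = 0" if c: "S c = 0" and F: "lin2 F" for c F
  proof -
    note F' = lin2_slots[OF F]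
    have F0: "F 0 y = 0" for y using F lin_zero[of "\<lambda>x. F x y"] by (simp add: lin2_def)
    have 1: "(P 2 $ \<lambda>X1 X2 X3. \<epsilon> X3 * (D 3 \<Lambda> $ \<lambda>u v. N 4 $ \<lambda>x1 x2 x3.
        F (X1 * \<beta> * S X2 * S x1 * \<alpha> * x2 * u) (c * x3 * v))) =
      (D 3 \<Lambda> $ \<lambda>u v. N 4 $ \<lambda>x1 x2 x3. F (\<beta> * S x1 * \<alpha> * x2 * u) (c * x3 * v))"
      using P_counit_3[of "\<lambda>p q. D 3 \<Lambda> $ \<lambda>u v. N 4 $ \<lambda>x1 x2 x3.
        F (p * \<beta> * S q * S x1 * \<alpha> * x2 * u) (c * x3 * v)" 2] by (simp add: L F' antipode_one)
    have 2: "(D 3 \<Lambda> $ \<lambda>u v. F u (c * v)) =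
      (D 3 \<Lambda> $ \<lambda>u v. N 4 $ \<lambda>x1 x2 x3. F (\<beta> * S x1 * \<alpha> * x2 * u) (c * x3 * v))"
    proof -
      have "(D 5 X3 $ \<lambda>p q. D 3 \<Lambda> $ \<lambda>u v. N 4 $ \<lambda>x1 x2 x3.
          F (X1 * \<beta> * S X2 * S x1 * \<alpha> * x2 * p * u) (c * x3 * q * v)) =
        \<epsilon> X3 * (D 3 \<Lambda> $ \<lambda>u v. N 4 $ \<lambda>x1 x2 x3.
          F (X1 * \<beta> * S X2 * S x1 * \<alpha> * x2 * u) (c * x3 * v))" for X1 X2 X3
        using D\<Lambda>[of "\<lambda>u v. N 4 $ \<lambda>x1 x2 x3. F (X1 * \<beta> * S X2 * S x1 * \<alpha> * x2 * u) (c * x3 * v)" 3 X3]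
        by (simp add: L F' D_mult[of _ 3 _ _ 5 3])
      then show ?thesis
        using zigzag_pq[of "\<lambda>A B. D 3 \<Lambda> $ \<lambda>u v. F (A * u) (c * B * v)" 2 5 4] 1
        by (simp add: L F')
    qed
    have "(D 5 c $ \<lambda>c1 c2. D 6 (c2 * \<Lambda>) $ \<lambda>u v. N 4 $ \<lambda>x1 x2 x3. F (\<beta> * S c1 * S x1 * \<alpha> * x2 * u) (x3 * v)) =
      (D 3 \<Lambda> $ \<lambda>u v. N 4 $ \<lambda>x1 x2 x3. F (\<beta> * S x1 * \<alpha> * x2 * u) (c * x3 * v))"
      using q_shift[of "\<lambda>A B. D 3 \<Lambda> $ \<lambda>u v. F (\<beta> * A * u) (B * v)" 5 c 7 4]
      by (simp add: L F' D_mult[of _ 6 _ _ 7 3])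
    moreover have "(D 6 (c2 * \<Lambda>) $ \<lambda>u v. N 4 $ \<lambda>x1 x2 x3. F (\<beta> * S c1 * S x1 * \<alpha> * x2 * u) (x3 * v)) =
        \<epsilon> c2 * (D 6 \<Lambda> $ \<lambda>u v. N 4 $ \<lambda>x1 x2 x3. F (\<beta> * S c1 * S x1 * \<alpha> * x2 * u) (x3 * v))" for c1 c2
      by (rule D\<Lambda>) (simp add: L F')
    moreover have "(D 5 c $ \<lambda>c1 c2. \<epsilon> c2 * (D 6 \<Lambda> $ \<lambda>u v. N 4 $ \<lambda>x1 x2 x3. F (\<beta> * S c1 * S x1 * \<alpha> * x2 * u) (x3 * v))) =
        (D 6 \<Lambda> $ \<lambda>u v. N 4 $ \<lambda>x1 x2 x3. F (\<beta> * S c * S x1 * \<alpha> * x2 * u) (x3 * v))"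
      by (rule D_counit) (simp add: L F')
    ultimately show ?thesis using 2 by (simp add: c F0 sum2_def sum3_def case_prod_unfold)
  qed
  \<comment> \<open>\<open>coassoc_P\<close> and a contraction with \<alpha> reduce this to
    \<open>A\<close>. Since \<open>A\<close> needs a fixed element of the kernel, the component
    \<open>q\<close> under S is first expanded in the basis. The kernel is an ideal, so
    \<open>c\<close> times S(e_i) stays in it.\<close>
  have E: "(P 2 $ \<lambda>X1 X2 X3. F (\<Lambda> * X1) (c * S X2 * \<alpha> * X3)) = 0" if c: "S c = 0" and F: "lin2 F" for c F
  proof -
    note F' = lin2_slots[OF F]
    have al: "(D 4 h $ \<lambda>p q. F x (w * (y * (S p * (\<alpha> * (q * z)))))) = \<epsilon> h * F x (w * (y * (\<alpha> * z)))" for h w x y z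
      using D_alpha[of "\<lambda>t. F x (w * y * t * z)" 4] by (simp add: sweedler F')
    have co: "(D 3 \<Lambda> $ \<lambda>u v. \<epsilon> v * F (u * x) y) = F (\<Lambda> * x) y" for x y
      by (rule D_counit) (simp add: sweedler F')
    have "(D 3 \<Lambda> $ \<lambda>u v. D 4 u $ \<lambda>p q. F (X1 * p) (c * (S q * (S X2 * (\<alpha> * (X3 * v)))))) = 0" for X1 X2 X3
    proof -
      have "(D 3 \<Lambda> $ \<lambda>u v. D 4 u $ \<lambda>p q. e' i q * F (X1 * p) (c * S (e i) * S X2 * \<alpha> * X3 * v)) = 0" for i
        using A[OF kerR[OF c], of "\<lambda>u w. D 4 u $ \<lambda>p q. e' i q * F (X1 * p) w" "S (e i) * S X2 * \<alpha> * X3"]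
        by (simp add: L F')
      then have "0 = (B 5 $ \<lambda>i. D 3 \<Lambda> $ \<lambda>u v. D 4 u $ \<lambda>p q. e' i q * F (X1 * p) (c * S (e i) * S X2 * \<alpha> * X3 * v))"
        by (simp add: sum_basis)
      also have "\<dots> = (D 3 \<Lambda> $ \<lambda>u v. D 4 u $ \<lambda>p q. B 5 $ \<lambda>i. e' i q * F (X1 * p) (c * S (e i) * S X2 * \<alpha> * X3 * v))"
        by (simp add: sum_sort)
      also have "\<dots> = (D 3 \<Lambda> $ \<lambda>u v. D 4 u $ \<lambda>p q. F (X1 * p) (c * S q * S X2 * \<alpha> * X3 * v))"
        using basis_sum[of "\<lambda>t. F (X1 * p) (c * S t * S X2 * \<alpha> * X3 * v)" 5 for p v] by (simp add: lin_antipode F')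
      finally show ?thesis by (simp add: mult.assoc)
    qed
    then show ?thesis
      using coassoc_P[of "\<lambda>x y z. F x (c * S y * \<alpha> * z)" 3 \<Lambda> 4 2]
      by (simp add: L F' al co) (simp add: sum3_def case_prod_unfold)
  qed
  \<comment> \<open>By \<open>pentagon_2'\<close>, with \<alpha> erasing one associator, this is a
    sum of instances of \<open>E\<close> for the kernel elements \<open>c * S q\<close>.\<close>
  have E2: "(N 3 $ \<lambda>x1 x2 x3. P 2 $ \<lambda>X1 X2 X3. D 4 X3 $ \<lambda>p q.
      F (\<Lambda> * X1) (c * S X2 * S x1 * \<alpha> * x2 * p) (x3 * q)) = 0" if c: "S c = 0" and F: "lin3 F" for c F
  proof -
    note F' = lin3_slots[OF F]
    have 1: "(P 2 $ \<lambda>Y1 Y2 Y3. N 3 $ \<lambda>y1 y2 y3. D 4 y1 $ \<lambda>p q.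
        F (\<Lambda> * Y1 * p) (c * S q * S Y2 * \<alpha> * Y3 * y2) y3) = 0"
    proof -
      have "(P 5 $ \<lambda>Y1 Y2 Y3. F (\<Lambda> * Y1 * p) (c * S q * S Y2 * \<alpha> * Y3 * y) z) = 0" for p q y z
        using E[OF kerR[OF c], of "\<lambda>u w. F (u * p) (w * y) z" "S q"] by (simp add: L F' sum3_def)
      then have "(N 3 $ \<lambda>y1 y2 y3. D 4 y1 $ \<lambda>p q. P 5 $ \<lambda>Y1 Y2 Y3.
        F (\<Lambda> * Y1 * p) (c * S q * S Y2 * \<alpha> * Y3 * y2) y3) = 0"
        by (simp add: sum2_def sum3_def case_prod_unfold)
      then show ?thesis
        unfolding sum2_def sum3_def case_prod_unfold by (simp add: sum_list_swap[of _ _ "\<Phi>"])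
    qed
    show ?thesis
      using pentagon_2'[of "\<lambda>w x y z. F (\<Lambda> * w) (c * S x * \<alpha> * y) z" 5 6 2 3 4 3 2 4]
        contract_P(2)[of "\<lambda>u t v. P 2 $ \<lambda>Y1 Y2 Y3. N 3 $ \<lambda>y1 y2 y3. D 4 y1 $ \<lambda>p q.
          F (\<Lambda> * u * Y1 * p) (c * S q * S Y2 * t * Y3 * y2) (v * y3)" 5 6] 1
      by (simp add: L F')
  qed
  \<comment> \<open>Multiplying \<open>E2\<close> by \<Phi>' cancels the remaining \<Phi>.\<close>
  have E3: "(N 3 $ \<lambda>x1 x2 x3. F \<Lambda> (c * S x1 * \<alpha> * x2) x3) = 0" if c: "S c = 0" and F: "lin3 F" for c F
  proof -
    note F' = lin3_slots[OF F]
    have "(N 3 $ \<lambda>x1 x2 x3. P 2 $ \<lambda>X1 X2 X3. D 4 X3 $ \<lambda>p q. D 5 z3 $ \<lambda>k l.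
      F (\<Lambda> * X1 * z1) (c * S z2 * S X2 * S x1 * \<alpha> * x2 * p * k) (x3 * q * l)) = 0" for z1 z2 z3
      using E2[OF kerR[OF c], of "\<lambda>u v w. D 5 z3 $ \<lambda>k l. F (u * z1) (v * k) (w * l)" "S z2"]
      by (simp add: L F')
    then have "(N 1 $ \<lambda>z1 z2 z3. N 3 $ \<lambda>x1 x2 x3. P 2 $ \<lambda>X1 X2 X3. D 4 X3 $ \<lambda>p q. D 5 z3 $ \<lambda>k l.
      F (\<Lambda> * X1 * z1) (c * S z2 * S X2 * S x1 * \<alpha> * x2 * p * k) (x3 * q * l)) = 0"
      by (simp add: sum3_def case_prod_unfold)
    then have "(P 2 $ \<lambda>X1 X2 X3. N 1 $ \<lambda>z1 z2 z3. N 3 $ \<lambda>x1 x2 x3. D 4 X3 $ \<lambda>p q. D 5 z3 $ \<lambda>k l.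
      F (\<Lambda> * X1 * z1) (c * S z2 * S X2 * S x1 * \<alpha> * x2 * p * k) (x3 * q * l)) = 0"
      unfolding sum2_def sum3_def case_prod_unfold by (simp add: sum_list_swap[of _ _ "\<Phi>"])
    then show ?thesis
      using PN[of "\<lambda>u v w. N 3 $ \<lambda>x1 x2 x3. D 4 w $ \<lambda>p q.
          F (\<Lambda> * u) (c * S v * S x1 * \<alpha> * x2 * p) (x3 * q)" 2 1]
      by (simp add: L F' antipode_one D_one D_mult[of _ 4 _ _ 4 5])
  qed
  \<comment> \<open>\<open>E3\<close> for the kernel element a X1 \<beta> S(X2), from which
    \<open>zigzag_pq\<close> recovers \<open>a\<close> alone.\<close>
  have "e' i \<Lambda> * e' j a = 0" for i j
  proof -
    have "(N 3 $ \<lambda>x1 x2 x3. D 4 X3 $ \<lambda>p q. e' i \<Lambda> * (e' j (a * X1 * \<beta> * S X2 * S x1 * \<alpha> * x2 * p) * \<epsilon> (x3 * q))) = 0"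
      for X1 X2 X3
      using E3[OF kerR[OF a], of "\<lambda>u v w. D 4 X3 $ \<lambda>p q. e' i u * (e' j (v * p) * \<epsilon> (w * q))" "X1 * \<beta> * S X2"]
      by (simp add: L)
    then show ?thesis
      using zigzag_pq[of "\<lambda>u v. e' i \<Lambda> * (e' j (a * u) * \<epsilon> v)" 2 4 3]
      by (simp add: L counit_one) (simp add: sum3_def case_prod_unfold)
  qed
  moreover obtain i where "e' i \<Lambda> \<noteq> 0"
  proof -
    have "\<exists>i. e' i \<Lambda> \<noteq> 0"
    proof (rule ccontr)
      assume "\<not> (\<exists>i. e' i \<Lambda> \<noteq> 0)"
      then have "\<Lambda> = 0" by (intro eqI_dual) (simp add: lin_zero[OF lin_e'])
      with \<Lambda> show False by simp
    qed
    then show ?thesis using that by blast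
  qed
  ultimately have "e' j a = 0" for j by (metis mult_eq_0_iff)
  then show ?thesis by (intro eqI_dual) (simp add: lin_zero[OF lin_e'])
qed

lemma surj_antipode: "surj S"
proof -
  interpret S: Vector_Spaces.linear scale scale S by (rule antipode_linear)
  have "x \<in> span (e ` I)" for x
  proof -
    have "(\<Sum>i\<in>I. e' i x *s e i) \<in> span (e ` I)"
      by (intro span_sum span_scale span_base) simp
    then show ?thesis by (simp add: basis_expansion)
  qed
  moreover obtain A where A: "A \<subseteq> e ` I" "independent A" "e ` I \<subseteq> span A"
    by (rule maximal_independent_subset)
  ultimately have "span A = UNIV"
    using span_mono[OF A(3)] by (auto simp: span_span)
  moreover have "finite A" using A(1) finite_index by (meson finite_imageI finite_subset)
  ultimately interpret finite_dimensional_vector_space scale A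
    by unfold_locales (use A(2) in auto)
  have "inj S"
    unfolding inj_def
  proof (intro allI impI)
    fix x y assume "S x = S y"
    then have "S (x - y) = 0" by (simp add: S.diff)
    then show "x = y" using antipode_kernel by fastforce
  qed
  with antipode_linear show ?thesis by (rule linear_inj_imp_surj)
qed

end

context quasi_hopf_algebra
begin

section \<open>The pentagon for \<open>V_tilde\<close>\<close>

text \<open>The legs of X and x are those of \<open>gamma\<close>, with its second entry S(X1 x11)
  \<alpha> x3 split at \<alpha> into two components. \<open>pentagon_1\<close> and
  \<open>pentagon_4\<close> place an inverse associator around \<open>delta\<close> for
  \<open>N_delta\<close>. \<open>q_shift\<close>, \<open>beta_absorb\<close> and
  \<open>zigzag_pq\<close> clear the rest.\<close>

lemma delta_gamma_core:
  assumes F: "lin3 F"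
  shows "(P i $ \<lambda>X1 X2 X3. N j $ \<lambda>x1 x2 x3. D k x1 $ \<lambda>p q. P l $ \<lambda>W1 W2 W3. D m W1 $ \<lambda>g g'. D n W2 $ \<lambda>k k'. D o' W3 $ \<lambda>l m.
      sum2 w delta $ \<lambda>u v. F (g * u * S k' * S q * S X2 * \<alpha> * X3 * x2 * l) (g' * v * S k * S p * S X1) (x3 * m)) =
    (P i' $ \<lambda>U1 U2 U3. N j' $ \<lambda>y1 y2 y3. D k' U1 $ \<lambda>g g'. F (g * y1) (g' * y2 * \<beta> * S y3 * S U2) U3)"
proof -
  have "(P 5 $ \<lambda>X1 X2 X3. N 6 $ \<lambda>x1 x2 x3. D 7 x1 $ \<lambda>p q. P 2 $ \<lambda>W1 W2 W3. D 10 W1 $ \<lambda>g g'. D 11 W2 $ \<lambda>k k'. D 12 W3 $ \<lambda>l m.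
      sum2 20 delta $ \<lambda>u v. F (g * u * S k' * S q * S X2 * \<alpha> * X3 * x2 * l) (g' * v * S k * S p * S X1) (x3 * m)) =
    (P 2 $ \<lambda>U1 U2 U3. N 5 $ \<lambda>y1 y2 y3. D 10 U1 $ \<lambda>g g'. F (g * y1) (g' * y2 * \<beta> * S y3 * S U2) U3)"
  proof -
    note F' = lin3_slots[OF F]
    have 1: "(P 5 $ \<lambda>X1 X2 X3. N 6 $ \<lambda>x1 x2 x3. D 7 x1 $ \<lambda>p q. P 2 $ \<lambda>W1 W2 W3. D 10 W1 $ \<lambda>g g'. D 11 W2 $ \<lambda>k k'. D 12 W3 $ \<lambda>l m.
        sum2 20 delta $ \<lambda>u v. F (g * u * S k' * S q * S X2 * \<alpha> * X3 * x2 * l) (g' * v * S k * S p * S X1) (x3 * m)) =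
      (P 2 $ \<lambda>U1 U2 U3. P 3 $ \<lambda>R1 R2 R3. N 5 $ \<lambda>z1 z2 z3. D 7 U3 $ \<lambda>c e. N 8 $ \<lambda>w1 w2 w3. D 9 e $ \<lambda>e1 e2. D 10 U1 $ \<lambda>g g'.
        D 12 R3 $ \<lambda>r r'. D 14 R1 $ \<lambda>a b. D 15 a $ \<lambda>a1 a2. D 16 z1 $ \<lambda>f f'. sum2 20 delta $ \<lambda>u v.
        F (g * a1 * f * u * S z3 * S R2 * S c * S w1 * \<alpha> * w2 * e1 * r) (g' * a2 * f' * v * S z2 * S b * S U2) (w3 * e2 * r'))"
      using pentagon_1[of "\<lambda>p q t y. P 2 $ \<lambda>W1 W2 W3. D 10 W1 $ \<lambda>g g'. D 11 W2 $ \<lambda>k k'. D 12 W3 $ \<lambda>l m. sum2 20 delta $ \<lambda>u v.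
          F (g * u * S k' * S q * \<alpha> * t * l) (g' * v * S k * S p) (y * m)" 5 6 7 6 7 8 5 9]
        contract_N(2)[of "\<lambda>p t q. N 8 $ \<lambda>w1 w2 w3. P 5 $ \<lambda>X1 X2 X3. D 9 X3 $ \<lambda>c d. P 2 $ \<lambda>W1 W2 W3. D 10 W1 $ \<lambda>g g'. D 11 W2 $ \<lambda>k k'.
          D 12 W3 $ \<lambda>l m. sum2 20 delta $ \<lambda>u v.
          F (g * u * S k' * S X2 * S w1 * t * w2 * c * l) (g' * v * S k * S X1 * S p) (q * w3 * d * m)" 6 7]
        pentagon_4[of "\<lambda>A B C E. N 8 $ \<lambda>w1 w2 w3. D 10 A $ \<lambda>g g'. D 9 E $ \<lambda>c d. sum2 20 delta $ \<lambda>u v.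
          F (g * u * S C * S w1 * \<alpha> * w2 * c) (g' * v * S B) (w3 * d)" 5 2 11 2 7 3 14 5]
      by (simp add: sweedler F' antipode_one D_mult[of _ 9 _ _ 9 12] D_mult[of _ 10 _ _ 10 15] D_mult[of _ 15 _ _ 15 16])
    have 2: "(P 2 $ \<lambda>U1 U2 U3. P 3 $ \<lambda>R1 R2 R3. N 5 $ \<lambda>z1 z2 z3. D 7 U3 $ \<lambda>c e. N 8 $ \<lambda>w1 w2 w3. D 9 e $ \<lambda>e1 e2. D 10 U1 $ \<lambda>g g'.
        D 12 R3 $ \<lambda>r r'. D 14 R1 $ \<lambda>a b. D 15 a $ \<lambda>a1 a2. D 16 z1 $ \<lambda>f f'. sum2 20 delta $ \<lambda>u v.
        F (g * a1 * f * u * S z3 * S R2 * S c * S w1 * \<alpha> * w2 * e1 * r) (g' * a2 * f' * v * S z2 * S b * S U2) (w3 * e2 * r')) =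
      (P 2 $ \<lambda>U1 U2 U3. N 5 $ \<lambda>y1 y2 y3. D 10 U1 $ \<lambda>g g'. F (g * y1) (g' * y2 * \<beta> * S y3 * S U2) U3)"
      using N_delta[of "\<lambda>A B. P 2 $ \<lambda>U1 U2 U3. P 3 $ \<lambda>R1 R2 R3. D 7 U3 $ \<lambda>c e. N 8 $ \<lambda>w1 w2 w3. D 9 e $ \<lambda>e1 e2. D 10 U1 $ \<lambda>g g'.
          D 12 R3 $ \<lambda>r r'. D 14 R1 $ \<lambda>a b. D 15 a $ \<lambda>a1 a2.
          F (g * a1 * A * S R2 * S c * S w1 * \<alpha> * w2 * e1 * r) (g' * a2 * B * S b * S U2) (w3 * e2 * r')" 5 16 20]
        q_shift[of "\<lambda>A B. P 3 $ \<lambda>R1 R2 R3. N 5 $ \<lambda>y1 y2 y3. D 10 U1 $ \<lambda>g g'. D 12 R3 $ \<lambda>r r'. D 14 R1 $ \<lambda>a b. D 15 a $ \<lambda>a1 a2.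
          F (g * a1 * y1 * \<beta> * S R2 * A * r) (g' * a2 * y2 * \<beta> * S y3 * S b * S U2) (B * r')" 7 U3 9 8 for U1 U2 U3]
        beta_absorb[of "\<lambda>A B. N 8 $ \<lambda>w1 w2 w3. D 10 U1 $ \<lambda>g g'. D 12 R3 $ \<lambda>r r'.
          F (g * A * \<beta> * S R2 * S w1 * \<alpha> * w2 * r) (g' * B * S U2) (U3 * w3 * r')" 14 R1 15 5 for U1 U2 U3 R1 R2 R3]
        zigzag_pq[of "\<lambda>A B. P 2 $ \<lambda>U1 U2 U3. N 5 $ \<lambda>y1 y2 y3. D 10 U1 $ \<lambda>g g'. F (g * y1 * A) (g' * y2 * \<beta> * S y3 * S U2) (U3 * B)" 3 12 8]
      by (simp add: sweedler F')
    from 1 2 show ?thesis by simp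
  qed
  then show ?thesis by (simp add: sum2_def sum3_def)
qed

text \<open>\<open>pentagon_2\<close>, \<open>p_shift\<close> and \<open>pentagon_3\<close> merge
  two copies of X1 \<beta> S(X2) \<otimes> X3. The right-hand side is the value \<open>R\<close> in
  \<open>V_tilde_pentagon\<close> without its twists.\<close>

lemma beta_beta_core:
  assumes F: "lin3 F"
  shows "(P 2 $ \<lambda>X1 X2 X3. P 3 $ \<lambda>Y1 Y2 Y3. P 4 $ \<lambda>W1 W2 W3. D 5 X2 $ \<lambda>k l. D 9 X3 $ \<lambda>m n.
      F (X1 * Y1 * \<beta> * S Y2 * S k) (l * Y3 * W1 * \<beta> * S W2 * S m) (n * W3)) =
    (P 2 $ \<lambda>Y1 Y2 Y3. P 3 $ \<lambda>U1 U2 U3. N 5 $ \<lambda>z1 z2 z3. D 7 U1 $ \<lambda>a b.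
      F (Y1 * \<beta> * S Y2 * S z1 * S a) (b * z2 * \<beta> * S z3 * S U2) (U3 * Y3))"
proof -
  note F' = lin3_slots[OF F]
  show ?thesis
    using pentagon_2[of "\<lambda>A B C E. P 4 $ \<lambda>W1 W2 W3. D 9 E $ \<lambda>m n.
        F (A * \<beta> * S B) (C * W1 * \<beta> * S W2 * S m) (n * W3)" 2 5 3 6 2 7 3 8]
      contract_P(4)[of "\<lambda>t p q. N 6 $ \<lambda>x1 x2 x3. P 2 $ \<lambda>X1 X2 X3. D 7 X3 $ \<lambda>c d. P 4 $ \<lambda>W1 W2 W3. D 9 (x3 * (d * q)) $ \<lambda>m n.
        F (X1 * t * S X2 * S x1) (x2 * c * p * W1 * \<beta> * S W2 * S m) (n * W3)" 3 8]
      p_shift[of "\<lambda>A B. N 6 $ \<lambda>x1 x2 x3. D 9 x3 $ \<lambda>m n. F (X1 * \<beta> * S X2 * S x1) (x2 * A * S m) (n * B)" 7 X3 10 4 for X1 X2 X3]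
      pentagon_3[of "\<lambda>A B C E. P 2 $ \<lambda>X1 X2 X3. F (X1 * \<beta> * S X2 * S A) (B * \<beta> * S C) (E * X3)" 6 9 4 3 7 5 6 8]
      contract_N(5)[of "\<lambda>p t q. P 2 $ \<lambda>X1 X2 X3. P 3 $ \<lambda>U1 U2 U3. D 7 U1 $ \<lambda>a b. N 5 $ \<lambda>z1 z2 z3.
        F (X1 * \<beta> * S X2 * S p * S z1 * S a) (b * z2 * t * S z3 * S U2) (U3 * q * X3)" 6 8]
    by (simp add: sweedler F' antipode_one D_mult[of _ 9 _ _ 9 10] D_mult[of _ 10 _ _ 10 11])
qed

text \<open>The inverse of S occurs in \<open>V_tilde\<close> only underneath S, so surjectivity of
  S eliminates it here.\<close>

lemma sum_V_tilde:
  assumes "surj S"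
  shows "sum2 i V_tilde F = (P j $ \<lambda>X1 X2 X3. sum2 k drinfeld_twist $ \<lambda>u v. F (S X3 * u) (X1 * \<beta> * S X2 * v))"
  using surj_f_inv_f[OF assms]
  by (simp add: sum2_def sum3_def V_tilde_def p_L_def case_prod_unfold o_def sum_list_map_concat_map antipode_mult)

text \<open>\<open>twist_antipode\<close> moves \<Delta>(S(c2)) to the front of f, and
  \<open>p_shift\<close> then gathers all parts of \<open>h\<close> next to
  \<open>X3\<close>.\<close>

lemma V_tilde_shift:
  assumes S: "surj S" and F: "lin2 F"
  shows "(sum2 i V_tilde $ \<lambda>a1 a2. D j h $ \<lambda>c1 c2. D k (S c2) $ \<lambda>s1 s2. F (a1 * s1) (c1 * a2 * s2)) =
    (sum2 i V_tilde $ \<lambda>a1 a2. F (S h * a1) a2)"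
proof -
  note F' = lin2_slots[OF F]
  have "(sum2 2 V_tilde $ \<lambda>a1 a2. D 3 h $ \<lambda>c1 c2. D 4 (S c2) $ \<lambda>s1 s2. F (a1 * s1) (c1 * a2 * s2)) =
    (sum2 2 V_tilde $ \<lambda>a1 a2. F (S h * a1) a2)"
    using twist_antipode[of "\<lambda>U V. P 5 $ \<lambda>X1 X2 X3. F (S X3 * U) (c1 * X1 * \<beta> * S X2 * V)" 4 c2 6 for c1 c2]
      p_shift[of "\<lambda>A B. sum2 6 drinfeld_twist $ \<lambda>u v. F (S B * u) (A * v)" 3 h 4 5]
    by (simp add: sum_V_tilde[OF S, of 2 _ 5 6] sweedler F')
  then show ?thesis by (simp add: sum2_def)
qed

text \<open>Three copies of \<open>V_tilde\<close> on the left bring three twists, two on the right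
  only two. The surplus twist becomes an inverse twist by \<open>twist_beta_coproduct\<close> and
  ends up in \<open>delta\<close>.\<close>

lemma V_tilde_pentagon:
  assumes S: "surj S" and G: "lin3 G"
  shows "(sum2 i V_tilde $ \<lambda>a1 a2. sum2 j V_tilde $ \<lambda>b1 b2. sum2 k V_tilde $ \<lambda>c1 c2. N l $ \<lambda>x1 x2 x3.
      D m c1 $ \<lambda>c11 c12. D n (S (c2 * x3)) $ \<lambda>s1 s2. G (b2 * c12 * x2 * a2 * s2) (a1 * s1) (b1 * c11 * x1)) =
    (sum2 i V_tilde $ \<lambda>a1 a2. sum2 j V_tilde $ \<lambda>b1 b2. P k $ \<lambda>X1 X2 X3. D l (S X2) $ \<lambda>s1 s2. D m (S X3) $ \<lambda>t1 t2.
      G (X1 * a2 * s2) (S (b2 * t2) * a1 * s1) (b1 * t1))"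
proof -
  note G' = lin3_slots[OF G]
  \<comment> \<open>The common value of both sides, with two twists left.\<close>
  define R where "R = (P 2 $ \<lambda>Y1 Y2 Y3. P 3 $ \<lambda>U1 U2 U3. N 5 $ \<lambda>z1 z2 z3. D 7 U1 $ \<lambda>a b. sum2 20 drinfeld_twist $ \<lambda>r s. sum2 22 drinfeld_twist $ \<lambda>u v.
      G (Y1 * \<beta> * S Y2 * S z1 * S a * v) (S (b * z2 * \<beta> * S z3 * S U2 * s) * u) (S (U3 * Y3) * r))"
  \<comment> \<open>\<open>twist_antipode\<close> clears the coproducts of antipodes next to two of
    the twists, so that \<open>twist_cocycle'\<close> can rearrange the nested pair.\<close>
  have L1: "(sum2 30 V_tilde $ \<lambda>a1 a2. sum2 31 V_tilde $ \<lambda>b1 b2. sum2 32 V_tilde $ \<lambda>c1 c2. N 6 $ \<lambda>x1 x2 x3.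
      D 33 c1 $ \<lambda>c11 c12. D 34 (S (c2 * x3)) $ \<lambda>s1 s2. G (b2 * c12 * x2 * a2 * s2) (a1 * s1) (b1 * c11 * x1)) =
    (P 2 $ \<lambda>W1 W2 W3. P 3 $ \<lambda>Y1 Y2 Y3. N 6 $ \<lambda>x1 x2 x3. D 12 W3 $ \<lambda>l m.
      sum2 20 drinfeld_twist $ \<lambda>r s. sum2 21 drinfeld_twist $ \<lambda>f1 f2. sum2 22 drinfeld_twist $ \<lambda>u v. P 25 $ \<lambda>X1 X2 X3.
      D 33 s $ \<lambda>a b. D 34 (W1 * \<beta> * S W2 * S x1 * f2 * b) $ \<lambda>k k'.
      G (Y1 * \<beta> * S Y2 * S l * S x2 * f1 * a * X1 * \<beta> * S X2 * S k * v) (S X3 * S k' * u) (S Y3 * S m * S x3 * r))"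
    using twist_antipode[of "\<lambda>U V. P 3 $ \<lambda>Y1 Y2 Y3. P 25 $ \<lambda>X1 X2 X3. N 6 $ \<lambda>x1 x2 x3. sum2 20 drinfeld_twist $ \<lambda>r s.
        sum2 22 drinfeld_twist $ \<lambda>u v. D 33 r $ \<lambda>r1 r2. D 34 (S (W1 * \<beta> * S W2 * s * x3)) $ \<lambda>s1 s2.
        G (Y1 * \<beta> * S Y2 * V * r2 * x2 * X1 * \<beta> * S X2 * v * s2) (S X3 * u * s1) (S Y3 * U * r1 * x1)" 12 W3 21 for W1 W2 W3]
      twist_antipode[of "\<lambda>U V. sum2 21 drinfeld_twist $ \<lambda>f1 f2. P 25 $ \<lambda>X1 X2 X3. D 33 r $ \<lambda>r1 r2.
        G (Y1 * \<beta> * S Y2 * S l * f2 * r2 * x2 * X1 * \<beta> * S X2 * V) (S X3 * U) (S Y3 * S m * f1 * r1 * x1)"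
        34 "W1 * \<beta> * S W2 * s * x3" 22 for W1 W2 W3 Y1 Y2 Y3 x1 x2 x3 l m r s]
      twist_cocycle'[of "\<lambda>A B C. P 2 $ \<lambda>W1 W2 W3. P 3 $ \<lambda>Y1 Y2 Y3. P 25 $ \<lambda>X1 X2 X3. D 12 W3 $ \<lambda>l m. D 34 (W1 * \<beta> * S W2 * C) $ \<lambda>k k'.
        sum2 22 drinfeld_twist $ \<lambda>u v.
        G (Y1 * \<beta> * S Y2 * S l * B * X1 * \<beta> * S X2 * S k * v) (S X3 * S k' * u) (S Y3 * S m * A)" 20 33 21 6]
    by (simp add: sum_V_tilde[OF S, of 30 _ 25 22] sum_V_tilde[OF S, of 31 _ 3 21] sum_V_tilde[OF S, of 32 _ 2 20]
        sweedler G' D_mult[of _ 33 _ _ 12 33])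
  \<comment> \<open>\<open>p_shift\<close> absorbs the coproduct of \<open>s\<close>. The remaining
    coproduct is distributed over its factors to expose \<Delta>(\<beta>).\<close>
  have L2: "\<dots> =
    (P 2 $ \<lambda>W1 W2 W3. P 3 $ \<lambda>Y1 Y2 Y3. N 6 $ \<lambda>x1 x2 x3. D 12 W3 $ \<lambda>l m.
      sum2 20 drinfeld_twist $ \<lambda>r s. sum2 21 drinfeld_twist $ \<lambda>f1 f2. sum2 22 drinfeld_twist $ \<lambda>u v. P 25 $ \<lambda>X1 X2 X3.
      D 36 W1 $ \<lambda>g g'. D 37 \<beta> $ \<lambda>b b'. D 38 (S W2) $ \<lambda>t t'. D 39 (S x1) $ \<lambda>y y'. D 41 f2 $ \<lambda>a a'.
      G (Y1 * \<beta> * S Y2 * S l * S x2 * f1 * X1 * \<beta> * S X2 * S (g * b * t * y * a) * v)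
        (S s * S X3 * S (g' * b' * t' * y' * a') * u) (S Y3 * S m * S x3 * r))"
    using p_shift[of "\<lambda>A B. sum2 21 drinfeld_twist $ \<lambda>f1 f2. sum2 22 drinfeld_twist $ \<lambda>u v.
        D 36 W1 $ \<lambda>g g'. D 37 \<beta> $ \<lambda>b b'. D 38 (S W2) $ \<lambda>t t'. D 39 (S x1) $ \<lambda>y y'. D 41 f2 $ \<lambda>a a'.
        G (Y1 * \<beta> * S Y2 * S l * S x2 * f1 * A * S (g * b * t * y * a) * v)
          (S B * S (g' * b' * t' * y' * a') * u) (S Y3 * S m * S x3 * r)" 33 s 34 25 for W1 W2 W3 Y1 Y2 Y3 x1 x2 x3 l m r s]
    by (simp add: sweedler G' D_mult[of _ 34 _ _ 36 51] D_mult[of _ 51 _ _ 37 52] D_mult[of _ 52 _ _ 38 53]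
        D_mult[of _ 53 _ _ 39 54] D_mult[of _ 54 _ _ 41 34])
  \<comment> \<open>\<open>twist_beta_coproduct\<close> replaces the twist \<open>f1\<close>,
    \<open>f2\<close> by an inverse twist. It passes S(x1) and S(W2) by
    \<open>twist_inverse_antipode\<close> and turns \<Delta>(\<beta>) into
    \<open>delta\<close>.\<close>
  have L3: "\<dots> =
    (P 2 $ \<lambda>W1 W2 W3. P 3 $ \<lambda>Y1 Y2 Y3. N 6 $ \<lambda>x1 x2 x3. D 12 W3 $ \<lambda>l m.
      sum2 20 drinfeld_twist $ \<lambda>r s. sum2 21 delta $ \<lambda>d d'. sum2 22 drinfeld_twist $ \<lambda>u v. P 25 $ \<lambda>X1 X2 X3.
      D 36 W1 $ \<lambda>g g'. D 38 W2 $ \<lambda>t t'. D 39 x1 $ \<lambda>y y'.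
      G (Y1 * \<beta> * S (g * d * S t' * S y' * S X2 * \<alpha> * X3 * x2 * l * Y2) * v)
        (S (g' * d' * S t * S y * S X1 * s) * u) (S (x3 * m * Y3) * r))"
    using twist_beta_coproduct[of "\<lambda>U V. P 2 $ \<lambda>W1 W2 W3. P 3 $ \<lambda>Y1 Y2 Y3. N 6 $ \<lambda>x1 x2 x3. D 12 W3 $ \<lambda>l m.
        sum2 20 drinfeld_twist $ \<lambda>r s. sum2 22 drinfeld_twist $ \<lambda>u v. D 36 W1 $ \<lambda>g g'. D 37 \<beta> $ \<lambda>b b'. D 38 (S W2) $ \<lambda>t t'. D 39 (S x1) $ \<lambda>y y'.
        G (Y1 * \<beta> * S Y2 * S l * S x2 * U * S (g * b * t * y) * v)
          (S s * S V * S (g' * b' * t' * y') * u) (S Y3 * S m * S x3 * r)" 21 41 25]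
      twist_inverse_antipode[of "\<lambda>U V. D 12 W3 $ \<lambda>l m. sum2 20 drinfeld_twist $ \<lambda>r s. sum2 22 drinfeld_twist $ \<lambda>u v. P 25 $ \<lambda>X1 X2 X3.
        D 36 W1 $ \<lambda>g g'. D 37 \<beta> $ \<lambda>b b'. D 38 (S W2) $ \<lambda>t t'.
        G (Y1 * \<beta> * S (g * b * t * U * S X2 * \<alpha> * X3 * x2 * l * Y2) * v)
          (S (g' * b' * t' * V * S X1 * s) * u) (S (x3 * m * Y3) * r)" 39 x1 21 for W1 W2 W3 Y1 Y2 Y3 x1 x2 x3]
      twist_inverse_antipode[of "\<lambda>U V. P 3 $ \<lambda>Y1 Y2 Y3. N 6 $ \<lambda>x1 x2 x3. D 12 W3 $ \<lambda>l m. sum2 20 drinfeld_twist $ \<lambda>r s. sum2 22 drinfeld_twist $ \<lambda>u v. P 25 $ \<lambda>X1 X2 X3.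
        D 36 W1 $ \<lambda>g g'. D 37 \<beta> $ \<lambda>b b'. D 39 x1 $ \<lambda>y y'.
        G (Y1 * \<beta> * S (g * b * U * S y' * S X2 * \<alpha> * X3 * x2 * l * Y2) * v)
          (S (g' * b' * V * S y * S X1 * s) * u) (S (x3 * m * Y3) * r)" 38 W2 21 for W1 W2 W3]
      twist_inverse_beta[of "\<lambda>U V. P 2 $ \<lambda>W1 W2 W3. P 3 $ \<lambda>Y1 Y2 Y3. N 6 $ \<lambda>x1 x2 x3. D 12 W3 $ \<lambda>l m. sum2 20 drinfeld_twist $ \<lambda>r s. sum2 22 drinfeld_twist $ \<lambda>u v. P 25 $ \<lambda>X1 X2 X3.
        D 36 W1 $ \<lambda>g g'. D 38 W2 $ \<lambda>t t'. D 39 x1 $ \<lambda>y y'.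
        G (Y1 * \<beta> * S (g * U * S t' * S y' * S X2 * \<alpha> * X3 * x2 * l * Y2) * v)
          (S (g' * V * S t * S y * S X1 * s) * u) (S (x3 * m * Y3) * r)" 37 21]
    by (simp add: sweedler G')
  have L4: "\<dots> = R"
    using delta_gamma_core[of "\<lambda>A B C. P 3 $ \<lambda>Y1 Y2 Y3. sum2 20 drinfeld_twist $ \<lambda>r s. sum2 22 drinfeld_twist $ \<lambda>u v.
        G (Y1 * \<beta> * S (A * Y2) * v) (S (B * s) * u) (S (C * Y3) * r)" 25 6 39 2 36 38 12 21 4 5 7]
    by (simp add: R_def sweedler G') (simp add: sum3_def sum2_def)
  have R: "(sum2 30 V_tilde $ \<lambda>a1 a2. sum2 31 V_tilde $ \<lambda>b1 b2. P 2 $ \<lambda>X1 X2 X3. D 5 (S X2) $ \<lambda>s1 s2. D 9 (S X3) $ \<lambda>t1 t2.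
      G (X1 * a2 * s2) (S (b2 * t2) * a1 * s1) (b1 * t1)) = R"
    using twist_antipode[of "\<lambda>U V. P 3 $ \<lambda>Y1 Y2 Y3. P 4 $ \<lambda>W1 W2 W3. sum2 20 drinfeld_twist $ \<lambda>r s. D 9 (S X3) $ \<lambda>t1 t2.
        G (X1 * Y1 * \<beta> * S Y2 * V) (S (W1 * \<beta> * S W2 * s * t2) * S Y3 * U) (S W3 * r * t1)" 5 X2 22 for X1 X2 X3]
      twist_antipode[of "\<lambda>U V. P 3 $ \<lambda>Y1 Y2 Y3. P 4 $ \<lambda>W1 W2 W3. sum2 22 drinfeld_twist $ \<lambda>u v. D 5 X2 $ \<lambda>k l.
        G (X1 * Y1 * \<beta> * S Y2 * S k * v) (S (W1 * \<beta> * S W2 * V) * S Y3 * S l * u) (S W3 * U)" 9 X3 20 for X1 X2 X3]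
      beta_beta_core[of "\<lambda>A B C. sum2 20 drinfeld_twist $ \<lambda>r s. sum2 22 drinfeld_twist $ \<lambda>u v. G (A * v) (S (B * s) * u) (S C * r)"]
    by (simp add: R_def sum_V_tilde[OF S, of 30 _ 3 22] sum_V_tilde[OF S, of 31 _ 4 20] sweedler G')
  show ?thesis using L1 L2 L3 L4 R by (simp add: sum2_def sum3_def)
qed

end

context quasi_bialgebra
begin

section \<open>The Heisenberg double\<close>

definition heis_eval ::
  "(('h \<times> ('h \<Rightarrow> 'k)) \<times> ('h \<times> ('h \<Rightarrow> 'k)) \<times> ('h \<times> ('h \<Rightarrow> 'k))) list \<Rightarrow>
    'h \<Rightarrow> 'h \<Rightarrow> 'h \<Rightarrow> ('h \<Rightarrow> 'h \<Rightarrow> 'h \<Rightarrow> 'k) \<Rightarrow> 'k" where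
  "heis_eval s y1 y2 y3 G = (\<Sum>((a, \<xi>), (b, \<nu>), (c, \<zeta>))\<leftarrow>s. \<xi> y1 * (\<nu> y2 * (\<zeta> y3 * G a b c)))"

text \<open>
  The effect of a right multiplication on one tensor factor: \<open>\<Psi>\<close> receives the new argument of the old functional
  and the right factor of the old algebra element.
\<close>

fun slot :: "nat \<Rightarrow> nat \<Rightarrow> nat \<Rightarrow> 'h \<times> ('h \<Rightarrow> 'k) \<Rightarrow> 'h \<Rightarrow> ('h \<Rightarrow> 'h \<Rightarrow> 'k) \<Rightarrow> 'k" where
  "slot i j k (b, \<nu>) y \<Psi> = (D i b $ \<lambda>b1 b2. N j $ \<lambda>x1 x2 x3. D k y $ \<lambda>y1 y2.
     \<nu> (x3 * y2) * \<Psi> (b2 * (x2 * y1)) (b1 * x1))"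

lemma heis_mult_slot:
  "(\<Sum>(p, \<zeta>)\<leftarrow>heis_mult (a, \<xi>) n. \<zeta> y * g p) = slot i j k n y (\<lambda>z w. \<xi> z * g (a * w))"
  by (cases n) (simp add: sum2_def sum3_def case_prod_unfold o_def sum_list_map_concat_map convolution_def
      act_right_def mult_ac flip: sum_list_const_mult)

lemma slot_scale: "slot i j k n y (\<lambda>z w. c * \<Psi> z w) = c * slot i j k n y \<Psi>"
  by (cases n) (simp add: mult.left_commute[of _ c] sum_mult_left)

lemma slot_sum_list:
  "slot i j k n y (\<lambda>z w. \<Sum>t\<leftarrow>ts. \<Psi> t z w) = (\<Sum>t\<leftarrow>ts. slot i j k n y (\<Psi> t))"
proof (induction ts)
  case Nil
  show ?case by (cases n) (simp add: sum2_def sum3_def case_prod_unfold)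
next
  case (Cons t ts)
  have "slot i j k n y (\<lambda>z w. \<Psi> t z w + R z w) = slot i j k n y (\<Psi> t) + slot i j k n y R" for R
    by (cases n) (simp add: sum2_def sum3_def case_prod_unfold sum_list_addf distrib_left)
  with Cons show ?case by simp
qed

text \<open>The right factor acts on the arguments before the left one is evaluated, so
  left-bracketed products unfold one right factor at a time.\<close>

lemma heis_eval_mult:
  "heis_eval (heis_mult3 s t) y1 y2 y3 G =
    (\<Sum>(n1, n2, n3)\<leftarrow>t. (slot 11 12 13 n1 y1 $ \<lambda>z1 w1. slot 21 22 23 n2 y2 $ \<lambda>z2 w2. slot 31 32 33 n3 y3 $ \<lambda>z3 w3.
      heis_eval s z1 z2 z3 (\<lambda>a b c. G (a * w1) (b * w2) (c * w3))))"
proof -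
  have 1: "(\<Sum>p\<leftarrow>heis_mult (a, \<xi>) n1. \<Sum>q\<leftarrow>heis_mult (b, \<nu>) n2. \<Sum>r\<leftarrow>heis_mult (c, \<zeta>) n3.
      snd p y1 * (snd q y2 * (snd r y3 * G (fst p) (fst q) (fst r)))) =
    (slot 11 12 13 n1 y1 $ \<lambda>z1 w1. slot 21 22 23 n2 y2 $ \<lambda>z2 w2. slot 31 32 33 n3 y3 $ \<lambda>z3 w3.
      \<xi> z1 * (\<nu> z2 * (\<zeta> z3 * G (a * w1) (b * w2) (c * w3))))"
    for a \<xi> b \<nu> c \<zeta> n1 n2 n3
    using heis_mult_slot[of y3 "\<lambda>r. G p q r" c \<zeta> n3 31 32 33 for p q]
      heis_mult_slot[of y2 "\<lambda>q. slot 31 32 33 n3 y3 (\<lambda>z3 w3. \<zeta> z3 * G p q (c * w3))" b \<nu> n2 21 22 23 for p]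
      heis_mult_slot[of y1 "\<lambda>p. slot 21 22 23 n2 y2 (\<lambda>z2 w2. \<nu> z2 * slot 31 32 33 n3 y3 (\<lambda>z3 w3. \<zeta> z3 * G p (b * w2) (c * w3)))" a \<xi> n1 11 12 13]
    by (simp add: case_prod_unfold sum_list_const_mult slot_scale)
  show ?thesis
    unfolding heis_eval_def heis_mult3_def
    by (simp add: sum_list_map_concat_map case_prod_unfold o_def slot_sum_list 1[symmetric] del: slot.simps heis_mult.simps)
      (simp add: sum_list_swap[of _ t s])
qed

lemma slot_unit:
  assumes "lin2 \<Psi>"
  shows "slot i j k (1, \<epsilon>) y \<Psi> = \<Psi> y 1"
proof -
  note \<Psi> = lin2_slots[OF assms]
  have 1: "(D k y $ \<lambda>y1 y2. c * (\<epsilon> y2 * \<Psi> (a * y1) b)) = c * \<Psi> (a * y) b" for a b c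
    using D_counit(1)[of "\<lambda>t. \<Psi> (a * t) b" k y] by (simp add: lin_rules \<Psi> sum_mult_left)
  show ?thesis
    using N_counit_3[of "\<lambda>p q. \<Psi> (q * y) p" j] by (simp add: lin_rules \<Psi> D_one counit_mult mult.assoc 1)
qed

lemma slot_counit:
  assumes "lin2 \<Psi>"
  shows "slot i j k (b, \<epsilon>) y \<Psi> = D i b (\<lambda>b1 b2. \<Psi> (b2 * y) b1)"
proof -
  note \<Psi> = lin2_slots[OF assms]
  have 1: "(D k y $ \<lambda>y1 y2. c * (\<epsilon> y2 * \<Psi> (a * (d * y1)) b)) = c * \<Psi> (a * (d * y)) b" for a b c d
    using D_counit(1)[of "\<lambda>t. \<Psi> (a * (d * t)) b" k y] by (simp add: lin_rules \<Psi> sum_mult_left)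
  show ?thesis
    using N_counit_3[of "\<lambda>p q. \<Psi> (b2 * (q * y)) (b1 * p)" j for b1 b2] by (simp add: lin_rules \<Psi> counit_mult mult.assoc 1)
qed

text \<open>If the left factor has functional part \<epsilon>, its argument enters only through
  \<epsilon>. The counit then erases \<Phi>' and both coproducts.\<close>

lemma slot_dual:
  assumes g: "lin g" and \<nu>: "lin \<nu>"
  shows "slot i j k (b, \<nu>) y (\<lambda>z w. \<epsilon> z * g w) = \<nu> y * g b"
proof -
  note g' = lin_compose[OF g] and \<nu>' = lin_compose[OF \<nu>]
  have 1: "(D k y $ \<lambda>y1 y2. \<epsilon> y1 * (\<nu> (a * y2) * c)) = \<nu> (a * y) * c" for a c
    by (rule D_counit) (simp add: lin_rules \<nu>')
  have 2: "(N j $ \<lambda>x1 x2 x3. \<epsilon> x2 * (\<nu> (x3 * y) * g (b1 * x1))) = \<nu> y * g b1" for b1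
    using N_counit_2[of "\<lambda>p q. \<nu> (q * y) * g (b1 * p)" j] by (simp add: lin_rules \<nu>' g')
  have 3: "(D i b $ \<lambda>b1 b2. \<epsilon> b2 * (\<nu> y * g b1)) = \<nu> y * g b"
    by (rule D_counit) (simp add: lin_rules g')
  have "slot i j k (b, \<nu>) y (\<lambda>z w. \<epsilon> z * g w) = (D i b $ \<lambda>b1 b2. N j $ \<lambda>x1 x2 x3. D k y $ \<lambda>y1 y2.
     \<epsilon> b2 * (\<epsilon> x2 * (\<epsilon> y1 * (\<nu> (x3 * y2) * g (b1 * x1)))))"
    by (simp add: counit_mult mult_ac)
  then show ?thesis by (simp only: sum_mult_left 1 2 3)
qed

end

section \<open>Evaluation in the third tensor power of the Heisenberg double\<close>

context quasi_hopf_algebra_basis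
begin

lemma lin_plus: "lin f \<Longrightarrow> lin g \<Longrightarrow> lin (f + g)"
  by (simp add: lin_def distrib_left add.assoc add.left_commute)

text \<open>A functional respecting the relations is linear in each functional entry. Expanding
  these entries in the dual basis turns its value into a combination of evaluations at basis
  vectors.\<close>

lemma heis_tensor3_eqI:
  assumes dual: "\<And>p. p \<in> set s \<union> set t \<Longrightarrow> p \<in> (UNIV \<times> dual scale) \<times> (UNIV \<times> dual scale) \<times> (UNIV \<times> dual scale)"
    and eval: "\<And>G y1 y2 y3. lin3 G \<Longrightarrow> heis_eval s y1 y2 y3 G = heis_eval t y1 y2 y3 G"
    and e': "\<And>i. e' i \<in> dual scale"
  shows "heis_tensor3 scale s = heis_tensor3 scale t"
  unfolding heis_tensor3_def Let_def
proof (rule tensor_class_eqI)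
  let ?P = "UNIV \<times> dual scale"
  let ?A = "pair_slots {\<lambda>x. x} UNIV {} (dual scale)"
  let ?B = "pair_slots {} UNIV {\<lambda>\<xi>. \<xi>} (dual scale)"
  let ?SA = "pair_slots ?A ?P (pair_slots ?A ?P ?A ?P) (?P \<times> ?P)"
  let ?SB = "pair_slots ?B ?P (pair_slots ?B ?P ?B ?P) (?P \<times> ?P)"
  fix F :: "('h \<times> ('h \<Rightarrow> 'k)) \<times> ('h \<times> ('h \<Rightarrow> 'k)) \<times> ('h \<times> ('h \<Rightarrow> 'k)) \<Rightarrow> 'k"
  assume F: "\<And>r. r \<in> linearity_rels scale UNIV ?SA \<union> linearity_rels dual_scale (dual scale) ?SB \<Longrightarrow> formal_eval F r = 0"
  interpret E: Vector_Spaces.linear free_scale "(*)" "formal_eval F" by (rule linear_formal_eval)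
  have SA: "lin (\<lambda>x. F (i x))" if "i \<in> ?SA" for i
  proof -
    have "formal_eval F (Poly_Mapping.single (i (x + y)) 1 - Poly_Mapping.single (i x) 1
        - Poly_Mapping.single (i y) 1) = 0" for x y
      using that by (intro F UnI1) (unfold linearity_rels_def, blast)
    moreover have "formal_eval F (Poly_Mapping.single (i (c *s x)) 1
        - free_scale c (Poly_Mapping.single (i x) 1)) = 0" for c x
      using that by (intro F UnI1) (unfold linearity_rels_def, blast)
    ultimately show ?thesis by (simp add: E.diff E.scale formal_eval_add lin_def diff_diff_eq)
  qed
  have SB: "F (i (\<xi> + \<nu>)) = F (i \<xi>) + F (i \<nu>)" "F (i (dual_scale c \<xi>)) = c * F (i \<xi>)"
    if "i \<in> ?SB" "\<xi> \<in> dual scale" "\<nu> \<in> dual scale" for i \<xi> \<nu> c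
  proof -
    have "formal_eval F (Poly_Mapping.single (i (\<xi> + \<nu>)) 1 - Poly_Mapping.single (i \<xi>) 1
        - Poly_Mapping.single (i \<nu>) 1) = 0"
      using that by (intro F UnI2) (unfold linearity_rels_def, blast)
    moreover have "formal_eval F (Poly_Mapping.single (i (dual_scale c \<xi>)) 1
        - free_scale c (Poly_Mapping.single (i \<xi>) 1)) = 0"
      using that by (intro F UnI2) (unfold linearity_rels_def, blast)
    ultimately show "F (i (\<xi> + \<nu>)) = F (i \<xi>) + F (i \<nu>)" "F (i (dual_scale c \<xi>)) = c * F (i \<xi>)"
      by (simp_all add: E.diff E.scale formal_eval_add diff_diff_eq)
  qed
  have dual_lin: "\<xi> \<in> dual scale \<longleftrightarrow> lin \<xi>" for \<xi>
    by (simp add: dual_def linear_mult_iff vector_space_axioms lin_def)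
  have expand: "F (i \<xi>) = (\<Sum>j\<in>I. \<xi> (e j) * F (i (e' j)))" if i: "i \<in> ?SB" and \<xi>: "\<xi> \<in> dual scale" for i \<xi>
  proof -
    \<comment> \<open>The induction also carries membership in the dual space, because
      \<open>SB\<close> grants additivity only there.\<close>
    have fin: "(\<Sum>j\<in>J. dual_scale (\<xi> (e j)) (e' j)) \<in> dual scale \<and>
        F (i (\<Sum>j\<in>J. dual_scale (\<xi> (e j)) (e' j))) = (\<Sum>j\<in>J. \<xi> (e j) * F (i (e' j)))" if "finite J" for J
      using that
    proof (induction J rule: finite_induct)
      case empty
      have z: "(0::'h \<Rightarrow> 'k) \<in> dual scale" by (simp add: dual_lin lin_def)
      have "F (i 0) = 0"
        using SB(2)[OF i z z, of 0] by (simp add: dual_scale_def zero_fun_def)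
      with z show ?case unfolding sum.empty by blast
    next
      case (insert j J)
      have j: "dual_scale (\<xi> (e j)) (e' j) \<in> dual scale"
        using lin_mult(2)[OF lin_e'[of j]] by (simp add: dual_lin dual_scale_def)
      then have "dual_scale (\<xi> (e j)) (e' j) + (\<Sum>j\<in>J. dual_scale (\<xi> (e j)) (e' j)) \<in> dual scale"
        using insert.IH lin_plus unfolding dual_lin by blast
      then show ?case
        unfolding sum.insert[OF insert.hyps(1,2)] SB(1)[OF i j conjunct1[OF insert.IH]]
          SB(2)[OF i e' e'] using insert.IH by (simp only: simp_thms)
    qed
    have "\<xi> = (\<Sum>j\<in>I. dual_scale (\<xi> (e j)) (e' j))"
    proof
      fix x
      have "finite J \<Longrightarrow> (\<Sum>j\<in>J. dual_scale (\<xi> (e j)) (e' j)) x = (\<Sum>j\<in>J. \<xi> (e j) * e' j x)" for J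
        by (induction J rule: finite_induct) (simp_all add: dual_scale_def)
      then show "\<xi> x = (\<Sum>j\<in>I. dual_scale (\<xi> (e j)) (e' j)) x"
        using basis_sum[of \<xi> 0 x] \<xi> by (simp add: finite_index sum_basis dual_lin mult.commute)
    qed
    then show ?thesis using fin[OF finite_index] by metis
  qed
  have A: "(\<lambda>x. (x, \<xi>)) \<in> ?A" if "\<xi> \<in> dual scale" for \<xi>
    using that by (auto simp: pair_slots_def)
  have B: "(\<lambda>\<xi>. (a, \<xi>)) \<in> ?B" for a
    by (auto simp: pair_slots_def)
  have sl1: "(\<lambda>x. ((x, \<xi>), q)) \<in> ?SA" if "\<xi> \<in> dual scale" "q \<in> ?P \<times> ?P" for \<xi> q
    by (rule pair_slots_fst[OF A[OF that(1)] that(2)])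
  have sl2: "(\<lambda>x. (p, (x, \<xi>), r)) \<in> ?SA" if "\<xi> \<in> dual scale" "p \<in> ?P" "r \<in> ?P" for \<xi> p r
    by (rule pair_slots_snd[OF that(2) pair_slots_fst[OF A[OF that(1)] that(3)]])
  have sl3: "(\<lambda>x. (p, p', (x, \<xi>))) \<in> ?SA" if "\<xi> \<in> dual scale" "p \<in> ?P" "p' \<in> ?P" for \<xi> p p'
    by (rule pair_slots_snd[OF that(2) pair_slots_snd[OF that(3) A[OF that(1)]]])
  have sl4: "(\<lambda>\<xi>. ((a, \<xi>), q)) \<in> ?SB" if "q \<in> ?P \<times> ?P" for a q
    by (rule pair_slots_fst[OF B that])
  have sl5: "(\<lambda>\<xi>. (p, (a, \<xi>), r)) \<in> ?SB" if "p \<in> ?P" "r \<in> ?P" for p a r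
    by (rule pair_slots_snd[OF that(1) pair_slots_fst[OF B that(2)]])
  have sl6: "(\<lambda>\<xi>. (p, p', (a, \<xi>))) \<in> ?SB" if "p \<in> ?P" "p' \<in> ?P" for p p' a
    by (rule pair_slots_snd[OF that(1) pair_slots_snd[OF that(2) B]])
  have e'P: "(x, e' i) \<in> ?P" for x :: 'h and i using e' by simp
  let ?G = "\<lambda>i j k a b c. F ((a, e' i), (b, e' j), (c, e' k))"
  have G: "lin3 (?G i j k)" for i j k
    unfolding lin3_def
  proof (intro conjI allI)
    fix a b c :: 'h
    have q: "((b, e' j), (c, e' k)) \<in> ?P \<times> ?P" using e' by simp
    note P = e'P[of b j] e'P[of a i]
    show "lin (\<lambda>a. ?G i j k a b c)" by (rule SA[OF sl1[OF e' q]])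
    show "lin (\<lambda>b. ?G i j k a b c)" by (rule SA[OF sl2[OF e' P(2) e'P]])
    show "lin (\<lambda>c. ?G i j k a b c)" by (rule SA[OF sl3[OF e' P(2) P(1)]])
  qed
  have "F ((a, \<xi>), (b, \<nu>), (c, \<zeta>)) = (\<Sum>i\<in>I. \<Sum>j\<in>I. \<Sum>k\<in>I. \<xi> (e i) * (\<nu> (e j) * (\<zeta> (e k) * ?G i j k a b c)))"
    if "\<xi> \<in> dual scale" "\<nu> \<in> dual scale" "\<zeta> \<in> dual scale" for a b c \<xi> \<nu> \<zeta>
  proof -
    have "F ((a, \<xi>), (b, \<nu>), (c, \<zeta>)) = (\<Sum>i\<in>I. \<xi> (e i) * F ((a, e' i), (b, \<nu>), (c, \<zeta>)))"
      by (rule expand[of "\<lambda>\<xi>. ((a, \<xi>), (b, \<nu>), (c, \<zeta>))"], rule sl4) (use that in auto)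
    also have "\<dots> = (\<Sum>i\<in>I. \<xi> (e i) * (\<Sum>j\<in>I. \<nu> (e j) * F ((a, e' i), (b, e' j), (c, \<zeta>))))"
      by (intro sum.cong refl arg_cong2[where f = "(*)"],
          rule expand[of "\<lambda>\<nu>. ((a, e' _), (b, \<nu>), (c, \<zeta>))"], rule sl5) (use that e' in auto)
    also have "\<dots> = (\<Sum>i\<in>I. \<xi> (e i) * (\<Sum>j\<in>I. \<nu> (e j) * (\<Sum>k\<in>I. \<zeta> (e k) * ?G i j k a b c)))"
      by (intro sum.cong refl arg_cong2[where f = "(*)"],
          rule expand[of "\<lambda>\<zeta>. ((a, e' _), (b, e' _), (c, \<zeta>))"], rule sl6) (use that e' in auto)
    finally show ?thesis by (simp add: sum_distrib_left)
  qed
  note F_eq = this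
  have sum_swap: "(\<Sum>p\<leftarrow>ps. \<Sum>i\<in>I. f p i) = (\<Sum>i\<in>I. \<Sum>p\<leftarrow>ps. f p i)" for ps :: "'q list" and f :: "'q \<Rightarrow> 'i \<Rightarrow> 'k"
    by (induction ps) (simp_all add: sum.distrib)
  have "(\<Sum>p\<leftarrow>ps. F p) = (\<Sum>i\<in>I. \<Sum>j\<in>I. \<Sum>k\<in>I. heis_eval ps (e i) (e j) (e k) (?G i j k))"
    if ps: "\<And>p. p \<in> set ps \<Longrightarrow> p \<in> ?P \<times> ?P \<times> ?P" for ps
  proof -
    have "(\<Sum>p\<leftarrow>ps. F p) = (\<Sum>p\<leftarrow>ps. case p of ((a, \<xi>), (b, \<nu>), (c, \<zeta>)) \<Rightarrow>
      \<Sum>i\<in>I. \<Sum>j\<in>I. \<Sum>k\<in>I. \<xi> (e i) * (\<nu> (e j) * (\<zeta> (e k) * ?G i j k a b c)))"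
      using ps by (intro arg_cong[where f = sum_list] map_cong refl) (auto simp: F_eq split: prod.splits)
    also have "\<dots> = (\<Sum>i\<in>I. \<Sum>j\<in>I. \<Sum>k\<in>I. heis_eval ps (e i) (e j) (e k) (?G i j k))"
      by (simp add: heis_eval_def case_prod_unfold sum_swap)
    finally show ?thesis .
  qed
  then show "(\<Sum>p\<leftarrow>s. F p) = (\<Sum>p\<leftarrow>t. F p)"
    using dual eval[OF G] by simp
qed

text \<open>Not a basis: the admissible pure tensors, those whose functional parts are
  linear.\<close>

abbreviation heis_basis :: "(('h \<times> ('h \<Rightarrow> 'k)) \<times> ('h \<times> ('h \<Rightarrow> 'k)) \<times> ('h \<times> ('h \<Rightarrow> 'k))) set" where
  "heis_basis \<equiv> (UNIV \<times> dual scale) \<times> (UNIV \<times> dual scale) \<times> (UNIV \<times> dual scale)"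

lemma dual_iff_lin: "\<xi> \<in> dual scale \<longleftrightarrow> lin \<xi>"
  by (simp add: dual_def linear_mult_iff vector_space_axioms lin_def)

lemma lin_epsilon: "lin \<epsilon>"
  using lin_counit[of "\<lambda>x. x"] by (simp add: lin_map_intros)

lemma heis_mult_dual:
  assumes "m \<in> UNIV \<times> dual scale" "n \<in> UNIV \<times> dual scale" "p \<in> set (heis_mult m n)"
  shows "p \<in> UNIV \<times> dual scale"
proof -
  obtain a \<xi> b \<nu> where mn: "m = (a, \<xi>)" "n = (b, \<nu>)" "lin \<xi>" "lin \<nu>"
    using assms(1,2) by (auto simp: dual_iff_lin)
  have "lin (convolution (\<xi> \<leftharpoonup> c) (\<nu> \<leftharpoonup> d))" for c d
  proof -
    have "lin (\<lambda>x. D 0 x (\<lambda>u v. \<xi> (c * u) * \<nu> (d * v)))"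
      using lin_compose[OF mn(3)] lin_compose[OF mn(4)] by (intro lin_D) (simp_all add: lin_rules)
    then show ?thesis by (simp add: convolution_def[abs_def] act_right_def sum2_def)
  qed
  with assms(3) show ?thesis by (auto simp: mn(1,2) dual_iff_lin)
qed

lemma heis_mult3_dual:
  assumes "set s \<subseteq> heis_basis" "set t \<subseteq> heis_basis"
  shows "set (heis_mult3 s t) \<subseteq> heis_basis"
proof
  fix p assume "p \<in> set (heis_mult3 s t)"
  then obtain m1 m2 m3 n1 n2 n3 p1 p2 p3 where *: "(m1, m2, m3) \<in> set s" "(n1, n2, n3) \<in> set t" "p = (p1, p2, p3)"
    "p1 \<in> set (heis_mult m1 n1)" "p2 \<in> set (heis_mult m2 n2)" "p3 \<in> set (heis_mult m3 n3)"
    by (auto simp: heis_mult3_def simp del: heis_mult.simps)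
  have "(m1, m2, m3) \<in> heis_basis" "(n1, n2, n3) \<in> heis_basis" using assms *(1,2) by auto
  then show "p \<in> heis_basis"
    using *(3) heis_mult_dual[OF _ _ *(4)] heis_mult_dual[OF _ _ *(5)] heis_mult_dual[OF _ _ *(6)] by simp
qed

lemma heis_eval_fst_snd:
  "heis_eval s y1 y2 y3 G =
    (\<Sum>(n1, n2, n3)\<leftarrow>s. snd n1 y1 * (snd n2 y2 * (snd n3 y3 * G (fst n1) (fst n2) (fst n3))))"
  by (simp add: heis_eval_def case_prod_unfold)

lemma W_bar_legs_sum:
  "(\<Sum>(n1, n2, n3)\<leftarrow>leg12 u (W_bar I e e'). \<Psi> n1 n2 n3) = B n (\<lambda>i. \<Psi> (e i, \<epsilon>) (1, e' i) u)"
  "(\<Sum>(n1, n2, n3)\<leftarrow>leg13 u (W_bar I e e'). \<Psi> n1 n2 n3) = B n (\<lambda>i. \<Psi> (e i, \<epsilon>) u (1, e' i))"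
  "(\<Sum>(n1, n2, n3)\<leftarrow>leg23 u (W_bar I e e'). \<Psi> n1 n2 n3) = B n (\<lambda>i. \<Psi> u (e i, \<epsilon>) (1, e' i))"
  by (simp_all add: leg12_def leg13_def leg23_def W_bar_def sum2_def basis_list_def o_def)

lemma W_hat_legs_sum:
  "(\<Sum>(n1, n2, n3)\<leftarrow>leg12 u (W_hat I e e'). \<Psi> n1 n2 n3) =
    (sum2 j V_tilde $ \<lambda>V1 V2. B n $ \<lambda>i. \<Psi> (S (V2 * e i), \<epsilon>) (V1, e' i) u)"
  "(\<Sum>(n1, n2, n3)\<leftarrow>leg13 u (W_hat I e e'). \<Psi> n1 n2 n3) =
    (sum2 j V_tilde $ \<lambda>V1 V2. B n $ \<lambda>i. \<Psi> (S (V2 * e i), \<epsilon>) u (V1, e' i))"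
  "(\<Sum>(n1, n2, n3)\<leftarrow>leg23 u (W_hat I e e'). \<Psi> n1 n2 n3) =
    (sum2 j V_tilde $ \<lambda>V1 V2. B n $ \<lambda>i. \<Psi> u (S (V2 * e i), \<epsilon>) (V1, e' i))"
  by (simp_all add: leg12_def leg13_def leg23_def W_hat_def sum2_def basis_list_def o_def
      sum_list_map_concat_map case_prod_unfold sum_list_swap[of _ V_tilde])

lemma legs_dual:
  assumes "set W \<subseteq> (UNIV \<times> dual scale) \<times> (UNIV \<times> dual scale)"
  shows "set (leg12 heis_unit W) \<subseteq> heis_basis" "set (leg13 heis_unit W) \<subseteq> heis_basis"
    "set (leg23 heis_unit W) \<subseteq> heis_basis"
  using assms lin_epsilon by (auto simp: leg12_def leg13_def leg23_def heis_unit_def dual_iff_lin)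

lemma W_dual:
  "set (W_bar I e e') \<subseteq> (UNIV \<times> dual scale) \<times> (UNIV \<times> dual scale)"
  "set (W_hat I e e') \<subseteq> (UNIV \<times> dual scale) \<times> (UNIV \<times> dual scale)"
  using lin_epsilon lin_e' by (auto simp: W_bar_def W_hat_def dual_iff_lin)

lemma Phi_dual: "set Phi_inv_321 \<subseteq> heis_basis" "set Phi_S \<subseteq> heis_basis"
  using lin_epsilon by (auto simp: Phi_inv_321_def Phi_S_def dual_iff_lin)

declare slot.simps [simp del]

lemma lin_slot: "(\<And>z w. lin (\<lambda>x. \<Psi> x z w)) \<Longrightarrow> lin (\<lambda>x. slot i j k n y (\<Psi> x))"
  by (cases n) (simp add: slot.simps lin_rules)

lemma slot_heis_unit: "lin2 \<Psi> \<Longrightarrow> slot i j k heis_unit y \<Psi> = \<Psi> y 1"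
  unfolding heis_unit_def by (rule slot_unit)

text \<open>The sum over \<open>i\<close> disappears because e^i is evaluated at
  \<open>x3 * q2\<close>, and the expansion puts this element in place of e_i.\<close>

lemma basis_slots:
  assumes T: "lin_map T" and \<Psi>: "lin4 \<Psi>"
  shows "(B n $ \<lambda>i. slot a b c (T (e i), \<epsilon>) y $ \<lambda>z w. slot j k l (p, e' i) y' $ \<lambda>z' w'. \<Psi> z w z' w') =
    (D j p $ \<lambda>p1 p2. N k $ \<lambda>x1 x2 x3. D l y' $ \<lambda>q1 q2. D a (T (x3 * q2)) $ \<lambda>b1 b2.
      \<Psi> (b2 * y) b1 (p2 * (x2 * q1)) (p1 * x1))"
proof -
  note \<Psi>' = lin4_slots[OF \<Psi>]
  have 1: "B 90 (\<lambda>i. e' i x * (D 91 (T (e i)) $ \<lambda>b1 b2. \<Psi> (b2 * y) b1 u v)) = (D 91 (T x) $ \<lambda>b1 b2. \<Psi> (b2 * y) b1 u v)"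
    for x u v
    using T by (intro basis_sum) (simp add: lin_rules \<Psi>')
  have "(B n $ \<lambda>i. slot a b c (T (e i), \<epsilon>) y $ \<lambda>z w. slot j k l (p, e' i) y' $ \<lambda>z' w'. \<Psi> z w z' w') =
    (B n $ \<lambda>i. D a (T (e i)) $ \<lambda>b1 b2. slot j k l (p, e' i) y' $ \<lambda>z' w'. \<Psi> (b2 * y) b1 z' w')"
    by (simp add: slot_counit lin_slot lin_rules \<Psi>')
  also have "\<dots> = (B 90 $ \<lambda>i. D 91 (T (e i)) $ \<lambda>b1 b2. D 2 p $ \<lambda>p1 p2. N 3 $ \<lambda>x1 x2 x3. D 4 y' $ \<lambda>q1 q2.
      e' i (x3 * q2) * \<Psi> (b2 * y) b1 (p2 * (x2 * q1)) (p1 * x1))"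
    by (simp add: slot.simps) (simp add: sum2_def sum3_def)
  also have "\<dots> = (D 2 p $ \<lambda>p1 p2. N 3 $ \<lambda>x1 x2 x3. D 4 y' $ \<lambda>q1 q2. B 90 $ \<lambda>i. e' i (x3 * q2) *
      (D 91 (T (e i)) $ \<lambda>b1 b2. \<Psi> (b2 * y) b1 (p2 * (x2 * q1)) (p1 * x1)))"
    by (simp add: sum_sort flip: sum_mult_left)
  finally show ?thesis by (simp add: 1) (simp add: sum2_def sum3_def)
qed

text \<open>When the new argument of the factor carrying e^i enters only through \<epsilon>, the
  associator of \<open>basis_slots\<close> disappears by \<open>slot_dual\<close>. In
  \<open>basis_slots_counit2\<close> the other argument does so as well, which also removes the last
  coproduct.\<close>

lemma basis_slots_counit:
  assumes T: "lin_map T" and \<Psi>: "lin3 \<Psi>"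
  shows "(B n $ \<lambda>i. slot a b c (T (e i), \<epsilon>) y $ \<lambda>z w. slot j k l (p, e' i) y' $ \<lambda>z' w'. \<epsilon> z' * \<Psi> z w w') =
    (D a (T y') $ \<lambda>b1 b2. \<Psi> (b2 * y) b1 p)"
proof -
  note \<Psi>' = lin3_slots[OF \<Psi>]
  have "B n (\<lambda>i. e' i y' * (D a (T (e i)) $ \<lambda>b1 b2. \<Psi> (b2 * y) b1 p)) = (D a (T y') $ \<lambda>b1 b2. \<Psi> (b2 * y) b1 p)"
    using T by (intro basis_sum) (simp add: lin_rules \<Psi>')
  then show ?thesis
    by (simp add: slot_dual lin_e' slot_counit lin_rules \<Psi>' sum_mult_left)
qed

lemma basis_slots_counit2:
  assumes T: "lin_map T" and \<Psi>: "lin2 \<Psi>"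
  shows "(B n $ \<lambda>i. slot a b c (T (e i), \<epsilon>) y $ \<lambda>z w. slot j k l (p, e' i) y' $ \<lambda>z' w'. \<epsilon> z * (\<epsilon> z' * \<Psi> w w')) =
    \<epsilon> y * \<Psi> (T y') p"
proof -
  note \<Psi>' = lin2_slots[OF \<Psi>]
  have "(D a (T y') $ \<lambda>b1 b2. \<epsilon> b2 * (\<epsilon> y * \<Psi> b1 p)) = \<epsilon> y * \<Psi> (T y') p"
    by (rule D_counit) (simp add: lin_rules \<Psi>')
  then show ?thesis
    using basis_slots_counit[OF T, of "\<lambda>z w w'. \<epsilon> z * \<Psi> w w'" n a b c y j k l p y']
    by (simp add: lin_rules \<Psi>' counit_mult mult_ac)
qed

section \<open>The two identities in the Heisenberg double\<close>

lemma W_bar_pentagon: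
  "heis_tensor3 scale (heis_mult3 (heis_mult3 (leg23 heis_unit (W_bar I e e')) (leg13 heis_unit (W_bar I e e')))
      (leg12 heis_unit (W_bar I e e'))) =
   heis_tensor3 scale (heis_mult3 (heis_mult3 Phi_inv_321 (leg12 heis_unit (W_bar I e e'))) (leg23 heis_unit (W_bar I e e')))"
proof (rule heis_tensor3_eqI)
  let ?W = "W_bar I e e'"
  fix G :: "'h \<Rightarrow> 'h \<Rightarrow> 'h \<Rightarrow> 'k" and y1 y2 y3 :: 'h
  assume G: "lin3 G"
  note id = lin_map_intros(1)
  have E1: "heis_eval (leg23 heis_unit ?W) z1 z2 z3 G = \<epsilon> z1 * (\<epsilon> z2 * G 1 z3 1)" if G: "lin3 G" for z1 z2 z3 G
    using basis_sum[of "\<lambda>t. G 1 t 1" 90 z3] lin3_slots[OF G]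
    by (simp add: heis_eval_fst_snd W_bar_legs_sum[where n = 90] heis_unit_def sum_mult_left lin_rules)
  have E2: "heis_eval (heis_mult3 (leg23 heis_unit ?W) (leg13 heis_unit ?W)) z1 z2 z3 G =
    \<epsilon> z1 * (\<epsilon> z2 * (N 32 $ \<lambda>x1 x2 x3. D 33 z3 $ \<lambda>c d. G (x3 * d) (x2 * c) x1))" if G: "lin3 G" for z1 z2 z3 G
  proof -
    note G' = lin3_slots[OF G]
    have "heis_eval (heis_mult3 (leg23 heis_unit ?W) (leg13 heis_unit ?W)) z1 z2 z3 G =
      (B 90 $ \<lambda>i. slot 11 12 13 (e i, \<epsilon>) z1 $ \<lambda>z w. slot 31 32 33 (1, e' i) z3 $ \<lambda>z' w'. \<epsilon> z * (\<epsilon> z2 * G w z' w'))"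
      by (simp add: heis_eval_mult W_bar_legs_sum[where n = 90] E1 lin_rules lin_slot G' slot_heis_unit)
    then show ?thesis
      using basis_slots[OF id, of "\<lambda>z w z' w'. \<epsilon> z * (\<epsilon> z2 * G w z' w')" 90 11 12 13 z1 31 32 33 1 z3]
        D_counit[of "\<lambda>t. \<epsilon> z1 * (\<epsilon> z2 * G t u v)" 11 for u v]
      by (simp add: lin_rules G' D_one counit_mult mult.assoc sum_mult_left)
  qed
  have E3: "heis_eval (heis_mult3 Phi_inv_321 (leg12 heis_unit ?W)) z1 z2 z3 G =
    \<epsilon> z1 * (\<epsilon> z3 * (N 32 $ \<lambda>x1 x2 x3. G (x3 * z2) x2 x1))" if G: "lin3 G" for z1 z2 z3 G
  proof -
    note G' = lin3_slots[OF G]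
    have 1: "heis_eval Phi_inv_321 z1 z2 z3 G = \<epsilon> z1 * (\<epsilon> z2 * (\<epsilon> z3 * (N 32 $ \<lambda>x1 x2 x3. G x3 x2 x1)))" for z1 z2 z3 G
      by (simp add: heis_eval_def Phi_inv_321_def sum3_def case_prod_unfold o_def sum_list_const_mult)
    have "heis_eval (heis_mult3 Phi_inv_321 (leg12 heis_unit ?W)) z1 z2 z3 G =
      (B 90 $ \<lambda>i. slot 11 12 13 (e i, \<epsilon>) z1 $ \<lambda>z w. slot 21 22 23 (1, e' i) z2 $ \<lambda>z' w'.
        \<epsilon> z * (\<epsilon> z' * (\<epsilon> z3 * (N 32 $ \<lambda>x1 x2 x3. G (x3 * w) (x2 * w') x1))))"
      by (simp add: heis_eval_mult W_bar_legs_sum[where n = 90] 1 lin_rules G' slot_heis_unit)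
    then show ?thesis
      using basis_slots_counit2[OF id, of "\<lambda>w w'. \<epsilon> z3 * (N 32 $ \<lambda>x1 x2 x3. G (x3 * w) (x2 * w') x1)" 90 11 12 13 z1 21 22 23 1 z2]
      by (simp add: lin_rules G')
  qed
  note G' = lin3_slots[OF G]
  have "heis_eval (heis_mult3 (heis_mult3 (leg23 heis_unit ?W) (leg13 heis_unit ?W)) (leg12 heis_unit ?W)) y1 y2 y3 G =
    (B 90 $ \<lambda>i. slot 11 12 13 (e i, \<epsilon>) y1 $ \<lambda>z w. slot 21 22 23 (1, e' i) y2 $ \<lambda>z' w'. \<epsilon> z * (\<epsilon> z' *
      (N 32 $ \<lambda>x1 x2 x3. D 33 y3 $ \<lambda>c d. G (x3 * d * w) (x2 * c * w') x1)))"
    by (simp add: heis_eval_mult[of _ "leg12 heis_unit ?W"] W_bar_legs_sum[where n = 90] E2 lin_rules G' slot_heis_unit)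
  also have "\<dots> = \<epsilon> y1 * (N 32 $ \<lambda>x1 x2 x3. D 33 y3 $ \<lambda>c d. G (x3 * d * y2) (x2 * c) x1)"
    using basis_slots_counit2[OF id, of "\<lambda>w w'. N 32 $ \<lambda>x1 x2 x3. D 33 y3 $ \<lambda>c d. G (x3 * d * w) (x2 * c * w') x1" 90 11 12 13 y1 21 22 23 1 y2]
    by (simp add: lin_rules G')
  also have "\<dots> = \<epsilon> y1 * (D 21 y3 $ \<lambda>c d. N 32 $ \<lambda>x1 x2 x3. G (x3 * d * y2) (x2 * c) x1)"
    by (simp add: sum2_sum3_commute) (simp add: sum2_def)
  also have "\<dots> = (B 90 $ \<lambda>i. slot 21 22 23 (e i, \<epsilon>) y2 $ \<lambda>z w. slot 31 32 33 (1, e' i) y3 $ \<lambda>z' w'. \<epsilon> z' * (\<epsilon> y1 *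
      (N 32 $ \<lambda>x1 x2 x3. G (x3 * z) (x2 * w) (x1 * w'))))"
    using basis_slots_counit[OF id, of "\<lambda>z w w'. \<epsilon> y1 * (N 32 $ \<lambda>x1 x2 x3. G (x3 * z) (x2 * w) (x1 * w'))" 90 21 22 23 y2 31 32 33 1 y3]
    by (simp add: lin_rules G' sum_mult_left mult.assoc)
  also have "\<dots> = heis_eval (heis_mult3 (heis_mult3 Phi_inv_321 (leg12 heis_unit ?W)) (leg23 heis_unit ?W)) y1 y2 y3 G"
    by (simp add: heis_eval_mult[of _ "leg23 heis_unit ?W"] W_bar_legs_sum[where n = 90] E3 lin_rules G' slot_heis_unit lin_slot mult.left_commute)
  finally show "heis_eval (heis_mult3 (heis_mult3 (leg23 heis_unit ?W) (leg13 heis_unit ?W)) (leg12 heis_unit ?W)) y1 y2 y3 G =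
    heis_eval (heis_mult3 (heis_mult3 Phi_inv_321 (leg12 heis_unit ?W)) (leg23 heis_unit ?W)) y1 y2 y3 G" .
next
  let ?W = "W_bar I e e'"
  fix p assume "p \<in> set (heis_mult3 (heis_mult3 (leg23 heis_unit ?W) (leg13 heis_unit ?W)) (leg12 heis_unit ?W)) \<union>
    set (heis_mult3 (heis_mult3 Phi_inv_321 (leg12 heis_unit ?W)) (leg23 heis_unit ?W))"
  moreover note L = legs_dual(3,2,1)[OF W_dual(1)] Phi_dual(1) legs_dual(1,3)[OF W_dual(1)]
  ultimately show "p \<in> heis_basis"
    using heis_mult3_dual[OF heis_mult3_dual[OF L(1,2)] L(3)] heis_mult3_dual[OF heis_mult3_dual[OF L(4,5)] L(6)] by blast
qed (simp add: dual_iff_lin lin_e')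

lemma W_hat_pentagon:
  "heis_tensor3 scale (heis_mult3 (heis_mult3 (leg12 heis_unit (W_hat I e e')) (leg13 heis_unit (W_hat I e e')))
      (leg23 heis_unit (W_hat I e e'))) =
   heis_tensor3 scale (heis_mult3 (heis_mult3 (leg23 heis_unit (W_hat I e e')) (leg12 heis_unit (W_hat I e e'))) Phi_S)"
proof (rule heis_tensor3_eqI)
  let ?W = "W_hat I e e'"
  fix G :: "'h \<Rightarrow> 'h \<Rightarrow> 'h \<Rightarrow> 'k" and y1 y2 y3 :: 'h
  assume G: "lin3 G"
  have T: "lin_map (\<lambda>x. S (v * x))" for v by (simp add: lin_antipode)
  note legs = W_hat_legs_sum[where j = 60 and n = 90]
  have E1: "heis_eval (leg12 heis_unit ?W) z1 z2 z3 G = \<epsilon> z1 * (\<epsilon> z3 * (sum2 60 V_tilde $ \<lambda>V1 V2. G (S (V2 * z2)) V1 1))"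
    if G: "lin3 G" for z1 z2 z3 G
    using basis_sum[of "\<lambda>t. \<epsilon> z3 * G (S (v2 * t)) v1 1" 90 z2 for v1 v2] lin3_slots[OF G]
    by (simp add: heis_eval_fst_snd legs heis_unit_def sum_mult_left lin_antipode)
  have E2: "heis_eval (leg23 heis_unit ?W) z1 z2 z3 G = \<epsilon> z1 * (\<epsilon> z2 * (sum2 60 V_tilde $ \<lambda>V1 V2. G 1 (S (V2 * z3)) V1))"
    if G: "lin3 G" for z1 z2 z3 G
    using basis_sum[of "\<lambda>t. G 1 (S (v2 * t)) v1" 90 z3 for v1 v2] lin3_slots[OF G]
    by (simp add: heis_eval_fst_snd legs heis_unit_def sum_mult_left lin_antipode)
  have E3: "heis_eval (heis_mult3 (leg12 heis_unit ?W) (leg13 heis_unit ?W)) z1 z2 z3 G =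
    \<epsilon> z1 * (sum2 61 V_tilde $ \<lambda>V1 V2. sum2 60 V_tilde $ \<lambda>U1 U2. G (S (U2 * z2) * S (V2 * z3)) U1 V1)"
    if G: "lin3 G" for z1 z2 z3 G
  proof -
    note G' = lin3_slots[OF G]
    have "heis_eval (heis_mult3 (leg12 heis_unit ?W) (leg13 heis_unit ?W)) z1 z2 z3 G =
      (sum2 61 V_tilde $ \<lambda>V1 V2. B 90 $ \<lambda>i. slot 11 12 13 (S (V2 * e i), \<epsilon>) z1 $ \<lambda>z w. slot 31 32 33 (V1, e' i) z3 $ \<lambda>z' w'.
        \<epsilon> z * (\<epsilon> z' * (sum2 60 V_tilde $ \<lambda>U1 U2. G (S (U2 * z2) * w) U1 w')))"
      by (simp add: heis_eval_mult W_hat_legs_sum[where j = 61 and n = 90] E1 lin_antipode lin_slot G' slot_heis_unit)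
    then show ?thesis
      using basis_slots_counit2[OF T, of "\<lambda>w w'. sum2 60 V_tilde $ \<lambda>U1 U2. G (S (U2 * z2) * w) U1 w'" 90 11 12 13 v2 z1 31 32 33 v1 z3 for v1 v2]
      by (simp add: lin_antipode G' sum_mult_left)
  qed
  have E4: "heis_eval (heis_mult3 (leg23 heis_unit ?W) (leg12 heis_unit ?W)) z1 z2 z3 G =
    \<epsilon> z1 * (sum2 61 V_tilde $ \<lambda>V1 V2. sum2 60 V_tilde $ \<lambda>U1 U2. G (S (V2 * z2)) (S (U2 * z3) * V1) U1)"
    if G: "lin3 G" for z1 z2 z3 G
  proof -
    note G' = lin3_slots[OF G]
    have "heis_eval (heis_mult3 (leg23 heis_unit ?W) (leg12 heis_unit ?W)) z1 z2 z3 G =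
      (sum2 61 V_tilde $ \<lambda>V1 V2. B 90 $ \<lambda>i. slot 11 12 13 (S (V2 * e i), \<epsilon>) z1 $ \<lambda>z w. slot 21 22 23 (V1, e' i) z2 $ \<lambda>z' w'.
        \<epsilon> z * (\<epsilon> z' * (sum2 60 V_tilde $ \<lambda>U1 U2. G w (S (U2 * z3) * w') U1)))"
      by (simp add: heis_eval_mult W_hat_legs_sum[where j = 61 and n = 90] E2 lin_antipode lin_slot G' slot_heis_unit)
    then show ?thesis
      using basis_slots_counit2[OF T, of "\<lambda>w w'. sum2 60 V_tilde $ \<lambda>U1 U2. G w (S (U2 * z3) * w') U1" 90 11 12 13 v2 z1 21 22 23 v1 z2 for v1 v2]
      by (simp add: lin_antipode G' sum_mult_left)
  qed
  note G' = lin3_slots[OF G]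
  have "heis_eval (heis_mult3 (heis_mult3 (leg12 heis_unit ?W) (leg13 heis_unit ?W)) (leg23 heis_unit ?W)) y1 y2 y3 G =
    (sum2 62 V_tilde $ \<lambda>W1 W2. B 90 $ \<lambda>i. slot 21 22 23 (S (W2 * e i), \<epsilon>) y2 $ \<lambda>z w. slot 31 32 33 (W1, e' i) y3 $ \<lambda>z' w'.
      \<epsilon> y1 * (sum2 61 V_tilde $ \<lambda>V1 V2. sum2 60 V_tilde $ \<lambda>U1 U2. G (S (U2 * z) * S (V2 * z')) (U1 * w) (V1 * w')))"
    by (simp add: heis_eval_mult[of _ "leg23 heis_unit ?W"] W_hat_legs_sum[where j = 62 and n = 90] E3 lin_antipode lin_slot G' slot_heis_unit)
  also have "\<dots> = \<epsilon> y1 * (sum2 62 V_tilde $ \<lambda>W1 W2. D 64 W1 $ \<lambda>p1 p2. N 63 $ \<lambda>x1 x2 x3. D 33 y3 $ \<lambda>q1 q2.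
      D 34 (S q2) $ \<lambda>c1 c2. D 65 (S (W2 * x3)) $ \<lambda>s1 s2. sum2 61 V_tilde $ \<lambda>V1 V2. sum2 60 V_tilde $ \<lambda>U1 U2.
      G (S (V2 * p2 * x2 * (q1 * U2 * c2) * s2 * y2)) (U1 * c1 * s1) (V1 * p1 * x1))"
    using basis_slots[OF T, of "\<lambda>z w z' w'. \<epsilon> y1 * (sum2 61 V_tilde $ \<lambda>V1 V2. sum2 60 V_tilde $ \<lambda>U1 U2.
        G (S (U2 * z) * S (V2 * z')) (U1 * w) (V1 * w'))" 90 21 22 23 v2 y2 31 32 33 v1 y3 for v1 v2]
    by (simp add: lin_antipode G' antipode_mult mult.assoc D_mult[of _ 21 _ _ 34 35] sum_mult_left)
      (simp add: sum2_def sum3_def)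
  \<comment> \<open>\<open>V_tilde_shift\<close> gathers the scattered coproduct of
    \<open>y3\<close> into a single factor \<open>S y3\<close>. Afterwards the evaluation points are
    fixed outer factors, and \<open>V_tilde_pentagon\<close> applies.\<close>
  also have "\<dots> = \<epsilon> y1 * (sum2 60 V_tilde $ \<lambda>U1 U2. sum2 61 V_tilde $ \<lambda>V1 V2. sum2 62 V_tilde $ \<lambda>W1 W2. N 63 $ \<lambda>x1 x2 x3.
      D 64 W1 $ \<lambda>p1 p2. D 65 (S (W2 * x3)) $ \<lambda>s1 s2.
      G (S (V2 * p2 * x2 * U2 * s2 * y2)) (S y3 * (U1 * s1)) (V1 * p1 * x1))"
    using V_tilde_shift[OF surj_antipode, of "\<lambda>A B. sum2 61 V_tilde $ \<lambda>V1 V2. sum2 62 V_tilde $ \<lambda>W1 W2. N 63 $ \<lambda>x1 x2 x3.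
      D 64 W1 $ \<lambda>p1 p2. D 65 (S (W2 * x3)) $ \<lambda>s1 s2. G (S (V2 * p2 * x2 * B * s2 * y2)) (A * s1) (V1 * p1 * x1)" 60 33 y3 34]
    by (simp add: sweedler G')
  also have "\<dots> = \<epsilon> y1 * (P 62 $ \<lambda>X1 X2 X3. D 63 (S X2) $ \<lambda>s1 s2. D 64 (S X3) $ \<lambda>t1 t2.
      sum2 60 V_tilde $ \<lambda>U1 U2. sum2 61 V_tilde $ \<lambda>V1 V2.
      G (S (X1 * U2 * s2 * y2)) (S y3 * (S (V2 * t2) * U1 * s1)) (V1 * t1))"
    using V_tilde_pentagon[OF surj_antipode, of "\<lambda>A B C. G (S (A * y2)) (S y3 * B) C" 60 61 62 63 64 65]
    by (simp add: sweedler G')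
  also have "\<dots> = (P 62 $ \<lambda>X1 X2 X3. slot 11 12 13 (S X1, \<epsilon>) y1 $ \<lambda>z1 w1. slot 21 22 23 (S X2, \<epsilon>) y2 $ \<lambda>z2 w2. slot 31 32 33 (S X3, \<epsilon>) y3 $ \<lambda>z3 w3.
      \<epsilon> z1 * (sum2 61 V_tilde $ \<lambda>V1 V2. sum2 60 V_tilde $ \<lambda>U1 U2. G (S (V2 * z2) * w1) (S (U2 * z3) * V1 * w2) (U1 * w3)))"
    by (simp add: slot_counit slot_dual lin_epsilon sum_mult_left lin_antipode lin_slot G' antipode_mult mult.assoc)
      (simp add: sum2_def sum3_def)
  also have "\<dots> = heis_eval (heis_mult3 (heis_mult3 (leg23 heis_unit ?W) (leg12 heis_unit ?W)) Phi_S) y1 y2 y3 G"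
    by (simp add: heis_eval_mult[of _ Phi_S] E4 lin_antipode G')
      (simp add: Phi_S_def sum3_def o_def case_prod_unfold)
  finally show "heis_eval (heis_mult3 (heis_mult3 (leg12 heis_unit ?W) (leg13 heis_unit ?W)) (leg23 heis_unit ?W)) y1 y2 y3 G =
    heis_eval (heis_mult3 (heis_mult3 (leg23 heis_unit ?W) (leg12 heis_unit ?W)) Phi_S) y1 y2 y3 G" .
next
  let ?W = "W_hat I e e'"
  fix p assume "p \<in> set (heis_mult3 (heis_mult3 (leg12 heis_unit ?W) (leg13 heis_unit ?W)) (leg23 heis_unit ?W)) \<union>
    set (heis_mult3 (heis_mult3 (leg23 heis_unit ?W) (leg12 heis_unit ?W)) Phi_S)"
  moreover note L = legs_dual(1,2,3)[OF W_dual(2)] legs_dual(3,1)[OF W_dual(2)] Phi_dual(2)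
  ultimately show "p \<in> heis_basis"
    using heis_mult3_dual[OF heis_mult3_dual[OF L(1,2)] L(3)] heis_mult3_dual[OF heis_mult3_dual[OF L(4,5)] L(6)] by blast
qed (simp add: dual_iff_lin lin_e')

end

lemma (in vector_space) dual_basis_expansion:
  assumes I: "finite I" and e: "basis_family scale I e" and e': "dual_basis_family scale I e e'"
  shows "(\<Sum>i\<in>I. scale (e' i x) (e i)) = x"
proof -
  have "x \<in> span (e ` I)" using e by (simp add: basis_family_def)
  then show ?thesis
  proof (induction rule: span_induct_alt)
    case base
    have "e' i 0 = 0" if "i \<in> I" for i
    proof -
      interpret f: Vector_Spaces.linear scale "(*)" "e' i"
        using e' that by (simp add: dual_basis_family_def dual_def)
      show ?thesis by (rule f.zero)
    qed
    then show ?case by simp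
  next
    case (step c b y)
    then obtain j where j: "j \<in> I" "b = e j" by auto
    have "e' i (scale c b + y) = (if i = j then c else 0) + e' i y" if "i \<in> I" for i
    proof -
      interpret f: Vector_Spaces.linear scale "(*)" "e' i"
        using e' that by (simp add: dual_basis_family_def dual_def)
      show ?thesis using e' that j by (simp add: f.add f.scale dual_basis_family_def)
    qed
    then have "(\<Sum>i\<in>I. scale (e' i (scale c b + y)) (e i)) =
      (\<Sum>i\<in>I. (if i = j then scale c (e i) else 0)) + (\<Sum>i\<in>I. scale (e' i y) (e i))"
      by (simp add: scale_left_distrib sum.distrib if_distrib[of "\<lambda>c. scale c _"] cong: if_cong)
    then show ?case using I j step by simp
  qed
qed

theorem theorem4p5:
  fixes scale :: "'k::field \<Rightarrow> 'h::ring_1 \<Rightarrow> 'h"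
    and \<Delta> :: "'h \<Rightarrow> ('h \<times> 'h) list"
    and \<epsilon> :: "'h \<Rightarrow> 'k"
    and \<Phi> \<Phi>' :: "('h \<times> 'h \<times> 'h) list"
    and \<alpha> \<beta> :: 'h
    and S :: "'h \<Rightarrow> 'h"
    and I :: "'i set"
    and e :: "'i \<Rightarrow> 'h"
    and e' :: "'i \<Rightarrow> 'h \<Rightarrow> 'k"
  assumes "quasi_hopf_algebra scale \<Delta> \<epsilon> \<Phi> \<Phi>' \<alpha> \<beta> S"
    and "finite I"
    and "basis_family scale I e"
    and "dual_basis_family scale I e e'"
  shows
    "(let mul = quasi_bialgebra.heis_mult3 \<Delta> \<Phi>';
          u = quasi_bialgebra.heis_unit \<epsilon>;
          W = quasi_bialgebra.W_bar \<epsilon> I e e';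
          Phi321 = quasi_bialgebra.Phi_inv_321 \<epsilon> \<Phi>'
      in heis_tensor3 scale (mul (mul (leg23 u W) (leg13 u W)) (leg12 u W)) =
         heis_tensor3 scale (mul (mul Phi321 (leg12 u W)) (leg23 u W)))
   \<and> (let mul = quasi_bialgebra.heis_mult3 \<Delta> \<Phi>';
          u = quasi_bialgebra.heis_unit \<epsilon>;
          W = quasi_hopf_algebra.W_hat \<Delta> \<epsilon> \<Phi> \<Phi>' \<alpha> \<beta> S I e e';
          PhiS = quasi_hopf_algebra.Phi_S \<epsilon> \<Phi> S
      in heis_tensor3 scale (mul (mul (leg12 u W) (leg13 u W)) (leg23 u W)) =
         heis_tensor3 scale (mul (mul (leg23 u W) (leg12 u W)) PhiS))"
proof -
  interpret H: quasi_hopf_algebra scale \<Delta> \<epsilon> \<Phi> \<Phi>' \<alpha> \<beta> S by fact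
  \<comment> \<open>Outside \<open>I\<close> the functions \<open>e' i\<close> are arbitrary, while the locale wants all of them linear.\<close>
  define f where "f i = (if i \<in> I then e' i else (\<lambda>_. 0))" for i
  have "H.lin (f i)" for i
  proof (cases "i \<in> I")
    case True
    then have "Vector_Spaces.linear scale (*) (e' i)" using assms(4) by (simp add: dual_basis_family_def dual_def)
    then interpret g: Vector_Spaces.linear scale "(*)" "e' i" .
    show ?thesis using True by (simp add: f_def H.lin_def g.add g.scale)
  qed (simp add: f_def H.lin_def)
  moreover have "(\<Sum>i\<in>I. scale (f i x) (e i)) = x" for x
    using H.dual_basis_expansion[OF assms(2-4)] by (simp add: f_def)
  ultimately interpret HB: quasi_hopf_algebra_basis scale \<Delta> \<epsilon> \<Phi> \<Phi>' \<alpha> \<beta> S I e f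
    using assms(2) by unfold_locales
  have "H.W_bar I e e' = H.W_bar I e f" "H.W_hat I e e' = H.W_hat I e f"
    using enum_list(1)[OF assms(2)]
    by (auto simp: H.W_bar_def H.W_hat_def f_def intro!: arg_cong[where f = concat])
  then show ?thesis
    using HB.W_bar_pentagon HB.W_hat_pentagon by (simp add: Let_def)
qed

end
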